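(* Let $A,B$ be closed base types and let $f:[\![A]\!]\to[\![B]\!]$ be a computable partial injective function, where $[\![-]\!]$ is the interpretation of the language in $\mathbf{PInj}$. Then there is a closed well-typed iso $\vdash_\omega\omega:A\leftrightarrow B$ such that $[\![\omega]\!]=f$.
   Context: The language: closed base types built from $\mathbb{1}$, $\oplus$, $\otimes$ and inductive types $\mu X.A$; values $v::=()\mid x\mid \mathtt{inl}\,v\mid\mathtt{inr}\,v\mid\langle v_1,v_2\rangle\mid \mathtt{fold}\,v$; patterns $p::=x\mid\langle p_1,p_2\rangle$; expressions $e::=v\mid \mathtt{let}\,p_1=\omega\,p_2\,\mathtt{in}\,e$; isos $\omega::=\{v_1\leftrightarrow e_1\mid\dots\mid v_n\leftrightarrow e_n\}\mid \mathtt{fix}\,\phi.\omega\mid\lambda\phi.\omega\mid\phi\mid\omega_1\omega_2$; iso types $A\leftrightarrow B$, $T_1\to T_2$. Typing: a clause-set $\{v_i\leftrightarrow e_i\}$ has type $A\leftrightarrow B$ when each $v_i:A$ and $e_i:B$ use the same linear context of variables, and left-hand sides are pairwise orthogonal and right-hand sides pairwise orthogonal ($\perp$ is the smallest relation with $\mathtt{inl}\,t_1\perp\mathtt{inr}\,t_2$, $\mathtt{inr}\,t_1\perp\mathtt{inl}\,t_2$, closed under the constructors $\mathtt{inl},\mathtt{inr},\mathtt{fold}$, pairing with an arbitrary term, and the body of a $\mathtt{let}$); $\mathtt{fix}\,\phi.\omega:T$ when $\omega:T$ under $\phi:T$; $\lambda$ and application as usual; terms are typed linearly, with $\mathtt{fold}\,t:\mu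 X.A$ when $t:A[\mu X.A/X]$. Semantics in $\mathbf{PInj}$ (sets and partial injections): $[\![\mathbb{1}]\!]$ a singleton, $\oplus$ disjoint union, $\otimes$ cartesian product, $[\![\mu X.A]\!]$ the least fixed point (initial algebra), so elements of $[\![A]\!]$ correspond to closed values of type $A$ (finite syntax trees); an iso $A\leftrightarrow B$ denotes a partial injection $[\![A]\!]\to[\![B]\!]$, a clause-set $\{v_i\leftrightarrow e_i\}$ denoting the join $\bigvee_i[\![e_i]\!]\circ[\![v_i]\!]^\circ$ and $\mathtt{fix}$ the least fixed point. "Computable" refers to computability under this identification of elements with finite closed values. *)

theory Defs
  imports Main "HOL-Library.FSet"
begin

section \<open>Types\<close>

text \<open>Type variables are de Bruijn indices, so that types are identified up to renaming of the
  variable bound by \<open>\<mu>\<close>.\<close>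

datatype ty =
    TVar nat
  | TOne
  | TSum ty ty
  | TProd ty ty
  | TMu ty

primrec ty_scoped :: "ty \<Rightarrow> nat \<Rightarrow> bool" where
  "ty_scoped (TVar n) k \<longleftrightarrow> n < k"
| "ty_scoped TOne k \<longleftrightarrow> True"
| "ty_scoped (TSum A B) k \<longleftrightarrow> ty_scoped A k \<and> ty_scoped B k"
| "ty_scoped (TProd A B) k \<longleftrightarrow> ty_scoped A k \<and> ty_scoped B k"
| "ty_scoped (TMu A) k \<longleftrightarrow> ty_scoped A (Suc k)"

definition closed_ty :: "ty \<Rightarrow> bool" where
  "closed_ty A \<longleftrightarrow> ty_scoped A 0"

text \<open>\<open>ty_subst A k C\<close> is \<open>A[C/k]\<close>. It is only used with a closed type \<open>C\<close>, hence \<open>C\<close> is not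
  lifted when passing under \<open>\<mu>\<close>.\<close>

primrec ty_subst :: "ty \<Rightarrow> nat \<Rightarrow> ty \<Rightarrow> ty" where
  "ty_subst (TVar n) k C = (if n = k then C else if n < k then TVar n else TVar (n - 1))"
| "ty_subst TOne k C = TOne"
| "ty_subst (TSum A B) k C = TSum (ty_subst A k C) (ty_subst B k C)"
| "ty_subst (TProd A B) k C = TProd (ty_subst A k C) (ty_subst B k C)"
| "ty_subst (TMu A) k C = TMu (ty_subst A (Suc k) C)"

datatype ity =
    TIso ty ty
  | TFun ity ity

primrec closed_ity :: "ity \<Rightarrow> bool" where
  "closed_ity (TIso A B) \<longleftrightarrow> closed_ty A \<and> closed_ty B"
| "closed_ity (TFun T1 T2) \<longleftrightarrow> closed_ity T1 \<and> closed_ity T2"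

section \<open>Syntax\<close>

text \<open>Term variables and iso variables are named by natural numbers. A clause-set carries its type
  \<open>A \<leftrightarrow> B\<close> (\<open>{x \<leftrightarrow> x}\<close> has many types, and its denotation depends on the chosen one); with this
  annotation the denotation is a function of the term instead of the typing derivation.\<close>

datatype val =
    VUnit
  | VVar nat
  | VInl val
  | VInr val
  | VPair val val
  | VFold val

datatype pat =
    PVar nat
  | PPair pat pat

datatype iso =
    Clauses ty ty "(val \<times> expr) list"
  | Fix nat iso
  | Lam nat iso
  | IVar nat
  | IApp iso iso
and expr =
    EVal val
  | ELet pat iso pat expr  \<comment> \<open>\<open>ELet p\<^sub>1 \<omega> p\<^sub>2 e\<close> is \<open>let p\<^sub>1 = \<omega> p\<^sub>2 in e\<close>\<close>

primrec pat_val :: "pat \<Rightarrow> val" where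
  "pat_val (PVar x) = VVar x"
| "pat_val (PPair p q) = VPair (pat_val p) (pat_val q)"

primrec pat_vars :: "pat \<Rightarrow> nat set" where
  "pat_vars (PVar x) = {x}"
| "pat_vars (PPair p q) = pat_vars p \<union> pat_vars q"

section \<open>Orthogonality\<close>

inductive val_orth :: "val \<Rightarrow> val \<Rightarrow> bool" where
  "val_orth (VInl v) (VInr w)"
| "val_orth (VInr v) (VInl w)"
| "val_orth v w \<Longrightarrow> val_orth (VInl v) (VInl w)"
| "val_orth v w \<Longrightarrow> val_orth (VInr v) (VInr w)"
| "val_orth v w \<Longrightarrow> val_orth (VFold v) (VFold w)"
| "val_orth v w \<Longrightarrow> val_orth (VPair v v') (VPair w w')"
| "val_orth v w \<Longrightarrow> val_orth (VPair v' v) (VPair w' w)"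

text \<open>The \<open>let\<close> rules are one-sided, so that expressions with different numbers of \<open>let\<close>s can be
  orthogonal, as needed for \<open>{[] \<leftrightarrow> [] | h::t \<leftrightarrow> let t' = \<phi> t in h::t'}\<close>. The two-sided
  rule is their composition.\<close>

inductive expr_orth :: "expr \<Rightarrow> expr \<Rightarrow> bool" where
  "val_orth v w \<Longrightarrow> expr_orth (EVal v) (EVal w)"
| "expr_orth e e' \<Longrightarrow> expr_orth (ELet p \<omega> q e) e'"
| "expr_orth e e' \<Longrightarrow> expr_orth e (ELet p \<omega> q e')"

definition pairwise_orth :: "('a \<Rightarrow> 'a \<Rightarrow> bool) \<Rightarrow> 'a list \<Rightarrow> bool" where
  "pairwise_orth R xs \<longleftrightarrow>
     (\<forall>i < length xs. \<forall>j < length xs. i \<noteq> j \<longrightarrow> R (xs ! i) (xs ! j))"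

section \<open>Typing\<close>

type_synonym ctx = "nat \<rightharpoonup> ty"
type_synonym ictx = "nat \<rightharpoonup> ity"

inductive val_typed :: "ctx \<Rightarrow> val \<Rightarrow> ty \<Rightarrow> bool" where
  "val_typed Map.empty VUnit TOne"
| "val_typed [x \<mapsto> A] (VVar x) A"
| "val_typed \<Delta> v A \<Longrightarrow> val_typed \<Delta> (VInl v) (TSum A B)"
| "val_typed \<Delta> v B \<Longrightarrow> val_typed \<Delta> (VInr v) (TSum A B)"
| "val_typed \<Delta>1 v A \<Longrightarrow> val_typed \<Delta>2 w B \<Longrightarrow> dom \<Delta>1 \<inter> dom \<Delta>2 = {} \<Longrightarrow>
   val_typed (\<Delta>1 ++ \<Delta>2) (VPair v w) (TProd A B)"
| "val_typed \<Delta> v (ty_subst A 0 (TMu A)) \<Longrightarrow> val_typed \<Delta> (VFold v) (TMu A)"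

inductive iso_typed :: "ictx \<Rightarrow> iso \<Rightarrow> ity \<Rightarrow> bool"
  and expr_typed :: "ictx \<Rightarrow> ctx \<Rightarrow> expr \<Rightarrow> ty \<Rightarrow> bool" where
  Clauses: "closed_ty A \<Longrightarrow> closed_ty B \<Longrightarrow>
   (\<forall>(v, e) \<in> set cs. \<exists>\<Delta>. val_typed \<Delta> v A \<and> expr_typed \<Psi> \<Delta> e B) \<Longrightarrow>
   pairwise_orth val_orth (map fst cs) \<Longrightarrow> pairwise_orth expr_orth (map snd cs) \<Longrightarrow>
   iso_typed \<Psi> (Clauses A B cs) (TIso A B)"
| Fix: "closed_ity T \<Longrightarrow> iso_typed (\<Psi>(\<phi> \<mapsto> T)) \<omega> T \<Longrightarrow> iso_typed \<Psi> (Fix \<phi> \<omega>) T"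
| Lam: "closed_ity T1 \<Longrightarrow> iso_typed (\<Psi>(\<phi> \<mapsto> T1)) \<omega> T2 \<Longrightarrow>
   iso_typed \<Psi> (Lam \<phi> \<omega>) (TFun T1 T2)"
| IVar: "\<Psi> \<phi> = Some T \<Longrightarrow> iso_typed \<Psi> (IVar \<phi>) T"
| IApp: "iso_typed \<Psi> \<omega>1 (TFun T1 T2) \<Longrightarrow> iso_typed \<Psi> \<omega>2 T1 \<Longrightarrow>
   iso_typed \<Psi> (IApp \<omega>1 \<omega>2) T2"
| EVal: "val_typed \<Delta> v A \<Longrightarrow> expr_typed \<Psi> \<Delta> (EVal v) A"
| ELet: "val_typed \<Delta>1 (pat_val p2) A \<Longrightarrow> iso_typed \<Psi> \<omega> (TIso A B) \<Longrightarrow>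
   val_typed \<Gamma> (pat_val p1) B \<Longrightarrow> expr_typed \<Psi> (\<Delta>2 ++ \<Gamma>) e C \<Longrightarrow>
   dom \<Delta>1 \<inter> dom \<Delta>2 = {} \<Longrightarrow> dom \<Delta>2 \<inter> dom \<Gamma> = {} \<Longrightarrow>
   expr_typed \<Psi> (\<Delta>1 ++ \<Delta>2) (ELet p1 \<omega> p2 e) C"

section \<open>Denotation of base types\<close>

text \<open>All sets \<open>\<lbrakk>A\<rbrakk>\<close> live in the type of finite trees \<open>dat\<close>; \<open>DFold\<close> is the structure map of the
  initial algebras, so that the elements of \<open>\<lbrakk>A\<rbrakk>\<close> are the closed values of type \<open>A\<close>.\<close>

datatype dat =
    DUnit
  | DInl dat
  | DInr dat
  | DPair dat dat
  | DFold dat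

primrec ty_den :: "ty \<Rightarrow> (nat \<Rightarrow> dat set) \<Rightarrow> dat set" where
  "ty_den (TVar n) \<rho> = \<rho> n"
| "ty_den TOne \<rho> = {DUnit}"
| "ty_den (TSum A B) \<rho> = DInl ` ty_den A \<rho> \<union> DInr ` ty_den B \<rho>"
| "ty_den (TProd A B) \<rho> = {DPair a b | a b. a \<in> ty_den A \<rho> \<and> b \<in> ty_den B \<rho>}"
| "ty_den (TMu A) \<rho> = lfp (\<lambda>S. DFold ` ty_den A (case_nat S \<rho>))"

definition carrier_of :: "ty \<Rightarrow> dat set" where
  "carrier_of A = ty_den A (\<lambda>_. {})"

lemma ty_den_mono: "(\<And>n. \<rho> n \<subseteq> \<rho>' n) \<Longrightarrow> ty_den A \<rho> \<subseteq> ty_den A \<rho>'"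
proof (induction A arbitrary: \<rho> \<rho>')
  case (TMu A)
  have "DFold ` ty_den A (case_nat S \<rho>) \<subseteq> DFold ` ty_den A (case_nat S \<rho>')" for S
    by (intro image_mono TMu.IH) (auto split: nat.split simp: subsetD[OF TMu.prems])
  then show ?case
    by (simp add: lfp_mono)
next
  case (TSum A B)
  then show ?case by (simp, blast)
next
  case (TProd A B)
  then show ?case by (simp, blast)
qed auto

section \<open>Denotation of isos\<close>

text \<open>A partial injection is represented by its graph, as a set of tokens \<open>Arc a b\<close>, and a
  Scott-continuous function between denotations of iso types by its trace, as a set of tokens
  \<open>Step \<beta> t\<close> (for the finite argument \<open>\<beta>\<close> the result contains \<open>t\<close>). This is the graph model of
  Engeler and Plotkin, which provides one HOL type for the denotations of isos of all types.
  The order is inclusion; on graphs it is the order of \<open>PInj\<close>, where joins are unions.\<close>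

datatype tok =
    Arc dat dat
  | Step "tok fset" tok

primrec val_den :: "val \<Rightarrow> (nat \<Rightarrow> dat) \<Rightarrow> dat" where
  "val_den VUnit \<sigma> = DUnit"
| "val_den (VVar x) \<sigma> = \<sigma> x"
| "val_den (VInl v) \<sigma> = DInl (val_den v \<sigma>)"
| "val_den (VInr v) \<sigma> = DInr (val_den v \<sigma>)"
| "val_den (VPair v w) \<sigma> = DPair (val_den v \<sigma>) (val_den w \<sigma>)"
| "val_den (VFold v) \<sigma> = DFold (val_den v \<sigma>)"

text \<open>\<open>expr_den e \<eta> \<sigma>\<close> is the set of results of \<open>e\<close> at the valuation \<open>\<sigma>\<close>; for well-typed \<open>e\<close> it has
  at most one element. In the equation for clause-sets, \<open>a \<in> \<lbrakk>A\<rbrakk>\<close> forces the valuation to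
  be well-typed on the variables of \<open>v\<close>; its other values are irrelevant to \<open>e\<close>.\<close>

function (sequential)
  iso_den :: "iso \<Rightarrow> (nat \<Rightarrow> tok set) \<Rightarrow> tok set"
  and expr_den :: "expr \<Rightarrow> (nat \<Rightarrow> tok set) \<Rightarrow> (nat \<Rightarrow> dat) \<Rightarrow> dat set" where
  "iso_den (Clauses A B cs) \<eta> =
     (\<Union>(v, e) \<in> set cs. {Arc a b | a b \<sigma>. a \<in> carrier_of A \<and> val_den v \<sigma> = a \<and> b \<in> expr_den e \<eta> \<sigma>})"
| "iso_den (Fix \<phi> \<omega>) \<eta> = lfp (\<lambda>d. iso_den \<omega> (\<eta>(\<phi> := d)))"
| "iso_den (Lam \<phi> \<omega>) \<eta> = {Step \<beta> t | \<beta> t. t \<in> iso_den \<omega> (\<eta>(\<phi> := fset \<beta>))}"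
| "iso_den (IVar \<phi>) \<eta> = \<eta> \<phi>"
| "iso_den (IApp \<omega>1 \<omega>2) \<eta> = {t. \<exists>\<beta>. Step \<beta> t \<in> iso_den \<omega>1 \<eta> \<and> fset \<beta> \<subseteq> iso_den \<omega>2 \<eta>}"
| "expr_den (EVal v) \<eta> \<sigma> = {val_den v \<sigma>}"
| "expr_den (ELet p1 \<omega> p2 e) \<eta> \<sigma> =
     {c. \<exists>\<sigma>'. Arc (val_den (pat_val p2) \<sigma>) (val_den (pat_val p1) \<sigma>') \<in> iso_den \<omega> \<eta>
            \<and> (\<forall>x. x \<notin> pat_vars p1 \<longrightarrow> \<sigma>' x = \<sigma> x)
            \<and> c \<in> expr_den e \<eta> \<sigma>'}"
  by pat_completeness auto
termination
proof (relation "measure (case_sum (size \<circ> fst) (size \<circ> fst))", goal_cases)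
  case (2 A B cs \<eta> ve v e \<sigma>)
  then have "size_prod (\<lambda>_. 0) size (v, e) \<le> size_list (size_prod (\<lambda>_. 0) size) cs"
    by (intro size_list_estimation') auto
  then show ?case by simp
qed simp_all

lemma iso_den_mono: "(\<And>\<phi>. \<eta> \<phi> \<subseteq> \<eta>' \<phi>) \<Longrightarrow> iso_den \<omega> \<eta> \<subseteq> iso_den \<omega> \<eta>'"
  and expr_den_mono: "(\<And>\<phi>. \<eta> \<phi> \<subseteq> \<eta>' \<phi>) \<Longrightarrow> expr_den e \<eta> \<sigma> \<subseteq> expr_den e \<eta>' \<sigma>"
proof (induction \<omega> \<eta> and e \<eta> \<sigma> arbitrary: \<eta>' and \<eta>' rule: iso_den_expr_den.induct)
  case (1 A B cs \<eta>)
  have "expr_den e \<eta> \<sigma> \<subseteq> expr_den e \<eta>' \<sigma>" if "(v, e) \<in> set cs" for v e \<sigma>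
    by (rule "1.IH"[OF that refl]) (rule "1.prems")
  then show ?case
    unfolding iso_den.simps by (intro UN_mono order.refl) blast
next
  case (2 \<phi> \<omega> \<eta>)
  have "iso_den \<omega> (\<eta>(\<phi> := d)) \<subseteq> iso_den \<omega> (\<eta>'(\<phi> := d))" for d
    by (rule "2.IH") (simp add: "2.prems")
  then show ?case by (simp add: lfp_mono)
next
  case (3 \<phi> \<omega> \<eta>)
  have "iso_den \<omega> (\<eta>(\<phi> := fset \<beta>)) \<subseteq> iso_den \<omega> (\<eta>'(\<phi> := fset \<beta>))" for \<beta>
    by (rule "3.IH") (simp add: "3.prems")
  then show ?case by auto
next
  case (5 \<omega>1 \<omega>2 \<eta>)
  have "iso_den \<omega>1 \<eta> \<subseteq> iso_den \<omega>1 \<eta>'" "iso_den \<omega>2 \<eta> \<subseteq> iso_den \<omega>2 \<eta>'"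
    by (rule "5.IH", rule "5.prems")+
  then show ?case unfolding iso_den.simps by blast
next
  case (7 p1 \<omega> p2 e \<eta> \<sigma>)
  have "iso_den \<omega> \<eta> \<subseteq> iso_den \<omega> \<eta>'" "\<And>\<sigma>. expr_den e \<eta> \<sigma> \<subseteq> expr_den e \<eta>' \<sigma>"
    by (rule "7.IH", rule "7.prems")+
  then show ?case unfolding expr_den.simps by blast
qed simp_all

definition closed_iso_den :: "iso \<Rightarrow> tok set" where
  "closed_iso_den \<omega> = iso_den \<omega> (\<lambda>_. {})"

definition partial_injection :: "dat set \<Rightarrow> dat set \<Rightarrow> (dat \<rightharpoonup> dat) \<Rightarrow> bool" where
  "partial_injection X Y f \<longleftrightarrow> dom f \<subseteq> X \<and> ran f \<subseteq> Y \<and> inj_on f (dom f)"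

definition arcs :: "(dat \<rightharpoonup> dat) \<Rightarrow> tok set" where
  "arcs f = {Arc a b | a b. f a = Some b}"

section \<open>Computability\<close>

text \<open>Deterministic Turing machines with one two-way infinite tape. States and symbols are natural
  numbers; the start state and the blank are 0. Finiteness of the transition table bounds the
  states and symbols that can occur. A machine halts when no transition applies.\<close>

datatype dir = MoveL | MoveR

type_synonym tm = "nat \<times> nat \<rightharpoonup> nat \<times> nat \<times> dir"
type_synonym config = "nat \<times> (int \<Rightarrow> nat) \<times> int"

primrec move :: "dir \<Rightarrow> int \<Rightarrow> int" where
  "move MoveL h = h - 1"
| "move MoveR h = h + 1"

fun tm_step :: "tm \<Rightarrow> config \<Rightarrow> config option" where
  "tm_step \<delta> (q, t, h) =
     map_option (\<lambda>(q', s, m). (q', t(h := s), move m h)) (\<delta> (q, t h))"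

definition tm_start :: "nat list \<Rightarrow> config" where
  "tm_start w = (0, \<lambda>i. if 0 \<le> i \<and> i < int (length w) then w ! nat i else 0, 0)"

definition tm_final :: "tm \<Rightarrow> nat list \<Rightarrow> config \<Rightarrow> bool" where
  "tm_final \<delta> w c \<longleftrightarrow> (tm_start w, c) \<in> {(c, c'). tm_step \<delta> c = Some c'}\<^sup>* \<and> tm_step \<delta> c = None"

text \<open>The output is the word that starts at the head and extends to the next blank.\<close>

fun tm_output :: "config \<Rightarrow> nat list \<Rightarrow> bool" where
  "tm_output (q, t, h) w \<longleftrightarrow>
     (\<forall>i < length w. t (h + int i) = w ! i \<and> w ! i \<noteq> 0) \<and> t (h + int (length w)) = 0"

text \<open>Values are presented to machines in Polish notation.\<close>

primrec word :: "dat \<Rightarrow> nat list" where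
  "word DUnit = [1]"
| "word (DInl a) = 2 # word a"
| "word (DInr a) = 3 # word a"
| "word (DPair a b) = 4 # word a @ word b"
| "word (DFold a) = 5 # word a"

definition computable_on :: "dat set \<Rightarrow> (dat \<rightharpoonup> dat) \<Rightarrow> bool" where
  "computable_on X f \<longleftrightarrow> (\<exists>\<delta>. finite (dom \<delta>) \<and>
     (\<forall>a \<in> X. case f a of
        None \<Rightarrow> \<not> (\<exists>c. tm_final \<delta> (word a) c)
      | Some b \<Rightarrow> \<exists>c. tm_final \<delta> (word a) c \<and> tm_output c (word b)))"

end

theory Submission
  imports Defs "HOL-Library.Nat_Bijection"
begin

text \<open>The relations definable by isos are closed under composition, sums, products, fixed points
  and inverses, and contain the finite pattern rewritings. The passage from
  a value to its word is therefore definable by recursion on the type, so that it suffices to define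
  the relation \<open>g\<close> that \<open>f\<close> induces on words. A machine can be simulated reversibly by recording the
  history of the run, copying the result and undoing the run. Hence the predicate \<open>P w v c\<close> stating
  that \<open>c\<close> consists of the running times of machines which check that \<open>w\<close> is the word of a value of
  type \<open>A\<close> and that the given Turing machine turns \<open>w\<close> into \<open>v\<close> is decidable within the language.
  As \<open>f\<close> is injective, each of \<open>w\<close> and \<open>v\<close> determines the triple \<open>(w, v, c)\<close>, which a search loop finds
  from either side. So \<open>g\<close> is the composition of \<open>w \<mapsto> (w, v, c)\<close> and the inverse of \<open>v \<mapsto> (w, v, c)\<close>.\<close>

section \<open>Types and their carriers\<close>

text \<open>The obstacle is partiality. Undoing a run requires its length, which is not part of the
  input, and a loop of the language cannot forget the number of its rounds. Machines are therefore
  only ever run for a number of steps that is given as an argument: this makes each check a total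
  function, whose history can be uncomputed, and moves the unknown numbers into the object that is
  searched for. The search leaves no garbage only if what it finds is unique, seen from
  \<open>w\<close> and from \<open>v\<close> alike. Two provisions serve this. An accepting state is
  left at once for a dead one, so that a running time is determined by the run. And \<open>w\<close>
  is parsed against the type \<open>A\<close>, because the Turing machine is constrained only on
  words of values of \<open>A\<close>: on another word it could halt with an output that is also the
  word of some \<open>f a\<close>, and then \<open>v\<close> would no longer determine
  \<open>w\<close>. Inverses cost nothing, since every relation is constructed together with its
  inverse.\<close>

lemma ty_scoped_mono: "ty_scoped A k \<Longrightarrow> k \<le> l \<Longrightarrow> ty_scoped A l"
proof (induction A arbitrary: k l)
  case (TMu A)
  then show ?case using TMu.IH[of "Suc k" "Suc l"] by simp
qed (simp, simp, (simp, blast)+)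

lemma ty_subst_scoped: "ty_scoped A k \<Longrightarrow> k \<le> j \<Longrightarrow> ty_subst A j C = A"
proof (induction A arbitrary: k j)
  case (TMu A)
  then show ?case using TMu.IH[of "Suc k" "Suc j"] by simp
qed (simp, simp, (simp, blast)+)

lemma ty_subst_closed [simp]: "closed_ty A \<Longrightarrow> ty_subst A j C = A"
  unfolding closed_ty_def by (rule ty_subst_scoped) auto

lemma closed_ty_scoped: "closed_ty A \<Longrightarrow> ty_scoped A k"
  unfolding closed_ty_def by (rule ty_scoped_mono) auto

lemma closed_ty_simps [simp]:
  "closed_ty TOne"
  "closed_ty (TSum A B) \<longleftrightarrow> closed_ty A \<and> closed_ty B"
  "closed_ty (TProd A B) \<longleftrightarrow> closed_ty A \<and> closed_ty B"
  by (simp_all add: closed_ty_def)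

text \<open>Simultaneous substitution of closed types for the indices from \<open>j\<close> on. An
  unfolded \<open>\<mu>\<close>-type is in general larger than the original, so recursions descend
  through the open type \<open>A\<close> and collect the unfolded \<open>\<mu>\<close>-types in
  \<open>Cs\<close>.\<close>

primrec psubst :: "ty \<Rightarrow> nat \<Rightarrow> ty list \<Rightarrow> ty" where
  "psubst (TVar n) j Cs = (if n < j then TVar n else Cs ! (n - j))"
| "psubst TOne j Cs = TOne"
| "psubst (TSum A B) j Cs = TSum (psubst A j Cs) (psubst B j Cs)"
| "psubst (TProd A B) j Cs = TProd (psubst A j Cs) (psubst B j Cs)"
| "psubst (TMu A) j Cs = TMu (psubst A (Suc j) Cs)"

lemma psubst_scoped: "ty_scoped A j \<Longrightarrow> psubst A j Cs = A"
  by (induction A arbitrary: j) auto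

lemma psubst_closed: "closed_ty A \<Longrightarrow> psubst A 0 Cs = A"
  by (simp add: closed_ty_def psubst_scoped)

lemma ty_scoped_psubst:
  "ty_scoped A (j + length Cs) \<Longrightarrow> \<forall>C \<in> set Cs. closed_ty C \<Longrightarrow> ty_scoped (psubst A j Cs) j"
proof (induction A arbitrary: j)
  case (TVar n)
  then show ?case by (cases "n < j") (simp_all add: closed_ty_scoped)
qed simp_all

lemma closed_psubst:
  "ty_scoped A (length Cs) \<Longrightarrow> \<forall>C \<in> set Cs. closed_ty C \<Longrightarrow> closed_ty (psubst A 0 Cs)"
  using ty_scoped_psubst[of A 0 Cs] by (simp add: closed_ty_def)

text \<open>For \<open>j = 0\<close> and \<open>C\<close> the \<open>\<mu>\<close>-type itself, this
  says that unfolding prolongs the list \<open>Cs\<close> at its head.\<close>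

lemma ty_subst_psubst:
  "ty_scoped A (Suc j + length Cs) \<Longrightarrow> \<forall>C \<in> set Cs. closed_ty C \<Longrightarrow>
   ty_subst (psubst A (Suc j) Cs) j C = psubst A j (C # Cs)"
proof (induction A arbitrary: j)
  case (TVar n)
  show ?case
  proof (cases "n < Suc j")
    case False
    then have "Cs ! (n - Suc j) \<in> set Cs" using TVar by (intro nth_mem) auto
    moreover have "(C # Cs) ! (n - j) = Cs ! (n - Suc j)"
      using False by (simp add: nth_Cons')
    ultimately show ?thesis using False TVar by simp
  qed auto
qed auto

lemma ty_den_psubst:
  "ty_scoped A (j + length Cs) \<Longrightarrow> \<forall>C \<in> set Cs. closed_ty C \<Longrightarrow>
   (\<And>C \<rho>. C \<in> set Cs \<Longrightarrow> ty_den C \<rho> = carrier_of C) \<Longrightarrow>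
   ty_den (psubst A j Cs) \<rho> =
   ty_den A (\<lambda>n. if n < j then \<rho> n else carrier_of (Cs ! (n - j)))"
proof (induction A arbitrary: j \<rho>)
  case (TVar n)
  then show ?case by auto
next
  case (TMu A)
  have "ty_den (psubst A (Suc j) Cs) (case_nat S \<rho>) =
    ty_den A (case_nat S (\<lambda>n. if n < j then \<rho> n else carrier_of (Cs ! (n - j))))" for S
    using TMu.prems
    by (subst TMu.IH) (auto intro!: arg_cong[where f="ty_den A"] simp: fun_eq_iff split: nat.split)
  then show ?case by simp
qed auto

lemma ty_den_cong: "ty_scoped A k \<Longrightarrow> (\<And>n. n < k \<Longrightarrow> \<rho> n = \<rho>' n) \<Longrightarrow> ty_den A \<rho> = ty_den A \<rho>'"
proof (induction A arbitrary: k \<rho> \<rho>')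
  case (TMu A)
  have "ty_den A (case_nat S \<rho>) = ty_den A (case_nat S \<rho>')" for S
    using TMu.prems by (intro TMu.IH[of "Suc k"]) (auto split: nat.split)
  then show ?case by simp
next
  case (TSum A B)
  have "ty_den A \<rho> = ty_den A \<rho>'" by (rule TSum.IH(1)[of k]) (use TSum.prems in simp_all)
  moreover have "ty_den B \<rho> = ty_den B \<rho>'" by (rule TSum.IH(2)[of k]) (use TSum.prems in simp_all)
  ultimately show ?case by simp
next
  case (TProd A B)
  have "ty_den A \<rho> = ty_den A \<rho>'" by (rule TProd.IH(1)[of k]) (use TProd.prems in simp_all)
  moreover have "ty_den B \<rho> = ty_den B \<rho>'" by (rule TProd.IH(2)[of k]) (use TProd.prems in simp_all)
  ultimately show ?case by simp
qed auto

lemma ty_den_closed: "closed_ty A \<Longrightarrow> ty_den A \<rho> = carrier_of A"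
  unfolding carrier_of_def closed_ty_def by (rule ty_den_cong) auto

lemma carrier_psubst:
  assumes "ty_scoped A (length Cs)" "\<forall>C \<in> set Cs. closed_ty C"
  shows "carrier_of (psubst A 0 Cs) = ty_den A (\<lambda>n. carrier_of (Cs ! n))"
  using assms ty_den_psubst[of A 0 Cs] by (simp add: carrier_of_def[of "psubst A 0 Cs"] ty_den_closed)

lemma ty_den_Mu_unfold: "ty_den (TMu A) \<rho> = DFold ` ty_den A (case_nat (ty_den (TMu A) \<rho>) \<rho>)"
proof -
  have "mono (\<lambda>S. DFold ` ty_den A (case_nat S \<rho>))"
    by (intro monoI image_mono ty_den_mono) (auto split: nat.split)
  from lfp_unfold[OF this] show ?thesis unfolding ty_den.simps(5) .
qed

text \<open>Syntactic substitution becomes a change of valuation by \<open>carrier_psubst\<close>,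
  so the fixed point equation of \<open>lfp\<close> turns into a statement about the type that the
  rule for \<open>VFold\<close> mentions.\<close>

lemma closed_ty_unfold: "closed_ty (TMu A) \<Longrightarrow> closed_ty (ty_subst A 0 (TMu A))"
  and carrier_Mu: "closed_ty (TMu A) \<Longrightarrow> carrier_of (TMu A) = DFold ` carrier_of (ty_subst A 0 (TMu A))"
proof -
  assume c: "closed_ty (TMu A)"
  then have s: "ty_scoped A (Suc 0)" by (simp add: closed_ty_def)
  then have eq: "ty_subst A 0 (TMu A) = psubst A 0 [TMu A]"
    using ty_subst_psubst[of A 0 "[]" "TMu A"] by (simp add: psubst_scoped)
  show "closed_ty (ty_subst A 0 (TMu A))"
    unfolding eq using s c by (intro closed_psubst) auto
  have car: "carrier_of (psubst A 0 [TMu A]) = ty_den A (case_nat (carrier_of (TMu A)) (\<lambda>_. {}))"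
    using s c by (subst carrier_psubst) (auto intro!: ty_den_cong[of A "Suc 0"])
  have "carrier_of (TMu A) = DFold ` ty_den A (case_nat (carrier_of (TMu A)) (\<lambda>_. {}))"
    unfolding carrier_of_def by (rule ty_den_Mu_unfold)
  then show "carrier_of (TMu A) = DFold ` carrier_of (ty_subst A 0 (TMu A))"
    unfolding eq car .
qed

lemma carrier_simps [simp]:
  "carrier_of TOne = {DUnit}"
  "carrier_of (TSum A B) = DInl ` carrier_of A \<union> DInr ` carrier_of B"
  "carrier_of (TProd A B) = {DPair a b | a b. a \<in> carrier_of A \<and> b \<in> carrier_of B}"
  by (simp_all add: carrier_of_def)

section \<open>Lists, unary numbers and finite types\<close>

definition TList :: "ty \<Rightarrow> ty" where
  "TList A = TMu (TSum TOne (TProd A (TVar 0)))"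

definition VNil :: val where "VNil = VFold (VInl VUnit)"
definition VCons :: "val \<Rightarrow> val \<Rightarrow> val" where "VCons v w = VFold (VInr (VPair v w))"
definition DNil :: dat where "DNil = DFold (DInl DUnit)"
definition DCons :: "dat \<Rightarrow> dat \<Rightarrow> dat" where "DCons a b = DFold (DInr (DPair a b))"

primrec dlist :: "dat list \<Rightarrow> dat" where
  "dlist [] = DNil"
| "dlist (x # xs) = DCons x (dlist xs)"

lemma DList_inject [simp]: "DCons a b = DCons a' b' \<longleftrightarrow> a = a' \<and> b = b'" "DNil \<noteq> DCons a b" "DCons a b \<noteq> DNil"
  by (auto simp: DNil_def DCons_def)

lemma dlist_inject [simp]: "dlist xs = dlist ys \<longleftrightarrow> xs = ys"
proof (induction xs arbitrary: ys)
  case Nil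
  show ?case by (cases ys) auto
next
  case (Cons x xs)
  then show ?case by (cases ys) auto
qed

lemma closed_TList [simp]: "closed_ty (TList A) \<longleftrightarrow> ty_scoped A (Suc 0)"
  by (simp add: TList_def closed_ty_def)

lemma closed_ty_scoped_1 [simp]: "closed_ty A \<Longrightarrow> ty_scoped A (Suc 0)"
  by (rule closed_ty_scoped)

lemma carrier_TList_unfold:
  "closed_ty A \<Longrightarrow> carrier_of (TList A) =
    insert DNil {DCons a b | a b. a \<in> carrier_of A \<and> b \<in> carrier_of (TList A)}"
  unfolding TList_def
  by (subst carrier_Mu) (auto simp: closed_ty_def[of "TMu _"] image_Un image_iff DNil_def DCons_def)

lemma carrier_TList:
  assumes "closed_ty A"
  shows "carrier_of (TList A) = dlist ` lists (carrier_of A)"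
proof
  have "carrier_of (TList A) = lfp (\<lambda>S. insert DNil {DCons a b | a b. a \<in> carrier_of A \<and> b \<in> S})"
    using assms by (simp add: TList_def carrier_of_def[of "TMu _"] ty_den_closed image_Un DNil_def DCons_def setcompr_eq_image image_image)
      (rule arg_cong[where f=lfp], auto)
  also have "\<dots> \<subseteq> dlist ` lists (carrier_of A)"
  proof (rule lfp_lowerbound, safe)
    fix a xs
    assume "a \<in> carrier_of A" "\<forall>x\<in>set xs. x \<in> carrier_of A"
    then show "DCons a (dlist xs) \<in> dlist ` lists (carrier_of A)"
      by (intro image_eqI[where x="a # xs"]) auto
  qed (auto intro: image_eqI[where x="[]"])
  finally show "carrier_of (TList A) \<subseteq> dlist ` lists (carrier_of A)" .
  have "set xs \<subseteq> carrier_of A \<Longrightarrow> dlist xs \<in> carrier_of (TList A)" for xs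
  proof (induction xs)
    case Nil
    show ?case by (subst carrier_TList_unfold[OF assms]) simp
  next
    case (Cons x xs)
    then show ?case by (subst carrier_TList_unfold[OF assms]) simp
  qed
  then show "dlist ` lists (carrier_of A) \<subseteq> carrier_of (TList A)" by auto
qed

lemma carrier_TList_intros:
  "closed_ty A \<Longrightarrow> DNil \<in> carrier_of (TList A)"
  "closed_ty A \<Longrightarrow> DCons a b \<in> carrier_of (TList A) \<longleftrightarrow> a \<in> carrier_of A \<and> b \<in> carrier_of (TList A)"
  by (subst carrier_TList_unfold; simp)+

definition TNat :: ty where "TNat = TList TOne"

definition dnat :: "nat \<Rightarrow> dat" where "dnat n = dlist (replicate n DUnit)"

lemma dnat_simps [simp]: "dnat 0 = DNil" "dnat (Suc n) = DCons DUnit (dnat n)"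
  by (simp_all add: dnat_def)

lemma dnat_inject [simp]: "dnat m = dnat n \<longleftrightarrow> m = n"
  by (simp add: dnat_def)

lemma closed_TNat [simp]: "closed_ty TNat"
  by (simp add: TNat_def)

lemma carrier_TNat: "carrier_of TNat = range dnat"
proof -
  have "xs \<in> lists {DUnit} \<Longrightarrow> dlist xs \<in> range dnat" for xs
    using replicate_eqI[of xs "length xs" DUnit] by (auto simp: dnat_def intro!: range_eqI[of _ _ "length xs"])
  then show ?thesis
    by (auto simp: TNat_def carrier_TList dnat_def intro!: imageI)
qed

text \<open>\<open>TMu (TVar 0)\<close> is the empty type, being the least fixed point of
  \<open>image DFold\<close>; it closes the sum so that exactly \<open>n\<close> values
  remain.\<close>

primrec TFin :: "nat \<Rightarrow> ty" where
  "TFin 0 = TMu (TVar 0)"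
| "TFin (Suc n) = TSum TOne (TFin n)"

primrec vfin :: "nat \<Rightarrow> val" where
  "vfin 0 = VInl VUnit"
| "vfin (Suc k) = VInr (vfin k)"

primrec dfin :: "nat \<Rightarrow> dat" where
  "dfin 0 = DInl DUnit"
| "dfin (Suc k) = DInr (dfin k)"

lemma closed_TFin [simp]: "closed_ty (TFin n)"
  by (induction n) (simp_all add: closed_ty_def)

lemma carrier_TFin: "carrier_of (TFin n) = dfin ` {..<n}"
proof (induction n)
  case 0
  have "lfp (\<lambda>S. DFold ` S) \<subseteq> {}" by (rule lfp_lowerbound) simp
  then show ?case by (simp add: carrier_of_def)
next
  case (Suc n)
  then show ?case by (simp add: lessThan_Suc_eq_insert_0 image_image)
qed

lemma dfin_inject [simp]: "dfin j = dfin k \<longleftrightarrow> j = k"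
proof (induction j arbitrary: k)
  case 0
  show ?case by (cases k) auto
next
  case (Suc j)
  then show ?case by (cases k) auto
qed

section \<open>Values and patterns\<close>

inductive_cases val_orth_elims:
  "val_orth (VInl v) (VInl w)" "val_orth (VInr v) (VInr w)"
  "val_orth (VFold v) (VFold w)" "val_orth (VPair v v') (VPair w w')"

lemma val_orth_simps [simp]:
  "val_orth (VInl v) (VInr w)" "val_orth (VInr w) (VInl v)"
  "val_orth (VInl v) (VInl w) \<longleftrightarrow> val_orth v w"
  "val_orth (VInr v) (VInr w) \<longleftrightarrow> val_orth v w"
  "val_orth (VFold v) (VFold w) \<longleftrightarrow> val_orth v w"
  "val_orth (VPair v v') (VPair w w') \<longleftrightarrow> val_orth v w \<or> val_orth v' w'"
  by (auto intro: val_orth.intros elim: val_orth_elims)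

lemma val_orth_VList [simp]:
  "val_orth VNil (VCons v w)" "val_orth (VCons v w) VNil"
  "val_orth (VCons v w) (VCons v' w') \<longleftrightarrow> val_orth v v' \<or> val_orth w w'"
  by (simp_all add: VNil_def VCons_def)

lemma val_orth_vfin: "j \<noteq> k \<Longrightarrow> val_orth (vfin j) (vfin k)"
proof (induction j arbitrary: k)
  case 0
  then show ?case by (cases k) auto
next
  case (Suc j)
  then show ?case by (cases k) auto
qed

primrec val_vars :: "val \<Rightarrow> nat list" where
  "val_vars VUnit = []"
| "val_vars (VVar x) = [x]"
| "val_vars (VInl v) = val_vars v"
| "val_vars (VInr v) = val_vars v"
| "val_vars (VPair v w) = val_vars v @ val_vars w"
| "val_vars (VFold v) = val_vars v"

text \<open>Variable \<open>x\<close> is assigned the type \<open>ts ! x\<close>. Linearity is expressed separately, by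
  distinctness of \<open>val_vars\<close>.\<close>

primrec val_wt :: "ty list \<Rightarrow> val \<Rightarrow> ty \<Rightarrow> bool" where
  "val_wt ts VUnit A \<longleftrightarrow> A = TOne"
| "val_wt ts (VVar x) A \<longleftrightarrow> A = ts ! x"
| "val_wt ts (VInl v) A \<longleftrightarrow> (case A of TSum B C \<Rightarrow> val_wt ts v B | _ \<Rightarrow> False)"
| "val_wt ts (VInr v) A \<longleftrightarrow> (case A of TSum B C \<Rightarrow> val_wt ts v C | _ \<Rightarrow> False)"
| "val_wt ts (VPair v w) A \<longleftrightarrow> (case A of TProd B C \<Rightarrow> val_wt ts v B \<and> val_wt ts w C | _ \<Rightarrow> False)"
| "val_wt ts (VFold v) A \<longleftrightarrow> (case A of TMu B \<Rightarrow> val_wt ts v (ty_subst B 0 (TMu B)) | _ \<Rightarrow> False)"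

lemma val_wt_typed:
  "val_wt ts v A \<Longrightarrow> distinct (val_vars v) \<Longrightarrow>
   val_typed (\<lambda>x. if x \<in> set (val_vars v) then Some (ts ! x) else None) v A"
proof (induction v arbitrary: A)
  case VUnit
  then show ?case using val_typed.intros(1) by (simp add: fun_eq_iff)
next
  case (VVar x)
  have "(\<lambda>y. if y = x then Some (ts ! y) else None) = [x \<mapsto> ts ! x]" by auto
  then show ?case using VVar val_typed.intros(2)[of x "ts ! x"] by simp
next
  case (VPair v w)
  let ?\<Delta> = "\<lambda>v x. if x \<in> set (val_vars v) then Some (ts ! x) else None"
  obtain B C where A: "A = TProd B C" "val_wt ts v B" "val_wt ts w C"
    using VPair.prems by (auto split: ty.splits)
  have "?\<Delta> (VPair v w) = ?\<Delta> v ++ ?\<Delta> w" by (auto simp: map_add_def)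
  moreover have "val_typed (?\<Delta> v ++ ?\<Delta> w) (VPair v w) (TProd B C)"
    using VPair A by (intro val_typed.intros) (auto split: if_splits)
  ultimately show ?case by (simp only: A)
qed (auto split: ty.splits intro: val_typed.intros)

text \<open>The constructors are injective and the carriers are built from them, so membership of a
  pattern's value can be traced back to its variables. This is what replaces a typing condition on
  valuations in the denotation of clauses.\<close>

lemma val_den_carrier:
  "val_wt ts v A \<Longrightarrow> closed_ty A \<Longrightarrow>
   val_den v \<sigma> \<in> carrier_of A \<longleftrightarrow> (\<forall>x \<in> set (val_vars v). \<sigma> x \<in> carrier_of (ts ! x))"
proof (induction v arbitrary: A)
  case (VFold v)
  then show ?case by (auto split: ty.splits simp: carrier_Mu closed_ty_unfold)
qed (auto split: ty.splits)

lemma val_den_cong: "(\<And>x. x \<in> set (val_vars v) \<Longrightarrow> \<sigma> x = \<sigma>' x) \<Longrightarrow> val_den v \<sigma> = val_den v \<sigma>'"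
  by (induction v) auto

lemma VList_simps [simp]:
  "val_vars VNil = []" "val_vars (VCons v w) = val_vars v @ val_vars w"
  "val_den VNil \<sigma> = DNil" "val_den (VCons v w) \<sigma> = DCons (val_den v \<sigma>) (val_den w \<sigma>)"
  "val_wt ts VNil (TList A)"
  "closed_ty A \<Longrightarrow> val_wt ts (VCons v w) (TList A) \<longleftrightarrow> val_wt ts v A \<and> val_wt ts w (TList A)"
  by (simp_all add: VNil_def VCons_def DNil_def DCons_def TList_def)

lemma VNat_simps [simp]: "val_wt ts VNil TNat" "val_wt ts (VCons VUnit v) TNat \<longleftrightarrow> val_wt ts v TNat"
  by (simp_all add: TNat_def)

lemma vfin_simps [simp]: "val_vars (vfin k) = []" "val_den (vfin k) \<sigma> = dfin k"
  by (induction k) auto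

lemma val_wt_vfin [simp]: "val_wt ts (vfin k) (TFin n) \<longleftrightarrow> k < n"
proof (induction n arbitrary: k)
  case 0
  then show ?case by (cases k) auto
next
  case (Suc n)
  then show ?case by (cases k) auto
qed

section \<open>Definable relations\<close>

type_synonym rel = "(dat \<times> dat) set"
type_synonym fenv = "nat \<rightharpoonup> ty \<times> ty"

definition arc :: "rel \<Rightarrow> tok set" where
  "arc r = {Arc a b | a b. (a, b) \<in> r}"

definition hom :: "ty \<Rightarrow> ty \<Rightarrow> rel" where
  "hom A B = carrier_of A \<times> carrier_of B"

definition ictx_of :: "fenv \<Rightarrow> ictx" where
  "ictx_of \<Psi> = map_option (\<lambda>(A, B). TIso A B) \<circ> \<Psi>"

definition env_ok :: "fenv \<Rightarrow> (nat \<Rightarrow> rel) \<Rightarrow> bool" where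
  "env_ok \<Psi> \<rho> \<longleftrightarrow> (\<forall>\<phi> A B. \<Psi> \<phi> = Some (A, B) \<longrightarrow> \<rho> \<phi> \<subseteq> hom A B)"

text \<open>The free iso variables all have types \<open>A \<leftrightarrow> B\<close>. Hence
  environments and results can be described by binary relations on data, and \<open>F\<close> is the
  relation transformer that the open iso \<open>\<omega>\<close> denotes.\<close>

definition denotes :: "fenv \<Rightarrow> ty \<Rightarrow> ty \<Rightarrow> ((nat \<Rightarrow> rel) \<Rightarrow> rel) \<Rightarrow> bool" where
  "denotes \<Psi> A B F \<longleftrightarrow> closed_ty A \<and> closed_ty B \<and>
     (\<exists>\<omega>. iso_typed (ictx_of \<Psi>) \<omega> (TIso A B) \<and>
       (\<forall>\<rho>. env_ok \<Psi> \<rho> \<longrightarrow> F \<rho> \<subseteq> hom A B \<and> iso_den \<omega> (\<lambda>\<phi>. arc (\<rho> \<phi>)) = arc (F \<rho>)))"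

lemma Arc_in_arc [simp]: "Arc a b \<in> arc r \<longleftrightarrow> (a, b) \<in> r"
  by (auto simp: arc_def)

lemma arc_subset_iff [simp]: "arc r \<subseteq> arc s \<longleftrightarrow> r \<subseteq> s"
  by (auto simp: arc_def)

lemma arc_inject [simp]: "arc r = arc s \<longleftrightarrow> r = s"
  by (auto simp: set_eq_iff arc_def)

lemma in_hom [simp]: "(a, b) \<in> hom A B \<longleftrightarrow> a \<in> carrier_of A \<and> b \<in> carrier_of B"
  by (simp add: hom_def)

lemma subset_homD:
  "r \<subseteq> hom A B \<Longrightarrow> (a, b) \<in> r \<Longrightarrow> a \<in> carrier_of A \<and> b \<in> carrier_of B"
  by (auto simp: hom_def)

lemma denotesI:
  assumes "closed_ty A" "closed_ty B" "iso_typed (ictx_of \<Psi>) \<omega> (TIso A B)"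
    and "\<And>\<rho>. env_ok \<Psi> \<rho> \<Longrightarrow> F \<rho> \<subseteq> hom A B"
    and "\<And>\<rho>. env_ok \<Psi> \<rho> \<Longrightarrow> iso_den \<omega> (\<lambda>\<phi>. arc (\<rho> \<phi>)) = arc (F \<rho>)"
  shows "denotes \<Psi> A B F"
  unfolding denotes_def using assms by blast

lemma denotesE:
  assumes "denotes \<Psi> A B F"
  obtains \<omega> where "closed_ty A" "closed_ty B" "iso_typed (ictx_of \<Psi>) \<omega> (TIso A B)"
    and "\<And>\<rho>. env_ok \<Psi> \<rho> \<Longrightarrow> F \<rho> \<subseteq> hom A B"
    and "\<And>\<rho>. env_ok \<Psi> \<rho> \<Longrightarrow> iso_den \<omega> (\<lambda>\<phi>. arc (\<rho> \<phi>)) = arc (F \<rho>)"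
  using assms unfolding denotes_def by blast

lemma iso_typed_single:
  assumes "closed_ty A" "closed_ty B" "val_typed \<Delta> v A" "expr_typed \<Psi> \<Delta> e B"
  shows "iso_typed \<Psi> (Clauses A B [(v, e)]) (TIso A B)"
  using assms by (intro Clauses) (auto simp: pairwise_orth_def)

lemma iso_typed_pair:
  assumes "closed_ty A" "closed_ty B" "val_typed \<Delta> v A" "expr_typed \<Psi> \<Delta> e B"
    and "val_typed \<Delta>' v' A" "expr_typed \<Psi> \<Delta>' e' B" "val_orth v v'" "val_orth v' v"
    and "expr_orth e e'" "expr_orth e' e"
  shows "iso_typed \<Psi> (Clauses A B [(v, e), (v', e')]) (TIso A B)"
  using assms by (intro Clauses) (auto simp: pairwise_orth_def less_Suc_eq nth_Cons')

lemma ELet_var: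
  assumes "iso_typed \<Psi> \<omega> (TIso A B)" "expr_typed \<Psi> (\<Delta>(y \<mapsto> B)) e C" "x \<notin> dom \<Delta>" "y \<notin> dom \<Delta>"
  shows "expr_typed \<Psi> (\<Delta>(x \<mapsto> A)) (ELet (PVar y) \<omega> (PVar x) e) C"
proof -
  have "expr_typed \<Psi> ([x \<mapsto> A] ++ \<Delta>) (ELet (PVar y) \<omega> (PVar x) e) C"
    using assms by (intro ELet[where \<Gamma> = "[y \<mapsto> B]"]) (auto intro: val_typed.intros)
  moreover have "[x \<mapsto> A] ++ \<Delta> = \<Delta>(x \<mapsto> A)"
    using assms(3) by (auto simp: fun_eq_iff map_add_def split: option.split)
  ultimately show ?thesis by simp
qed

lemma expr_den_ELet_var:
  "expr_den (ELet (PVar y) \<omega> (PVar x) e) \<eta> \<sigma> =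
   {c. \<exists>b. Arc (\<sigma> x) b \<in> iso_den \<omega> \<eta> \<and> c \<in> expr_den e \<eta> (\<sigma>(y := b))}"
proof (intro set_eqI iffI)
  fix c assume "c \<in> expr_den (ELet (PVar y) \<omega> (PVar x) e) \<eta> \<sigma>"
  then obtain \<sigma>' where *: "Arc (\<sigma> x) (\<sigma>' y) \<in> iso_den \<omega> \<eta>" "\<forall>z. z \<noteq> y \<longrightarrow> \<sigma>' z = \<sigma> z"
    "c \<in> expr_den e \<eta> \<sigma>'" by auto
  have "\<sigma>' = \<sigma>(y := \<sigma>' y)" using *(2) by (simp add: fun_eq_iff)
  with *(3) have "c \<in> expr_den e \<eta> (\<sigma>(y := \<sigma>' y))" by (simp only:)
  with *(1) show "c \<in> {c. \<exists>b. Arc (\<sigma> x) b \<in> iso_den \<omega> \<eta> \<and> c \<in> expr_den e \<eta> (\<sigma>(y := b))}" by blast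
next
  fix c assume "c \<in> {c. \<exists>b. Arc (\<sigma> x) b \<in> iso_den \<omega> \<eta> \<and> c \<in> expr_den e \<eta> (\<sigma>(y := b))}"
  then obtain b where "Arc (\<sigma> x) b \<in> iso_den \<omega> \<eta>" "c \<in> expr_den e \<eta> (\<sigma>(y := b))" by blast
  then show "c \<in> expr_den (ELet (PVar y) \<omega> (PVar x) e) \<eta> \<sigma>"
    by (auto intro!: exI[of _ "\<sigma>(y := b)"])
qed

lemma iso_den_clauses:
  "iso_den (Clauses A B cs) \<eta> =
   arc (\<Union>(v, e) \<in> set cs. {(val_den v \<sigma>, b) | \<sigma> b. val_den v \<sigma> \<in> carrier_of A \<and> b \<in> expr_den e \<eta> \<sigma>})"
proof -
  have "arc (\<Union>i \<in> I. R i) = (\<Union>i \<in> I. arc (R i))" for I and R :: "val \<times> expr \<Rightarrow> rel"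
    by (auto simp: arc_def)
  then show ?thesis
    unfolding iso_den.simps by (simp only:) (intro SUP_cong refl, auto simp: arc_def)
qed

lemma ex_valuation1: "(\<exists>\<sigma>. P (\<sigma> (0::nat))) \<longleftrightarrow> (\<exists>a. P a)"
  by (auto intro: exI[of _ "\<lambda>_. _"])

lemma ex_valuation2: "(\<exists>\<sigma>. P (\<sigma> (0::nat)) (\<sigma> 1)) \<longleftrightarrow> (\<exists>a b. P a b)"
proof
  assume "\<exists>a b. P a b"
  then obtain a b where "P a b" by blast
  then show "\<exists>\<sigma>. P (\<sigma> (0::nat)) (\<sigma> 1)" by (intro exI[of _ "\<lambda>n. if n = 0 then a else b"]) simp
qed auto

section \<open>Composition, products, sums and rewriting\<close>

lemma denotes_comp:
  assumes "denotes \<Psi> A B F" "denotes \<Psi> B C G"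
  shows "denotes \<Psi> A C (\<lambda>\<rho>. F \<rho> O G \<rho>)"
proof -
  from assms(1) obtain \<omega>1 where 1: "closed_ty A" "closed_ty B" "iso_typed (ictx_of \<Psi>) \<omega>1 (TIso A B)"
    "\<And>\<rho>. env_ok \<Psi> \<rho> \<Longrightarrow> F \<rho> \<subseteq> hom A B" "\<And>\<rho>. env_ok \<Psi> \<rho> \<Longrightarrow> iso_den \<omega>1 (\<lambda>\<phi>. arc (\<rho> \<phi>)) = arc (F \<rho>)"
    by (rule denotesE) (rule that)
  from assms(2) obtain \<omega>2 where 2: "closed_ty B" "closed_ty C" "iso_typed (ictx_of \<Psi>) \<omega>2 (TIso B C)"
    "\<And>\<rho>. env_ok \<Psi> \<rho> \<Longrightarrow> G \<rho> \<subseteq> hom B C" "\<And>\<rho>. env_ok \<Psi> \<rho> \<Longrightarrow> iso_den \<omega>2 (\<lambda>\<phi>. arc (\<rho> \<phi>)) = arc (G \<rho>)"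
    by (rule denotesE) (rule that)
  let ?e = "ELet (PVar 1) \<omega>1 (PVar 0) (ELet (PVar 2) \<omega>2 (PVar 1) (EVal (VVar 2)))"
  show ?thesis
  proof (rule denotesI)
    have "expr_typed (ictx_of \<Psi>) [0 \<mapsto> A] ?e C"
      by (intro ELet_var[OF 1(3)] ELet_var[OF 2(3)] EVal val_typed.intros) auto
    then show "iso_typed (ictx_of \<Psi>) (Clauses A C [(VVar 0, ?e)]) (TIso A C)"
      using 1(1) 2(2) by (intro iso_typed_single[OF _ _ val_typed.intros(2)])
    show "F \<rho> O G \<rho> \<subseteq> hom A C" if "env_ok \<Psi> \<rho>" for \<rho>
      using 1(4)[OF that] 2(4)[OF that] by (auto dest: subset_homD)
    fix \<rho> assume ok: "env_ok \<Psi> \<rho>"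
    \<comment> \<open>Membership is brought into the form that \<open>iso_den_clauses\<close>
      produces, a valuation whose value at 0 is the argument; then only the two \<open>let\<close>s
      remain to be evaluated.\<close>
    have mem: "(a, c) \<in> F \<rho> O G \<rho> \<longleftrightarrow> (\<exists>\<sigma>. a = \<sigma> (0::nat) \<and> \<sigma> 0 \<in> carrier_of A \<and>
      (\<exists>b. (\<sigma> 0, b) \<in> F \<rho> \<and> (b, c) \<in> G \<rho>))" for a c
      unfolding ex_valuation1[of "\<lambda>x. a = x \<and> x \<in> carrier_of A \<and> (\<exists>b. (x, b) \<in> F \<rho> \<and> (b, c) \<in> G \<rho>)"]
      using 1(4)[OF ok] by (auto dest: subset_homD)
    show "iso_den (Clauses A C [(VVar 0, ?e)]) (\<lambda>\<phi>. arc (\<rho> \<phi>)) = arc (F \<rho> O G \<rho>)"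
      unfolding iso_den_clauses arc_inject
      by (rule set_eqI, unfold split_paired_all mem)
        (auto simp: expr_den_ELet_var 1(5)[OF ok] 2(5)[OF ok] simp del: expr_den.simps(2))
  qed (use 1 2 in simp_all)
qed

definition par_rel :: "rel \<Rightarrow> rel \<Rightarrow> rel" where
  "par_rel r s = {(DPair a b, DPair a' b') | a b a' b'. (a, a') \<in> r \<and> (b, b') \<in> s}"

definition sum_rel :: "rel \<Rightarrow> rel \<Rightarrow> rel" where
  "sum_rel r s = {(DInl a, DInl a') | a a'. (a, a') \<in> r} \<union> {(DInr b, DInr b') | b b'. (b, b') \<in> s}"

lemma val_typed_PairI:
  "val_typed \<Delta>1 v A \<Longrightarrow> val_typed \<Delta>2 w B \<Longrightarrow> dom \<Delta>1 \<inter> dom \<Delta>2 = {} \<Longrightarrow> \<Delta> = \<Delta>1 ++ \<Delta>2 \<Longrightarrow>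
   val_typed \<Delta> (VPair v w) (TProd A B)"
  by (auto intro: val_typed.intros)

lemma denotes_prod:
  assumes "denotes \<Psi> A A' F" "denotes \<Psi> B B' G"
  shows "denotes \<Psi> (TProd A B) (TProd A' B') (\<lambda>\<rho>. par_rel (F \<rho>) (G \<rho>))"
proof -
  from assms(1) obtain \<omega>1 where 1: "closed_ty A" "closed_ty A'" "iso_typed (ictx_of \<Psi>) \<omega>1 (TIso A A')"
    "\<And>\<rho>. env_ok \<Psi> \<rho> \<Longrightarrow> F \<rho> \<subseteq> hom A A'" "\<And>\<rho>. env_ok \<Psi> \<rho> \<Longrightarrow> iso_den \<omega>1 (\<lambda>\<phi>. arc (\<rho> \<phi>)) = arc (F \<rho>)"
    by (rule denotesE) (rule that)
  from assms(2) obtain \<omega>2 where 2: "closed_ty B" "closed_ty B'" "iso_typed (ictx_of \<Psi>) \<omega>2 (TIso B B')"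
    "\<And>\<rho>. env_ok \<Psi> \<rho> \<Longrightarrow> G \<rho> \<subseteq> hom B B'" "\<And>\<rho>. env_ok \<Psi> \<rho> \<Longrightarrow> iso_den \<omega>2 (\<lambda>\<phi>. arc (\<rho> \<phi>)) = arc (G \<rho>)"
    by (rule denotesE) (rule that)
  let ?e = "ELet (PVar 2) \<omega>1 (PVar 0) (ELet (PVar 3) \<omega>2 (PVar 1) (EVal (VPair (VVar 2) (VVar 3))))"
  let ?cs = "[(VPair (VVar 0) (VVar 1), ?e)]"
  show ?thesis
  proof (rule denotesI)
    have "expr_typed (ictx_of \<Psi>) [2 \<mapsto> A', 1 \<mapsto> B] (ELet (PVar 3) \<omega>2 (PVar 1) (EVal (VPair (VVar 2) (VVar 3)))) (TProd A' B')"
      by (intro ELet_var[OF 2(3)] EVal)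
        (auto intro!: val_typed_PairI[OF val_typed.intros(2) val_typed.intros(2)] split: if_splits)
    then have "expr_typed (ictx_of \<Psi>) [1 \<mapsto> B, 0 \<mapsto> A] ?e (TProd A' B')"
      by (intro ELet_var[OF 1(3)]) (auto simp: fun_upd_twist)
    moreover have "val_typed [1 \<mapsto> B, 0 \<mapsto> A] (VPair (VVar 0) (VVar 1)) (TProd A B)"
      by (rule val_typed_PairI[OF val_typed.intros(2) val_typed.intros(2)]) (auto split: if_splits)
    ultimately show "iso_typed (ictx_of \<Psi>) (Clauses (TProd A B) (TProd A' B') ?cs) (TIso (TProd A B) (TProd A' B'))"
      using 1 2 by (intro iso_typed_single) auto
    show "par_rel (F \<rho>) (G \<rho>) \<subseteq> hom (TProd A B) (TProd A' B')" if "env_ok \<Psi> \<rho>" for \<rho>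
      using 1(4)[OF that] 2(4)[OF that] by (auto simp: par_rel_def dest: subset_homD)
    fix \<rho> assume ok: "env_ok \<Psi> \<rho>"
    let ?P = "\<lambda>x z a b. x = DPair a b \<and> a \<in> carrier_of A \<and> b \<in> carrier_of B \<and>
      (\<exists>a' b'. z = DPair a' b' \<and> (a, a') \<in> F \<rho> \<and> (b, b') \<in> G \<rho>)"
    have mem: "(x, z) \<in> par_rel (F \<rho>) (G \<rho>) \<longleftrightarrow> (\<exists>\<sigma>. ?P x z (\<sigma> (0::nat)) (\<sigma> 1))" for x z
      unfolding ex_valuation2[of "?P x z"]
      using 1(4)[OF ok] 2(4)[OF ok] by (auto simp: par_rel_def dest: subset_homD)
    show "iso_den (Clauses (TProd A B) (TProd A' B') ?cs) (\<lambda>\<phi>. arc (\<rho> \<phi>)) = arc (par_rel (F \<rho>) (G \<rho>))"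
      unfolding iso_den_clauses arc_inject
      by (rule set_eqI, unfold split_paired_all mem)
        (auto simp: expr_den_ELet_var 1(5)[OF ok] 2(5)[OF ok] simp del: expr_den.simps(2))
  qed (use 1 2 in simp_all)
qed

lemma denotes_sum:
  assumes "denotes \<Psi> A A' F" "denotes \<Psi> B B' G"
  shows "denotes \<Psi> (TSum A B) (TSum A' B') (\<lambda>\<rho>. sum_rel (F \<rho>) (G \<rho>))"
proof -
  from assms(1) obtain \<omega>1 where 1: "closed_ty A" "closed_ty A'" "iso_typed (ictx_of \<Psi>) \<omega>1 (TIso A A')"
    "\<And>\<rho>. env_ok \<Psi> \<rho> \<Longrightarrow> F \<rho> \<subseteq> hom A A'" "\<And>\<rho>. env_ok \<Psi> \<rho> \<Longrightarrow> iso_den \<omega>1 (\<lambda>\<phi>. arc (\<rho> \<phi>)) = arc (F \<rho>)"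
    by (rule denotesE) (rule that)
  from assms(2) obtain \<omega>2 where 2: "closed_ty B" "closed_ty B'" "iso_typed (ictx_of \<Psi>) \<omega>2 (TIso B B')"
    "\<And>\<rho>. env_ok \<Psi> \<rho> \<Longrightarrow> G \<rho> \<subseteq> hom B B'" "\<And>\<rho>. env_ok \<Psi> \<rho> \<Longrightarrow> iso_den \<omega>2 (\<lambda>\<phi>. arc (\<rho> \<phi>)) = arc (G \<rho>)"
    by (rule denotesE) (rule that)
  let ?e1 = "ELet (PVar 1) \<omega>1 (PVar 0) (EVal (VInl (VVar 1)))"
  let ?e2 = "ELet (PVar 1) \<omega>2 (PVar 0) (EVal (VInr (VVar 1)))"
  let ?cs = "[(VInl (VVar 0), ?e1), (VInr (VVar 0), ?e2)]"
  show ?thesis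
  proof (rule denotesI)
    have "expr_typed (ictx_of \<Psi>) [0 \<mapsto> A] ?e1 (TSum A' B')" "expr_typed (ictx_of \<Psi>) [0 \<mapsto> B] ?e2 (TSum A' B')"
      by (intro ELet_var[OF 1(3)] ELet_var[OF 2(3)] EVal val_typed.intros; simp)+
    then show "iso_typed (ictx_of \<Psi>) (Clauses (TSum A B) (TSum A' B') ?cs) (TIso (TSum A B) (TSum A' B'))"
      using 1 2 by (intro iso_typed_pair) (auto intro: val_typed.intros intro!: expr_orth.intros)
    show "sum_rel (F \<rho>) (G \<rho>) \<subseteq> hom (TSum A B) (TSum A' B')" if "env_ok \<Psi> \<rho>" for \<rho>
      using 1(4)[OF that] 2(4)[OF that] by (auto simp: sum_rel_def dest: subset_homD)
    fix \<rho> assume ok: "env_ok \<Psi> \<rho>"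
    let ?P = "\<lambda>x z a. x = DInl a \<and> a \<in> carrier_of A \<and> (\<exists>a'. z = DInl a' \<and> (a, a') \<in> F \<rho>)"
    let ?Q = "\<lambda>x z b. x = DInr b \<and> b \<in> carrier_of B \<and> (\<exists>b'. z = DInr b' \<and> (b, b') \<in> G \<rho>)"
    have mem: "(x, z) \<in> sum_rel (F \<rho>) (G \<rho>) \<longleftrightarrow> (\<exists>\<sigma>. ?P x z (\<sigma> (0::nat))) \<or> (\<exists>\<sigma>. ?Q x z (\<sigma> (0::nat)))" for x z
      unfolding ex_valuation1[of "?P x z"] ex_valuation1[of "?Q x z"]
      using 1(4)[OF ok] 2(4)[OF ok] by (auto simp: sum_rel_def dest: subset_homD)
    show "iso_den (Clauses (TSum A B) (TSum A' B') ?cs) (\<lambda>\<phi>. arc (\<rho> \<phi>)) = arc (sum_rel (F \<rho>) (G \<rho>))"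
      unfolding iso_den_clauses arc_inject
      by (rule set_eqI, unfold split_paired_all mem)
        (auto simp: expr_den_ELet_var 1(5)[OF ok] 2(5)[OF ok] simp del: expr_den.simps(2))
  qed (use 1 2 in simp_all)
qed

lemma denotes_var:
  assumes "\<Psi> \<phi> = Some (A, B)" "closed_ty A" "closed_ty B"
  shows "denotes \<Psi> A B (\<lambda>\<rho>. \<rho> \<phi>)"
  using assms by (intro denotesI[of _ _ _ "IVar \<phi>"] IVar) (auto simp: ictx_of_def env_ok_def)

text \<open>A let-free clause \<open>v \<leftrightarrow> w\<close> is given with the list of the types of its variables.\<close>

type_synonym clause = "ty list \<times> val \<times> val"

definition clause_ok :: "ty \<Rightarrow> ty \<Rightarrow> clause \<Rightarrow> bool" where
  "clause_ok A B = (\<lambda>(ts, v, w). val_wt ts v A \<and> val_wt ts w B \<and>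
     distinct (val_vars v) \<and> distinct (val_vars w) \<and>
     set (val_vars v) = {..<length ts} \<and> set (val_vars w) = {..<length ts})"

definition clause_rel :: "clause \<Rightarrow> rel" where
  "clause_rel = (\<lambda>(ts, v, w). {(val_den v ((!) xs), val_den w ((!) xs)) | xs.
     list_all2 (\<lambda>x T. x \<in> carrier_of T) xs ts})"

definition clauses_rel :: "clause list \<Rightarrow> rel" where
  "clauses_rel cs = (\<Union>c \<in> set cs. clause_rel c)"

definition orth_clauses :: "clause list \<Rightarrow> bool" where
  "orth_clauses cs \<longleftrightarrow> pairwise_orth val_orth (map (fst \<circ> snd) cs) \<and>
     pairwise_orth val_orth (map (snd \<circ> snd) cs)"

lemma denotes_rewrites:
  assumes "closed_ty A" "closed_ty B" "\<And>c. c \<in> set cs \<Longrightarrow> clause_ok A B c" "orth_clauses cs"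
  shows "denotes \<Psi> A B (\<lambda>_. clauses_rel cs)"
proof -
  let ?cs = "map (\<lambda>(ts, v, w). (v, EVal w)) cs"
  show ?thesis
  proof (rule denotesI)
    have "\<exists>\<Delta>. val_typed \<Delta> v A \<and> expr_typed (ictx_of \<Psi>) \<Delta> (EVal w) B" if "(ts, v, w) \<in> set cs" for ts v w
    proof -
      let ?\<Delta> = "\<lambda>x. if x < length ts then Some (ts ! x) else None"
      have "val_typed ?\<Delta> v A \<and> val_typed ?\<Delta> w B"
        using assms(3)[OF that] val_wt_typed[of ts v A] val_wt_typed[of ts w B] by (simp add: clause_ok_def)
      then show ?thesis by (blast intro: EVal)
    qed
    moreover have "map fst ?cs = map (fst \<circ> snd) cs" "map snd ?cs = map EVal (map (snd \<circ> snd) cs)"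
      by auto
    moreover have "pairwise_orth expr_orth (map EVal (map (snd \<circ> snd) cs))"
      using assms(4) by (auto simp: orth_clauses_def pairwise_orth_def intro: expr_orth.intros)
    ultimately show "iso_typed (ictx_of \<Psi>) (Clauses A B ?cs) (TIso A B)"
      using assms by (intro Clauses; (simp only: orth_clauses_def)?) auto
    have *: "clause_rel (ts, v, w) = {(val_den v \<sigma>, val_den w \<sigma>) | \<sigma>. val_den v \<sigma> \<in> carrier_of A}"
      and **: "clause_rel (ts, v, w) \<subseteq> hom A B" if "(ts, v, w) \<in> set cs" for ts v w
    proof -
      have ok: "val_wt ts v A" "val_wt ts w B" "set (val_vars v) = {..<length ts}" "set (val_vars w) = {..<length ts}"
        using assms(3)[OF that] by (auto simp: clause_ok_def)
      have v: "val_den v \<sigma> \<in> carrier_of A \<longleftrightarrow> (\<forall>x < length ts. \<sigma> x \<in> carrier_of (ts ! x))" for \<sigma>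
        using val_den_carrier[OF ok(1) assms(1)] ok(3) by auto
      have w: "val_den w \<sigma> \<in> carrier_of B \<longleftrightarrow> (\<forall>x < length ts. \<sigma> x \<in> carrier_of (ts ! x))" for \<sigma>
        using val_den_carrier[OF ok(2) assms(2)] ok(4) by auto
      show "clause_rel (ts, v, w) \<subseteq> hom A B"
        by (auto simp: clause_rel_def v w list_all2_conv_all_nth)
      show "clause_rel (ts, v, w) = {(val_den v \<sigma>, val_den w \<sigma>) | \<sigma>. val_den v \<sigma> \<in> carrier_of A}" (is "?l = ?r")
      proof
        show "?l \<subseteq> ?r" by (auto simp: clause_rel_def v list_all2_conv_all_nth)
        show "?r \<subseteq> ?l"
        proof clarify
          \<comment> \<open>Only the variables below \<open>length ts\<close> occur in the clause,
            so the list of their values can stand in for the whole valuation.\<close>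
          fix \<sigma> assume "val_den v \<sigma> \<in> carrier_of A"
          then have "list_all2 (\<lambda>x T. x \<in> carrier_of T) (map \<sigma> [0..<length ts]) ts"
            by (simp add: v list_all2_conv_all_nth)
          moreover have "val_den v \<sigma> = val_den v ((!) (map \<sigma> [0..<length ts]))"
            "val_den w \<sigma> = val_den w ((!) (map \<sigma> [0..<length ts]))"
            by (rule val_den_cong; simp add: ok(3,4))+
          ultimately show "(val_den v \<sigma>, val_den w \<sigma>) \<in> ?l"
            unfolding clause_rel_def prod.case by blast
        qed
      qed
    qed
    show "clauses_rel cs \<subseteq> hom A B" using ** by (fastforce simp: clauses_rel_def)
    show "iso_den (Clauses A B ?cs) (\<lambda>\<phi>. arc (\<rho> \<phi>)) = arc (clauses_rel cs)" for \<rho>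
    proof -
      have "clauses_rel cs = (\<Union>(ts, v, w) \<in> set cs. {(val_den v \<sigma>, val_den w \<sigma>) | \<sigma>. val_den v \<sigma> \<in> carrier_of A})"
        unfolding clauses_rel_def by (intro SUP_cong refl) (auto simp: *)
      then show ?thesis
        unfolding iso_den_clauses arc_inject by (simp add: image_image case_prod_beta)
    qed
  qed (use assms in simp_all)
qed

text \<open>Least prefixed point among the relations below \<open>hom A B\<close>. The restriction
  matters because \<open>denotes\<close> describes an iso only in environments that satisfy
  \<open>env_ok\<close>, so nothing is known about \<open>H\<close> elsewhere.\<close>

definition rel_fix :: "ty \<Rightarrow> ty \<Rightarrow> (rel \<Rightarrow> rel) \<Rightarrow> rel" where
  "rel_fix A B H = \<Inter> {r. r \<subseteq> hom A B \<and> H r \<subseteq> r}"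

lemma rel_fix_eqI:
  assumes "R \<subseteq> hom A B" "H R \<subseteq> R" "\<And>S. S \<subseteq> hom A B \<Longrightarrow> H S \<subseteq> S \<Longrightarrow> R \<subseteq> S"
  shows "rel_fix A B H = R"
  unfolding rel_fix_def using assms by blast

lemma env_ok_upd: "env_ok \<Psi> \<rho> \<Longrightarrow> r \<subseteq> hom A B \<Longrightarrow> env_ok (\<Psi>(\<phi> \<mapsto> (A, B))) (\<rho>(\<phi> := r))"
  by (auto simp: env_ok_def)

lemma denotes_fix:
  assumes "denotes (\<Psi>(\<phi> \<mapsto> (A, B))) A B F"
  shows "denotes \<Psi> A B (\<lambda>\<rho>. rel_fix A B (\<lambda>r. F (\<rho>(\<phi> := r))))"
proof -
  from assms obtain \<omega> where 1: "closed_ty A" "closed_ty B"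
    "iso_typed (ictx_of (\<Psi>(\<phi> \<mapsto> (A, B)))) \<omega> (TIso A B)"
    "\<And>\<rho>. env_ok (\<Psi>(\<phi> \<mapsto> (A, B))) \<rho> \<Longrightarrow> F \<rho> \<subseteq> hom A B"
    "\<And>\<rho>. env_ok (\<Psi>(\<phi> \<mapsto> (A, B))) \<rho> \<Longrightarrow> iso_den \<omega> (\<lambda>\<phi>. arc (\<rho> \<phi>)) = arc (F \<rho>)"
    by (rule denotesE) (rule that)
  show ?thesis
  proof (rule denotesI)
    have "ictx_of (\<Psi>(\<phi> \<mapsto> (A, B))) = (ictx_of \<Psi>)(\<phi> \<mapsto> TIso A B)"
      by (auto simp: ictx_of_def)
    then show "iso_typed (ictx_of \<Psi>) (Fix \<phi> \<omega>) (TIso A B)"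
      using 1 by (intro Fix) auto
    fix \<rho> assume ok: "env_ok \<Psi> \<rho>"
    define H where "H r = F (\<rho>(\<phi> := r))" for r
    have H: "H r \<subseteq> hom A B" if "r \<subseteq> hom A B" for r
      unfolding H_def by (intro 1(4) env_ok_upd ok that)
    show "rel_fix A B (\<lambda>r. F (\<rho>(\<phi> := r))) \<subseteq> hom A B"
      using H[OF order.refl] unfolding rel_fix_def H_def by (intro Inter_lower) simp
    let ?G = "\<lambda>d. iso_den \<omega> ((\<lambda>\<phi>. arc (\<rho> \<phi>))(\<phi> := d))"
    have G: "?G (arc r) = arc (H r)" if "r \<subseteq> hom A B" for r
    proof -
      have "(\<lambda>\<phi>'. arc ((\<rho>(\<phi> := r)) \<phi>')) = (\<lambda>\<phi>. arc (\<rho> \<phi>))(\<phi> := arc r)"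
        by (simp add: fun_eq_iff)
      then show ?thesis using 1(5)[OF env_ok_upd[OF ok that, of \<phi>]] by (simp add: H_def)
    qed
    have mono: "mono ?G" by (intro monoI iso_den_mono) auto
    define R where "R = {(a, b). Arc a b \<in> lfp ?G}"
    \<comment> \<open>\<open>arc (hom A B)\<close> is itself a prefixed point. The least one
      therefore contains no \<open>Step\<close> tokens and is the graph of a relation between the
      carriers.\<close>
    have "lfp ?G \<subseteq> arc (hom A B)"
      by (rule lfp_lowerbound) (use H in \<open>simp add: G\<close>)
    then have lfpR: "lfp ?G = arc R" and R: "R \<subseteq> hom A B"
      by (auto simp: R_def arc_def)
    have "rel_fix A B H = R"
    proof (rule rel_fix_eqI[OF R])
      have "arc (H R) = arc R"
        using lfp_unfold[OF mono] G[OF R] by (simp add: lfpR)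
      then show "H R \<subseteq> R" by simp
      fix S assume S: "S \<subseteq> hom A B" "H S \<subseteq> S"
      have "lfp ?G \<subseteq> arc S"
        by (rule lfp_lowerbound) (use S in \<open>simp add: G\<close>)
      then show "R \<subseteq> S" by (simp add: lfpR)
    qed
    then show "iso_den (Fix \<phi> \<omega>) (\<lambda>\<phi>. arc (\<rho> \<phi>)) = arc (rel_fix A B (\<lambda>r. F (\<rho>(\<phi> := r))))"
      by (simp add: lfpR flip: H_def)
  qed (use 1 in simp_all)
qed

text \<open>The inverse of each combinator is an instance of the same combinator, so that invertibility
  within the language can be carried along.\<close>

definition fenv_conv :: "fenv \<Rightarrow> fenv" where
  "fenv_conv \<Psi> = map_option prod.swap \<circ> \<Psi>"

definition definable :: "fenv \<Rightarrow> ty \<Rightarrow> ty \<Rightarrow> ((nat \<Rightarrow> rel) \<Rightarrow> rel) \<Rightarrow> bool" where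
  "definable \<Psi> A B F \<longleftrightarrow> denotes \<Psi> A B F \<and> denotes (fenv_conv \<Psi>) B A (\<lambda>\<rho>. (F (\<lambda>\<phi>. (\<rho> \<phi>)\<inverse>))\<inverse>)"

lemma definable_comp:
  "definable \<Psi> A B F \<Longrightarrow> definable \<Psi> B C G \<Longrightarrow> definable \<Psi> A C (\<lambda>\<rho>. F \<rho> O G \<rho>)"
  by (auto simp: definable_def converse_relcomp intro: denotes_comp)

lemma par_rel_converse: "(par_rel r s)\<inverse> = par_rel (r\<inverse>) (s\<inverse>)"
  by (auto simp: par_rel_def)

lemma sum_rel_converse: "(sum_rel r s)\<inverse> = sum_rel (r\<inverse>) (s\<inverse>)"
  by (auto simp: sum_rel_def)

lemma definable_prod:
  "definable \<Psi> A A' F \<Longrightarrow> definable \<Psi> B B' G \<Longrightarrow>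
   definable \<Psi> (TProd A B) (TProd A' B') (\<lambda>\<rho>. par_rel (F \<rho>) (G \<rho>))"
  by (simp add: definable_def par_rel_converse denotes_prod)

lemma definable_sum:
  "definable \<Psi> A A' F \<Longrightarrow> definable \<Psi> B B' G \<Longrightarrow>
   definable \<Psi> (TSum A B) (TSum A' B') (\<lambda>\<rho>. sum_rel (F \<rho>) (G \<rho>))"
  by (simp add: definable_def sum_rel_converse denotes_sum)

lemma definable_var:
  "\<Psi> \<phi> = Some (A, B) \<Longrightarrow> closed_ty A \<Longrightarrow> closed_ty B \<Longrightarrow> definable \<Psi> A B (\<lambda>\<rho>. \<rho> \<phi>)"
  by (simp add: definable_def denotes_var fenv_conv_def)

text \<open>Taking converses is an order isomorphism from the relations below \<open>hom A B\<close>
  to those below \<open>hom B A\<close>, so it carries prefixed points of \<open>H\<close> to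
  prefixed points of the conjugate of \<open>H\<close>.\<close>

lemma rel_fix_converse: "(rel_fix A B H)\<inverse> = rel_fix B A (\<lambda>r. (H (r\<inverse>))\<inverse>)"
proof -
  have "hom B A = (hom A B)\<inverse>" by (auto simp: hom_def)
  then have "{r. r \<subseteq> hom B A \<and> (H (r\<inverse>))\<inverse> \<subseteq> r} = converse ` {r. r \<subseteq> hom A B \<and> H r \<subseteq> r}"
    by (auto simp: image_iff converse_subset_swap[of _ "hom A B"])
  then show ?thesis by (auto simp: rel_fix_def)
qed

lemma definable_fix:
  assumes "definable (\<Psi>(\<phi> \<mapsto> (A, B))) A B F"
  shows "definable \<Psi> A B (\<lambda>\<rho>. rel_fix A B (\<lambda>r. F (\<rho>(\<phi> := r))))"
proof -
  have "fenv_conv (\<Psi>(\<phi> \<mapsto> (A, B))) = (fenv_conv \<Psi>)(\<phi> \<mapsto> (B, A))"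
    by (auto simp: fenv_conv_def)
  moreover have "(\<lambda>\<phi>'. ((\<rho>(\<phi> := r)) \<phi>')\<inverse>) = (\<lambda>\<phi>. (\<rho> \<phi>)\<inverse>)(\<phi> := r\<inverse>)"
    for \<rho> and r :: rel by (auto simp: fun_eq_iff)
  ultimately show ?thesis
    using assms denotes_fix[of \<Psi> \<phi> A B F]
      denotes_fix[of "fenv_conv \<Psi>" \<phi> B A "\<lambda>\<rho>. (F (\<lambda>\<phi>. (\<rho> \<phi>)\<inverse>))\<inverse>"]
    by (simp add: definable_def rel_fix_converse del: fun_upd_apply)
qed

lemma definable_rewrites:
  assumes "closed_ty A" "closed_ty B" "\<And>c. c \<in> set cs \<Longrightarrow> clause_ok A B c" "orth_clauses cs"
  shows "definable \<Psi> A B (\<lambda>_. clauses_rel cs)"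
proof -
  let ?swap = "\<lambda>(ts, v, w). (ts, w, v) :: clause"
  have "(clauses_rel cs)\<inverse> = clauses_rel (map ?swap cs)"
    by (auto simp: clauses_rel_def clause_rel_def)
  moreover have "denotes (fenv_conv \<Psi>) B A (\<lambda>_. clauses_rel (map ?swap cs))"
  proof (rule denotes_rewrites)
    show "clause_ok B A c" if "c \<in> set (map ?swap cs)" for c
      using that assms(3) by (fastforce simp: clause_ok_def)
    have "fst \<circ> snd \<circ> ?swap = snd \<circ> snd" "snd \<circ> snd \<circ> ?swap = fst \<circ> snd"
      by (auto simp: fun_eq_iff)
    then show "orth_clauses (map ?swap cs)"
      using assms(4) by (simp add: orth_clauses_def)
  qed (use assms in simp_all)
  ultimately show ?thesis
    using denotes_rewrites[OF assms] by (simp add: definable_def)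
qed

text \<open>Quantifying over all environments builds weakening into the notion: such a relation may
  be used under any fixed point operator.\<close>

definition rep :: "ty \<Rightarrow> ty \<Rightarrow> rel \<Rightarrow> bool" where
  "rep A B R \<longleftrightarrow> (\<forall>\<Psi>. definable \<Psi> A B (\<lambda>_. R))"

lemma rep_definable: "rep A B R \<Longrightarrow> definable \<Psi> A B (\<lambda>_. R)"
  by (simp add: rep_def)

lemma rep_closed: "rep A B R \<Longrightarrow> closed_ty A \<and> closed_ty B"
  by (simp add: rep_def definable_def denotes_def)

lemma rep_hom: "rep A B R \<Longrightarrow> R \<subseteq> hom A B"
  by (auto simp: rep_def definable_def denotes_def env_ok_def dest!: spec[of _ Map.empty])

lemma rep_iso:
  assumes "rep A B R"
  shows "\<exists>\<omega>. iso_typed Map.empty \<omega> (TIso A B) \<and> closed_iso_den \<omega> = arc R"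
proof -
  have "denotes Map.empty A B (\<lambda>_. R)" using assms by (simp add: rep_def definable_def)
  then obtain \<omega> where "iso_typed (ictx_of Map.empty) \<omega> (TIso A B)"
    "\<forall>\<rho>. env_ok Map.empty \<rho> \<longrightarrow> iso_den \<omega> (\<lambda>\<phi>. arc (\<rho> \<phi>)) = arc R"
    unfolding denotes_def by blast
  moreover have "arc {} = {}" by (simp add: arc_def)
  ultimately show ?thesis
    by (auto simp: closed_iso_den_def ictx_of_def env_ok_def comp_def dest: spec[of _ "\<lambda>_. {}"] intro!: exI[of _ \<omega>])
qed

lemma rep_comp: "rep A B R \<Longrightarrow> rep B C S \<Longrightarrow> rep A C (R O S)"
  unfolding rep_def using definable_comp[of _ A B "\<lambda>_. R" C "\<lambda>_. S"] by blast

lemma rep_prod: "rep A A' R \<Longrightarrow> rep B B' S \<Longrightarrow> rep (TProd A B) (TProd A' B') (par_rel R S)"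
  unfolding rep_def using definable_prod[of _ A A' "\<lambda>_. R" B B' "\<lambda>_. S"] by blast

lemma rep_sum: "rep A A' R \<Longrightarrow> rep B B' S \<Longrightarrow> rep (TSum A B) (TSum A' B') (sum_rel R S)"
  unfolding rep_def using definable_sum[of _ A A' "\<lambda>_. R" B B' "\<lambda>_. S"] by blast

lemma rep_converse: "rep A B R \<Longrightarrow> rep B A (R\<inverse>)"
proof -
  assume R: "rep A B R"
  have conv: "fenv_conv (fenv_conv \<Psi>) = \<Psi>" for \<Psi>
    by (auto simp: fenv_conv_def fun_eq_iff option.map_comp option.map_ident comp_def)
  then have "denotes \<Psi> B A (\<lambda>_. R\<inverse>) \<and> denotes (fenv_conv \<Psi>) A B (\<lambda>_. R)" for \<Psi>
    using rep_definable[OF R, of "fenv_conv \<Psi>"] by (simp add: definable_def conv)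
  then show ?thesis by (simp add: rep_def definable_def)
qed

lemma pairwise_orth_Cons [simp]:
  "pairwise_orth R (x # xs) \<longleftrightarrow> (\<forall>y \<in> set xs. R x y \<and> R y x) \<and> pairwise_orth R xs"
proof
  assume *: "pairwise_orth R (x # xs)"
  show "(\<forall>y \<in> set xs. R x y \<and> R y x) \<and> pairwise_orth R xs"
    unfolding pairwise_orth_def
  proof (intro conjI ballI allI impI)
    fix y assume "y \<in> set xs"
    then obtain i where "i < length xs" "y = xs ! i" by (auto simp: in_set_conv_nth)
    then show "R x y" "R y x"
      using * unfolding pairwise_orth_def by (metis Suc_less_eq length_Cons nat.distinct(1) nth_Cons_0 nth_Cons_Suc zero_less_Suc)+
  next
    fix i j assume "i < length xs" "j < length xs" "i \<noteq> j"
    then show "R (xs ! i) (xs ! j)"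
      using * unfolding pairwise_orth_def by (metis Suc_less_eq length_Cons nat.inject nth_Cons_Suc)
  qed
next
  assume *: "(\<forall>y \<in> set xs. R x y \<and> R y x) \<and> pairwise_orth R xs"
  then show "pairwise_orth R (x # xs)"
    unfolding pairwise_orth_def by (auto simp: nth_Cons less_Suc_eq_0_disj split: nat.splits)
qed

lemma pairwise_orth_Nil [simp]: "pairwise_orth R []"
  by (simp add: pairwise_orth_def)

lemma pairwise_orth_map:
  "distinct xs \<Longrightarrow> (\<And>x y. x \<in> set xs \<Longrightarrow> y \<in> set xs \<Longrightarrow> x \<noteq> y \<Longrightarrow> R (f x) (f y)) \<Longrightarrow> pairwise_orth R (map f xs)"
  by (auto simp: pairwise_orth_def nth_eq_iff_index_eq)

lemma rep_clauses:
  assumes "closed_ty A" "closed_ty B" "\<And>c. c \<in> set cs \<Longrightarrow> clause_ok A B c" "orth_clauses cs"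
    and "R = clauses_rel cs"
  shows "rep A B R"
  using definable_rewrites[OF assms(1-4)] by (simp add: rep_def assms(5))

lemma clause_rel_simps:
  "clause_rel ([], v, w) = {(val_den v ((!) []), val_den w ((!) []))}"
  "clause_rel ([A], v, w) = {(val_den v ((!) [a]), val_den w ((!) [a])) | a. a \<in> carrier_of A}"
  "clause_rel ([A, B], v, w) = {(val_den v ((!) [a, b]), val_den w ((!) [a, b])) | a b.
     a \<in> carrier_of A \<and> b \<in> carrier_of B}"
  "clause_rel ([A, B, C], v, w) = {(val_den v ((!) [a, b, c]), val_den w ((!) [a, b, c])) | a b c.
     a \<in> carrier_of A \<and> b \<in> carrier_of B \<and> c \<in> carrier_of C}"
  "clause_rel ([A, B, C, D], v, w) = {(val_den v ((!) [a, b, c, d]), val_den w ((!) [a, b, c, d])) | a b c d.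
     a \<in> carrier_of A \<and> b \<in> carrier_of B \<and> c \<in> carrier_of C \<and> d \<in> carrier_of D}"
  by (auto simp: clause_rel_def list_all2_Cons2)

lemmas clause_simps = clause_ok_def orth_clauses_def clauses_rel_def clause_rel_simps
  lessThan_Suc lessThan_nat_numeral

section \<open>Rearrangement of tuples\<close>

lemma rep_id:
  assumes "closed_ty A"
  shows "rep A A (Id_on (carrier_of A))"
  by (rule rep_clauses[where cs = "[([A], VVar 0, VVar 0)]"]) (use assms in \<open>auto simp: clause_simps\<close>)

lemma rep_swap:
  assumes "closed_ty A" "closed_ty B"
  shows "rep (TProd A B) (TProd B A) {(DPair a b, DPair b a) | a b. a \<in> carrier_of A \<and> b \<in> carrier_of B}"
  by (rule rep_clauses[where cs = "[([A, B], VPair (VVar 0) (VVar 1), VPair (VVar 1) (VVar 0))]"])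
    (use assms in \<open>auto simp: clause_simps\<close>)

lemma rep_assoc:
  assumes "closed_ty A" "closed_ty B" "closed_ty C"
  shows "rep (TProd A (TProd B C)) (TProd (TProd A B) C)
    {(DPair a (DPair b c), DPair (DPair a b) c) | a b c. a \<in> carrier_of A \<and> b \<in> carrier_of B \<and> c \<in> carrier_of C}"
  by (rule rep_clauses[where cs = "[([A, B, C], VPair (VVar 0) (VPair (VVar 1) (VVar 2)), VPair (VPair (VVar 0) (VVar 1)) (VVar 2))]"])
    (use assms in \<open>auto simp: clause_simps\<close>)

lemma rep_exchange:
  assumes "closed_ty A" "closed_ty B" "closed_ty C"
  shows "rep (TProd (TProd A B) C) (TProd (TProd A C) B)
    {(DPair (DPair a b) c, DPair (DPair a c) b) | a b c. a \<in> carrier_of A \<and> b \<in> carrier_of B \<and> c \<in> carrier_of C}"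
  by (rule rep_clauses[where cs = "[([A, B, C], VPair (VPair (VVar 0) (VVar 1)) (VVar 2), VPair (VPair (VVar 0) (VVar 2)) (VVar 1))]"])
    (use assms in \<open>auto simp: clause_simps\<close>)

text \<open>The form in which recursion is used below: \<open>H\<close> describes one unfolding,
  \<open>H R \<subseteq> R\<close> says that \<open>R\<close> respects the recursive equation, and
  \<open>R \<subseteq> S\<close> is proved by induction on the argument of the recursion.\<close>

lemma rep_fix:
  assumes "\<And>\<Psi>. definable (\<Psi>(0 \<mapsto> (A, B))) A B (\<lambda>\<rho>. H (\<rho> 0))"
    and "R \<subseteq> hom A B" "H R \<subseteq> R" "\<And>S. S \<subseteq> hom A B \<Longrightarrow> H S \<subseteq> S \<Longrightarrow> R \<subseteq> S"
  shows "rep A B R"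
proof -
  have "definable \<Psi> A B (\<lambda>\<rho>. rel_fix A B H)" for \<Psi>
    using definable_fix[OF assms(1), of \<Psi>] by simp
  then show ?thesis
    using rel_fix_eqI[of R A B H] assms(2-4) by (simp add: rep_def)
qed

lemma definable_fix_var:
  "closed_ty A \<Longrightarrow> closed_ty B \<Longrightarrow> definable (\<Psi>(0 \<mapsto> (A, B))) A B (\<lambda>\<rho>. \<rho> 0)"
  by (rule definable_var) auto

section \<open>Computable total functions\<close>

text \<open>The argument is kept in the result, so that the function need not be injective.\<close>

definition comp_fun :: "ty \<Rightarrow> ty \<Rightarrow> (dat \<Rightarrow> dat) \<Rightarrow> bool" where
  "comp_fun A B F \<longleftrightarrow> rep A (TProd A B) {(x, DPair x (F x)) | x. x \<in> carrier_of A}"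

abbreviation dup :: "ty \<Rightarrow> bool" where
  "dup A \<equiv> comp_fun A A (\<lambda>x. x)"

lemma comp_fun_closed: "comp_fun A B F \<Longrightarrow> closed_ty A \<and> closed_ty B"
  unfolding comp_fun_def by (drule rep_closed) simp

lemma comp_fun_carrier: "comp_fun A B F \<Longrightarrow> x \<in> carrier_of A \<Longrightarrow> F x \<in> carrier_of B"
  unfolding comp_fun_def by (drule rep_hom) (auto simp: hom_def)

lemma comp_fun_cong:
  assumes "comp_fun A B F" "\<And>x. x \<in> carrier_of A \<Longrightarrow> F x = G x"
  shows "comp_fun A B G"
proof -
  have "{(x, DPair x (F x)) | x. x \<in> carrier_of A} = {(x, DPair x (G x)) | x. x \<in> carrier_of A}"
    using assms(2) by auto
  then show ?thesis using assms(1) by (simp add: comp_fun_def)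
qed

text \<open>From \<open>x\<close> one computes \<open>F x\<close> and from that
  \<open>G (F x)\<close>. Since \<open>x\<close> is still present, the intermediate
  \<open>F x\<close> is erased by running the first computation backwards.\<close>

lemma comp_fun_comp:
  assumes "comp_fun A B F" "comp_fun B C G"
  shows "comp_fun A C (\<lambda>x. G (F x))"
proof -
  have cl: "closed_ty A" "closed_ty B" "closed_ty C"
    using assms comp_fun_closed by blast+
  note car = comp_fun_carrier[OF assms(1)] comp_fun_carrier[OF assms(2)]
  have "rep A (TProd A C)
    ({(x, DPair x (F x)) | x. x \<in> carrier_of A}
      O par_rel (Id_on (carrier_of A)) {(x, DPair x (G x)) | x. x \<in> carrier_of B}
      O {(DPair a (DPair b c), DPair (DPair a b) c) | a b c. a \<in> carrier_of A \<and> b \<in> carrier_of B \<and> c \<in> carrier_of C}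
      O par_rel ({(x, DPair x (F x)) | x. x \<in> carrier_of A}\<inverse>) (Id_on (carrier_of C)))"
    by (rule rep_comp rep_prod rep_converse rep_id rep_assoc cl assms[unfolded comp_fun_def])+
  also have "\<dots> = {(x, DPair x (G (F x))) | x. x \<in> carrier_of A}"
    using car by (auto simp: par_rel_def relcomp_unfold Id_on_iff)
  finally show ?thesis by (simp add: comp_fun_def)
qed

lemma comp_fun_pair:
  assumes "comp_fun A B F" "comp_fun A C G"
  shows "comp_fun A (TProd B C) (\<lambda>x. DPair (F x) (G x))"
proof -
  have cl: "closed_ty A" "closed_ty B" "closed_ty C"
    using assms comp_fun_closed by blast+
  note car = comp_fun_carrier[OF assms(1)] comp_fun_carrier[OF assms(2)]
  have "rep A (TProd A (TProd B C))
    ({(x, DPair x (F x)) | x. x \<in> carrier_of A}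
      O par_rel {(x, DPair x (G x)) | x. x \<in> carrier_of A} (Id_on (carrier_of B))
      O {(DPair (DPair a b) c, DPair (DPair a c) b) | a b c. a \<in> carrier_of A \<and> b \<in> carrier_of C \<and> c \<in> carrier_of B}
      O {(DPair a (DPair b c), DPair (DPair a b) c) | a b c. a \<in> carrier_of A \<and> b \<in> carrier_of B \<and> c \<in> carrier_of C}\<inverse>)"
    by (rule rep_comp rep_prod rep_converse rep_id rep_assoc rep_exchange cl assms[unfolded comp_fun_def])+
  also have "\<dots> = {(x, DPair x (DPair (F x) (G x))) | x. x \<in> carrier_of A}"
    using car by (auto simp: par_rel_def relcomp_unfold Id_on_iff)
  finally show ?thesis by (simp add: comp_fun_def)
qed

text \<open>Bennett's trick: compute, copy the result, uncompute.\<close>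

lemma comp_fun_garbage:
  assumes "rep A (TProd B C) {(x, DPair (F x) (g x)) | x. x \<in> carrier_of A}" "dup B"
    and inj: "\<And>x y. x \<in> carrier_of A \<Longrightarrow> y \<in> carrier_of A \<Longrightarrow> F x = F y \<Longrightarrow> g x = g y \<Longrightarrow> x = y"
  shows "comp_fun A B F"
proof -
  let ?T = "{(x, DPair (F x) (g x)) | x. x \<in> carrier_of A}"
  have cl: "closed_ty A" "closed_ty B" "closed_ty C"
    using rep_closed[OF assms(1)] by auto
  have car: "F x \<in> carrier_of B" "g x \<in> carrier_of C" if "x \<in> carrier_of A" for x
    using rep_hom[OF assms(1)] that by (auto simp: hom_def)
  have "rep A (TProd A B)
    (?T O par_rel {(x, DPair x x) | x. x \<in> carrier_of B} (Id_on (carrier_of C))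
      O {(DPair (DPair a b) c, DPair (DPair a c) b) | a b c. a \<in> carrier_of B \<and> b \<in> carrier_of B \<and> c \<in> carrier_of C}
      O par_rel (?T\<inverse>) (Id_on (carrier_of B)))"
    by (rule rep_comp rep_prod rep_converse rep_id rep_exchange cl assms(1) assms(2)[unfolded comp_fun_def])+
  also have "\<dots> = {(x, DPair x (F x)) | x. x \<in> carrier_of A}"
    using car by (auto simp: par_rel_def relcomp_unfold Id_on_iff dest: inj)
  finally show ?thesis by (simp add: comp_fun_def)
qed

fun dfst :: "dat \<Rightarrow> dat" where "dfst (DPair a b) = a" | "dfst x = x"
fun dsnd :: "dat \<Rightarrow> dat" where "dsnd (DPair a b) = b" | "dsnd x = x"

lemma comp_fun_fst: "dup A \<Longrightarrow> closed_ty B \<Longrightarrow> comp_fun (TProd A B) A dfst"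
proof (rule comp_fun_garbage[where g = dsnd])
  assume "dup A" "closed_ty B"
  then have "rep (TProd A B) (TProd A B) (Id_on (carrier_of (TProd A B)))"
    using comp_fun_closed by (intro rep_id) auto
  then show "rep (TProd A B) (TProd A B) {(x, DPair (dfst x) (dsnd x)) | x. x \<in> carrier_of (TProd A B)}"
    by (rule back_subst[where P = "rep _ _"]) (auto simp: Id_on_iff)
qed auto

lemma comp_fun_snd: "dup B \<Longrightarrow> closed_ty A \<Longrightarrow> comp_fun (TProd A B) B dsnd"
proof (rule comp_fun_garbage[where g = dfst])
  assume "dup B" "closed_ty A"
  then have "rep (TProd A B) (TProd B A) {(DPair a b, DPair b a) | a b. a \<in> carrier_of A \<and> b \<in> carrier_of B}"
    using comp_fun_closed by (intro rep_swap) auto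
  then show "rep (TProd A B) (TProd B A) {(x, DPair (dsnd x) (dfst x)) | x. x \<in> carrier_of (TProd A B)}"
    by (rule back_subst[where P = "rep _ _"]) auto
qed auto

lemma dup_prod: "dup A \<Longrightarrow> dup B \<Longrightarrow> dup (TProd A B)"
  by (rule comp_fun_cong[OF comp_fun_pair[OF comp_fun_fst comp_fun_snd]]) (auto dest: comp_fun_closed)

lemma comp_fun_rep:
  assumes "rep A B {(x, F x) | x. x \<in> carrier_of A}" "dup A"
  shows "comp_fun A B F"
proof -
  let ?T = "{(x, F x) | x. x \<in> carrier_of A}"
  have cl: "closed_ty A" using comp_fun_closed[OF assms(2)] by simp
  have "rep A (TProd A B) ({(x, DPair x x) | x. x \<in> carrier_of A} O par_rel (Id_on (carrier_of A)) ?T)"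
    by (rule rep_comp rep_prod rep_id cl assms(1) assms(2)[unfolded comp_fun_def])+
  also have "\<dots> = {(x, DPair x (F x)) | x. x \<in> carrier_of A}"
    by (auto simp: par_rel_def relcomp_unfold Id_on_iff)
  finally show ?thesis by (simp add: comp_fun_def)
qed

lemma dup_fin: "dup (TFin n)"
  unfolding comp_fun_def
  by (rule rep_clauses[where cs = "map (\<lambda>k. ([], vfin k, VPair (vfin k) (vfin k))) [0..<n]"])
    (auto simp: clause_simps carrier_TFin comp_def val_orth_vfin intro!: pairwise_orth_map)

lemmas rel_simps = par_rel_def sum_rel_def relcomp_unfold Id_on_iff

lemma rep_list_cases:
  assumes "closed_ty A"
  shows "rep (TList A) (TSum TOne (TProd A (TList A)))
    (insert (DNil, DInl DUnit) {(DCons a l, DInr (DPair a l)) | a l. a \<in> carrier_of A \<and> l \<in> carrier_of (TList A)})"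
  by (rule rep_clauses[where cs = "[([], VNil, VInl VUnit), ([A, TList A], VCons (VVar 0) (VVar 1), VInr (VPair (VVar 0) (VVar 1)))]"])
    (use assms in \<open>auto simp: clause_simps\<close>)

lemma carrier_TList_induct [consumes 2, case_names Nil Cons]:
  assumes "closed_ty A" "l \<in> carrier_of (TList A)"
    and "P DNil" "\<And>a l. a \<in> carrier_of A \<Longrightarrow> l \<in> carrier_of (TList A) \<Longrightarrow> P l \<Longrightarrow> P (DCons a l)"
  shows "P l"
proof -
  have "set xs \<subseteq> carrier_of A \<Longrightarrow> P (dlist xs)" for xs
  proof (induction xs)
    case (Cons a xs)
    then have "dlist xs \<in> carrier_of (TList A)" using assms(1) by (auto simp: carrier_TList)
    then show ?case using Cons assms(4) by simp
  qed (use assms(3) in simp)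
  moreover obtain xs where "l = dlist xs" "set xs \<subseteq> carrier_of A"
    using assms(1,2) by (auto simp: carrier_TList)
  ultimately show ?thesis by simp
qed

text \<open>Linearity forbids copying a variable, so a list is copied by recursion, entry by
  entry.\<close>

lemma dup_list:
  assumes "dup A"
  shows "dup (TList A)"
proof -
  have cl: "closed_ty A" using comp_fun_closed[OF assms] by simp
  then have cl': "closed_ty (TList A)" by simp
  let ?L = "TList A"
  let ?J = "insert (DInl DUnit, DPair DNil DNil)
    {(DInr (DPair (DPair a b) (DPair l m)), DPair (DCons a l) (DCons b m)) | a b l m.
      a \<in> carrier_of A \<and> b \<in> carrier_of A \<and> l \<in> carrier_of ?L \<and> m \<in> carrier_of ?L}"
  have J: "rep (TSum TOne (TProd (TProd A A) (TProd ?L ?L))) (TProd ?L ?L) ?J"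
    by (rule rep_clauses[where cs = "[([], VInl VUnit, VPair VNil VNil),
      ([A, A, ?L, ?L], VInr (VPair (VPair (VVar 0) (VVar 1)) (VPair (VVar 2) (VVar 3))),
        VPair (VCons (VVar 0) (VVar 2)) (VCons (VVar 1) (VVar 3)))]"])
      (use cl in \<open>auto simp: clause_simps\<close>)
  \<comment> \<open>Case distinction, recursive call inside one summand, reassembly. All recursive
    isos below have this shape; the reassembly \<open>?J\<close> must have orthogonal right-hand
    sides, here because an empty copy differs from a nonempty one.\<close>
  define H where "H r = insert (DNil, DInl DUnit) {(DCons a l, DInr (DPair a l)) | a l. a \<in> carrier_of A \<and> l \<in> carrier_of ?L}
    O sum_rel (Id_on (carrier_of TOne)) (par_rel {(x, DPair x x) | x. x \<in> carrier_of A} r) O ?J" for r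
  have H: "H r = insert (DNil, DPair DNil DNil)
    {(DCons a l, DPair (DCons a l') (DCons a l'')) | a l l' l''. a \<in> carrier_of A \<and> (l, DPair l' l'') \<in> r}"
    if "r \<subseteq> hom ?L (TProd ?L ?L)" for r
    unfolding H_def using subset_homD[OF that, of _ "DPair _ _"] by (auto simp: rel_simps)
  let ?R = "{(x, DPair x x) | x. x \<in> carrier_of ?L}"
  have R: "?R \<subseteq> hom ?L (TProd ?L ?L)" by auto
  show ?thesis
    unfolding comp_fun_def
  proof (rule rep_fix[where H = H])
    show "definable (\<Psi>(0 \<mapsto> (?L, TProd ?L ?L))) ?L (TProd ?L ?L) (\<lambda>\<rho>. H (\<rho> 0))" for \<Psi>
      unfolding H_def
      by (rule rep_definable[OF rep_list_cases] rep_definable[OF J] rep_definable[OF rep_id]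
          rep_definable[OF assms[unfolded comp_fun_def]] definable_fix_var definable_comp definable_sum
          definable_prod cl | simp add: cl)+
    show "H ?R \<subseteq> ?R" by (auto simp: H[OF R] carrier_TList_intros cl)
    fix S assume S: "S \<subseteq> hom ?L (TProd ?L ?L)" "H S \<subseteq> S"
    have "(l, DPair l l) \<in> S" if "l \<in> carrier_of ?L" for l
      using cl that by (induction l rule: carrier_TList_induct) (use S in \<open>auto simp: H\<close>)
    then show "?R \<subseteq> S" by auto
  qed (rule R)
qed

lemma dup_one: "dup TOne"
  unfolding comp_fun_def
  by (rule rep_clauses[where cs = "[([], VUnit, VPair VUnit VUnit)]"]) (auto simp: clause_simps)

lemma dup_nat: "dup TNat"
  unfolding TNat_def by (intro dup_list dup_one)

section \<open>Iteration with a recorded history\<close>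

lemma rep_nat_cases:
  assumes "closed_ty A"
  shows "rep (TProd A TNat) (TSum A (TProd A TNat))
    ({(DPair a (dnat 0), DInl a) | a. a \<in> carrier_of A} \<union>
     {(DPair a (dnat (Suc n)), DInr (DPair a (dnat n))) | a n. a \<in> carrier_of A})"
  by (rule rep_clauses[where cs = "[([A], VPair (VVar 0) VNil, VInl (VVar 0)),
      ([A, TNat], VPair (VVar 0) (VCons VUnit (VVar 1)), VInr (VPair (VVar 0) (VVar 1)))]"])
    (use assms in \<open>auto simp: clause_simps carrier_TNat\<close>)

primrec history :: "(dat \<Rightarrow> dat) \<Rightarrow> (dat \<Rightarrow> dat) \<Rightarrow> nat \<Rightarrow> dat \<Rightarrow> dat list" where
  "history F g 0 x = []"
| "history F g (Suc n) x = g x # history F g n (F x)"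

text \<open>The length of the history tells the number of steps. The induction hypothesis then gives
  \<open>F x = F y\<close>, and the pair of \<open>F\<close> and \<open>g\<close> separates
  points.\<close>

lemma history_inj:
  assumes "\<And>x y. x \<in> X \<Longrightarrow> y \<in> X \<Longrightarrow> F x = F y \<Longrightarrow> g x = g y \<Longrightarrow> x = y" "\<And>x. x \<in> X \<Longrightarrow> F x \<in> X"
  shows "x \<in> X \<Longrightarrow> y \<in> X \<Longrightarrow> (F ^^ m) x = (F ^^ n) y \<Longrightarrow> history F g m x = history F g n y \<Longrightarrow> m = n \<and> x = y"
proof (induction m arbitrary: n x y)
  case 0
  then show ?case by (cases n) auto
next
  case (Suc m)
  then obtain n' where n: "n = Suc n'" by (cases n) auto
  have "m = n' \<and> F x = F y"
    using Suc.prems by (intro Suc.IH) (auto simp: n funpow_swap1 assms(2))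
  then show ?case using Suc.prems assms(1)[of x y] by (simp add: n)
qed

lemma rep_iterate:
  assumes "rep A (TProd A C) {(x, DPair (F x) (g x)) | x. x \<in> carrier_of A}"
  shows "rep (TProd A TNat) (TProd A (TList C))
    {(DPair x (dnat n), DPair ((F ^^ n) x) (dlist (history F g n x))) | x n. x \<in> carrier_of A}"
proof -
  have cl: "closed_ty A" "closed_ty C" using rep_closed[OF assms] by auto
  then have cl': "closed_ty (TList C)" by simp
  have car: "F x \<in> carrier_of A" "g x \<in> carrier_of C" if "x \<in> carrier_of A" for x
    using rep_hom[OF assms] that by (auto simp: hom_def)
  have car_n: "(F ^^ n) x \<in> carrier_of A" "dlist (history F g n x) \<in> carrier_of (TList C)" if "x \<in> carrier_of A" for x n
    using that by (induction n arbitrary: x) (auto simp: car carrier_TList_intros cl funpow_swap1)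
  let ?L = "TList C"
  \<comment> \<open>An empty history marks a loop that stops at once and a nonempty one a loop that
    has made a step, so the two branches can be merged reversibly.\<close>
  let ?J = "{(DInl a, DPair a DNil) | a. a \<in> carrier_of A} \<union>
    {(DInr (DPair (DPair a l) c), DPair a (DCons c l)) | a l c.
      a \<in> carrier_of A \<and> l \<in> carrier_of ?L \<and> c \<in> carrier_of C}"
  have J: "rep (TSum A (TProd (TProd A ?L) C)) (TProd A ?L) ?J"
    by (rule rep_clauses[where cs = "[([A], VInl (VVar 0), VPair (VVar 0) VNil),
      ([A, ?L, C], VInr (VPair (VPair (VVar 0) (VVar 1)) (VVar 2)), VPair (VVar 0) (VCons (VVar 2) (VVar 1)))]"])
      (use cl in \<open>auto simp: clause_simps\<close>)
  let ?T = "{(x, DPair (F x) (g x)) | x. x \<in> carrier_of A}"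
  let ?N = "{(DPair a (dnat 0), DInl a) | a. a \<in> carrier_of A} \<union>
     {(DPair a (dnat (Suc n)), DInr (DPair a (dnat n))) | a n. a \<in> carrier_of A}"
  let ?E = "{(DPair (DPair a b) c, DPair (DPair a c) b) | a b c. a \<in> carrier_of A \<and> b \<in> carrier_of C \<and> c \<in> carrier_of TNat}"
  define H where "H r = ?N O sum_rel (Id_on (carrier_of A))
    (par_rel ?T (Id_on (carrier_of TNat)) O ?E O par_rel r (Id_on (carrier_of C))) O ?J" for r
  have H: "H r = {(DPair x (dnat 0), DPair x DNil) | x. x \<in> carrier_of A} \<union>
    {(DPair x (dnat (Suc n)), DPair y (DCons (g x) l)) | x n y l. x \<in> carrier_of A \<and>
      (DPair (F x) (dnat n), DPair y l) \<in> r}"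
    if "r \<subseteq> hom (TProd A TNat) (TProd A ?L)" for r
    unfolding H_def using subset_homD[OF that, of "DPair _ _" "DPair _ _"]
    by (auto simp: rel_simps carrier_TNat car)
  let ?R = "{(DPair x (dnat n), DPair ((F ^^ n) x) (dlist (history F g n x))) | x n. x \<in> carrier_of A}"
  have R: "?R \<subseteq> hom (TProd A TNat) (TProd A ?L)" by (auto simp: carrier_TNat car_n)
  show ?thesis
  proof (rule rep_fix[where H = H])
    show "definable (\<Psi>(0 \<mapsto> (TProd A TNat, TProd A ?L))) (TProd A TNat) (TProd A ?L) (\<lambda>\<rho>. H (\<rho> 0))" for \<Psi>
      unfolding H_def
      by (rule rep_definable[OF rep_nat_cases] rep_definable[OF J] rep_definable[OF rep_id]
          rep_definable[OF rep_exchange] rep_definable[OF assms] definable_fix_var definable_comp definable_sum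
          definable_prod cl | simp add: cl)+
    show "H ?R \<subseteq> ?R"
      unfolding H[OF R]
    proof (intro Un_least subsetI)
      fix p assume "p \<in> {(DPair x (dnat 0), DPair x DNil) | x. x \<in> carrier_of A}"
      then show "p \<in> ?R" by (force intro: exI[of _ 0])
    next
      fix p assume "p \<in> {(DPair x (dnat (Suc n)), DPair y (DCons (g x) l)) | x n y l. x \<in> carrier_of A \<and>
        (DPair (F x) (dnat n), DPair y l) \<in> ?R}"
      then obtain x n where "x \<in> carrier_of A"
        "p = (DPair x (dnat (Suc n)), DPair ((F ^^ n) (F x)) (DCons (g x) (dlist (history F g n (F x)))))"
        by auto
      then show "p \<in> ?R"
        by (auto simp: funpow_swap1 simp del: dnat_simps intro!: exI[of _ "Suc n"])
    qed
    fix S assume S: "S \<subseteq> hom (TProd A TNat) (TProd A ?L)" "H S \<subseteq> S"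
    have "(DPair x (dnat n), DPair ((F ^^ n) x) (dlist (history F g n x))) \<in> S" if "x \<in> carrier_of A" for x n
      using that
    proof (induction n arbitrary: x)
      case 0
      then show ?case using S by (auto simp: H)
    next
      case (Suc n)
      then have "(DPair (F x) (dnat n), DPair ((F ^^ n) (F x)) (dlist (history F g n (F x)))) \<in> S"
        by (simp add: car)
      then have "(DPair x (dnat (Suc n)), DPair ((F ^^ n) (F x)) (DCons (g x) (dlist (history F g n (F x))))) \<in> H S"
        using Suc.prems by (auto simp: H[OF S(1)])
      then show ?case using S(2) by (auto simp: funpow_swap1)
    qed
    then show "?R \<subseteq> S" by auto
  qed (rule R)
qed

definition diterate :: "(dat \<Rightarrow> dat) \<Rightarrow> dat \<Rightarrow> dat" where
  "diterate F p = (F ^^ (THE n. dsnd p = dnat n)) (dfst p)"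

lemma diterate [simp]: "diterate F (DPair x (dnat n)) = (F ^^ n) x"
  by (simp add: diterate_def)

text \<open>The history of the iteration is the garbage, and \<open>history_inj\<close> provides the
  injectivity that \<open>comp_fun_garbage\<close> demands for its removal.\<close>

lemma comp_fun_iterate:
  assumes T: "rep A (TProd A C) {(x, DPair (F x) (g x)) | x. x \<in> carrier_of A}" and "dup A"
    and inj: "\<And>x y. x \<in> carrier_of A \<Longrightarrow> y \<in> carrier_of A \<Longrightarrow> F x = F y \<Longrightarrow> g x = g y \<Longrightarrow> x = y"
  shows "comp_fun (TProd A TNat) A (diterate F)"
proof (rule comp_fun_garbage)
  let ?h = "\<lambda>p. dlist (history F g (THE n. dsnd p = dnat n) (dfst p))"
  show "rep (TProd A TNat) (TProd A (TList C)) {(p, DPair (diterate F p) (?h p)) | p. p \<in> carrier_of (TProd A TNat)}"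
    by (rule back_subst[where P = "rep _ _", OF rep_iterate[OF T]])
      (fastforce simp: carrier_TNat)
  have car: "F x \<in> carrier_of A" if "x \<in> carrier_of A" for x
    using rep_hom[OF T] that by (auto simp: hom_def)
  show "p = q" if "p \<in> carrier_of (TProd A TNat)" "q \<in> carrier_of (TProd A TNat)"
    "diterate F p = diterate F q" "?h p = ?h q" for p q
  proof -
    obtain x m where p: "p = DPair x (dnat m)" "x \<in> carrier_of A" using \<open>p \<in> _\<close> by (auto simp: carrier_TNat)
    obtain y n where q: "q = DPair y (dnat n)" "y \<in> carrier_of A" using \<open>q \<in> _\<close> by (auto simp: carrier_TNat)
    have "(F ^^ m) x = (F ^^ n) y" "history F g m x = history F g n y"
      using that(3,4) unfolding p(1) q(1) by simp_all
    then have "m = n \<and> x = y"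
      by (intro history_inj[of "carrier_of A" F g x y]) (use inj car p q in blast)+
    then show ?thesis using p q by simp
  qed
qed (fact assms)

section \<open>Decidable predicates and unbounded search\<close>

definition TBool :: ty where "TBool = TSum TOne TOne"

definition dbool :: "bool \<Rightarrow> dat" where
  "dbool b = (if b then DInl DUnit else DInr DUnit)"

lemma dbool_inject [simp]: "dbool b = dbool c \<longleftrightarrow> b = c"
  by (auto simp: dbool_def)

lemma closed_TBool [simp]: "closed_ty TBool"
  by (simp add: TBool_def)

lemma dbool_carrier [simp]: "dbool b \<in> carrier_of TBool"
  by (simp add: dbool_def TBool_def)

lemma carrier_TBool: "carrier_of TBool = {dbool True, dbool False}"
  by (auto simp: dbool_def TBool_def)

definition decidable :: "ty \<Rightarrow> (dat \<Rightarrow> bool) \<Rightarrow> bool" where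
  "decidable A P \<longleftrightarrow> comp_fun A TBool (\<lambda>x. dbool (P x))"

lemma decidable_comp: "comp_fun A B F \<Longrightarrow> decidable B P \<Longrightarrow> decidable A (\<lambda>x. P (F x))"
  unfolding decidable_def by (rule comp_fun_comp)

lemma decidable_cong: "decidable A P \<Longrightarrow> (\<And>x. x \<in> carrier_of A \<Longrightarrow> P x \<longleftrightarrow> Q x) \<Longrightarrow> decidable A Q"
  unfolding decidable_def by (erule comp_fun_cong) simp

lemma dup_bool: "dup TBool"
  unfolding comp_fun_def TBool_def
  by (rule rep_clauses[where cs = "[([], VInl VUnit, VPair (VInl VUnit) (VInl VUnit)),
      ([], VInr VUnit, VPair (VInr VUnit) (VInr VUnit))]"])
    (auto simp: clause_simps)

text \<open>Conjunction is not injective, so it is computed with both arguments kept as garbage,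
  which is uncomputed afterwards.\<close>

lemma decidable_conj:
  assumes "decidable A P" "decidable A Q"
  shows "decidable A (\<lambda>x. P x \<and> Q x)"
proof -
  let ?tt = "VInl VUnit" and ?ff = "VInr VUnit" and ?B2 = "TProd TBool TBool"
  let ?and = "\<lambda>x. dbool (dfst x = dbool True \<and> dsnd x = dbool True)"
  have "comp_fun ?B2 TBool ?and"
  proof (rule comp_fun_garbage[OF _ dup_bool, where g = "\<lambda>x. x"])
    let ?t = "dbool True" and ?f = "dbool False"
    have "rep ?B2 (TProd TBool ?B2) {(DPair ?t ?t, DPair ?t (DPair ?t ?t)), (DPair ?t ?f, DPair ?f (DPair ?t ?f)),
        (DPair ?f ?t, DPair ?f (DPair ?f ?t)), (DPair ?f ?f, DPair ?f (DPair ?f ?f))}"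
      by (rule rep_clauses[where cs = "[([], VPair ?tt ?tt, VPair ?tt (VPair ?tt ?tt)),
        ([], VPair ?tt ?ff, VPair ?ff (VPair ?tt ?ff)),
        ([], VPair ?ff ?tt, VPair ?ff (VPair ?ff ?tt)),
        ([], VPair ?ff ?ff, VPair ?ff (VPair ?ff ?ff))]"])
        (simp, simp, fastforce simp: clause_simps TBool_def, simp add: clause_simps,
          simp add: clause_simps dbool_def insert_commute)
    then show "rep ?B2 (TProd TBool ?B2) {(x, DPair (?and x) x) | x. x \<in> carrier_of ?B2}"
      by (rule back_subst[where P = "rep _ _"]) (auto simp: carrier_TBool)
  qed
  then have "comp_fun A TBool (\<lambda>x. ?and (DPair (dbool (P x)) (dbool (Q x))))"
    using assms unfolding decidable_def by (intro comp_fun_comp[OF comp_fun_pair])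
  then show ?thesis by (simp add: decidable_def)
qed

text \<open>The Boolean computed next to \<open>x\<close> is consumed by turning it into the choice
  of a summand. This makes a decidable test a reversible branching.\<close>

lemma rep_split:
  assumes "decidable A P"
  shows "rep A (TSum A A) ({(x, DInl x) | x. x \<in> carrier_of A \<and> P x} \<union> {(x, DInr x) | x. x \<in> carrier_of A \<and> \<not> P x})"
proof -
  have cl: "closed_ty A" using assms comp_fun_closed by (auto simp: decidable_def)
  have "rep (TProd A TBool) (TSum A A) ({(DPair x (dbool True), DInl x) | x. x \<in> carrier_of A} \<union>
      {(DPair x (dbool False), DInr x) | x. x \<in> carrier_of A})"
    by (rule rep_clauses[where cs = "[([A], VPair (VVar 0) (VInl VUnit), VInl (VVar 0)),
        ([A], VPair (VVar 0) (VInr VUnit), VInr (VVar 0))]"])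
      (use cl in \<open>auto simp: clause_simps TBool_def dbool_def\<close>)
  from rep_comp[OF assms[unfolded decidable_def comp_fun_def] this] show ?thesis
    by (rule back_subst[where P = "rep _ _"]) (auto simp: relcomp_unfold)
qed

text \<open>A loop in the language reveals the number of its iterations. Here this number is the
  result of the search, so that it can be merged with the loop variable.\<close>

lemma rep_search:
  assumes "decidable (TProd A TNat) P"
  shows "rep A (TProd A TNat)
    {(x, DPair x (dnat k)) | x k. x \<in> carrier_of A \<and> P (DPair x (dnat k)) \<and> (\<forall>j<k. \<not> P (DPair x (dnat j)))}"
proof -
  have cl: "closed_ty A" "closed_ty TNat" using comp_fun_closed[OF assms[unfolded decidable_def]] by auto
  let ?A = "TProd A TNat"
  have clA: "closed_ty ?A" using cl by simp
  let ?succ = "{(DPair x (dnat k), DPair x (dnat (Suc k))) | x k. x \<in> carrier_of A}"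
  have succ: "rep ?A ?A ?succ"
    by (rule rep_clauses[where cs = "[([A, TNat], VPair (VVar 0) (VVar 1), VPair (VVar 0) (VCons VUnit (VVar 1)))]"])
      (use cl in \<open>auto simp: clause_simps carrier_TNat\<close>)
  let ?init = "{(x, DPair x (dnat 0)) | x. x \<in> carrier_of A}"
  have init: "rep A ?A ?init"
    by (rule rep_clauses[where cs = "[([A], VVar 0, VPair (VVar 0) VNil)]"])
      (use cl in \<open>auto simp: clause_simps\<close>)
  \<comment> \<open>The counter of rounds, 0 on immediate exit and a successor after a further
    round, keeps the two exits of the loop orthogonal.\<close>
  let ?J = "{(DInl q, DPair q (dnat 0)) | q. q \<in> carrier_of ?A} \<union>
    {(DInr (DPair q (dnat c)), DPair q (dnat (Suc c))) | q c. q \<in> carrier_of ?A}"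
  have J: "rep (TSum ?A (TProd ?A TNat)) (TProd ?A TNat) ?J"
    by (rule rep_clauses[where cs = "[([?A], VInl (VVar 0), VPair (VVar 0) VNil),
        ([?A, TNat], VInr (VPair (VVar 0) (VVar 1)), VPair (VVar 0) (VCons VUnit (VVar 1)))]"])
      (use cl in \<open>auto simp: clause_simps carrier_TNat\<close>)
  let ?S = "{(x, DInl x) | x. x \<in> carrier_of ?A \<and> P x} \<union> {(x, DInr x) | x. x \<in> carrier_of ?A \<and> \<not> P x}"
  define H where "H r = ?S O sum_rel (Id_on (carrier_of ?A)) (?succ O r) O ?J" for r
  have H: "H r = {(DPair x (dnat k), DPair (DPair x (dnat k)) (dnat 0)) | x k. x \<in> carrier_of A \<and> P (DPair x (dnat k))} \<union>
    {(DPair x (dnat k), DPair q (dnat (Suc c))) | x k q c. x \<in> carrier_of A \<and> \<not> P (DPair x (dnat k)) \<and>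
      (DPair x (dnat (Suc k)), DPair q (dnat c)) \<in> r}" if "r \<subseteq> hom ?A (TProd ?A TNat)" for r
    unfolding H_def using subset_homD[OF that, of "DPair _ _" "DPair _ _"]
    by (auto simp: rel_simps carrier_TNat)
  \<comment> \<open>Started at position \<open>k\<close>, the loop stops at \<open>k + c\<close>
    with counter \<open>c\<close>. The general \<open>k\<close> is needed for the recursion, the
    case \<open>k = 0\<close> is the one that is used.\<close>
  let ?R = "{(DPair x (dnat k), DPair (DPair x (dnat (k + c))) (dnat c)) | x k c. x \<in> carrier_of A \<and>
    P (DPair x (dnat (k + c))) \<and> (\<forall>j<c. \<not> P (DPair x (dnat (k + j))))}"
  have R: "?R \<subseteq> hom ?A (TProd ?A TNat)" by (auto simp: carrier_TNat)
  have repR: "rep ?A (TProd ?A TNat) ?R"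
  proof (rule rep_fix[where H = H])
    show "definable (\<Psi>(0 \<mapsto> (?A, TProd ?A TNat))) ?A (TProd ?A TNat) (\<lambda>\<rho>. H (\<rho> 0))" for \<Psi>
      unfolding H_def
      by (rule rep_definable[OF rep_split] rep_definable[OF J] rep_definable[OF succ] rep_definable[OF rep_id]
          definable_fix_var definable_comp definable_sum cl assms | simp add: cl)+
    show "H ?R \<subseteq> ?R"
      unfolding H[OF R]
    proof (intro Un_least subsetI)
      fix p assume "p \<in> {(DPair x (dnat k), DPair (DPair x (dnat k)) (dnat 0)) | x k. x \<in> carrier_of A \<and> P (DPair x (dnat k))}"
      then show "p \<in> ?R" by (force intro: exI[of _ 0])
    next
      fix p assume "p \<in> {(DPair x (dnat k), DPair q (dnat (Suc c))) | x k q c. x \<in> carrier_of A \<and>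
        \<not> P (DPair x (dnat k)) \<and> (DPair x (dnat (Suc k)), DPair q (dnat c)) \<in> ?R}"
      then obtain x k c where *: "x \<in> carrier_of A" "\<not> P (DPair x (dnat k))" "P (DPair x (dnat (Suc k + c)))"
        "\<forall>j<c. \<not> P (DPair x (dnat (Suc k + j)))"
        "p = (DPair x (dnat k), DPair (DPair x (dnat (Suc k + c))) (dnat (Suc c)))"
        by (auto simp del: dnat_simps)
      have "\<not> P (DPair x (dnat (k + j)))" if "j < Suc c" for j
        using * that by (cases j) (auto simp del: dnat_simps)
      with * show "p \<in> ?R"
        by (auto simp del: dnat_simps intro!: exI[of _ k] exI[of _ "Suc c"])
    qed
    fix S assume S: "S \<subseteq> hom ?A (TProd ?A TNat)" "H S \<subseteq> S"
    have "(DPair x (dnat k), DPair (DPair x (dnat (k + c))) (dnat c)) \<in> S"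
      if "x \<in> carrier_of A" "P (DPair x (dnat (k + c)))" "\<forall>j<c. \<not> P (DPair x (dnat (k + j)))" for x k c
      using that
    proof (induction c arbitrary: k)
      case 0
      then have "(DPair x (dnat k), DPair (DPair x (dnat k)) (dnat 0)) \<in> H S"
        unfolding H[OF S(1)] by auto
      then show ?case using S(2) by auto
    next
      case (Suc c)
      have "\<not> P (DPair x (dnat k))" using Suc.prems(3) by (auto dest: spec[of _ 0])
      moreover have "(DPair x (dnat (Suc k)), DPair (DPair x (dnat (Suc k + c))) (dnat c)) \<in> S"
        using Suc.prems by (intro Suc.IH) (auto simp del: dnat_simps dest: spec[of _ "Suc _"])
      ultimately have "(DPair x (dnat k), DPair (DPair x (dnat (Suc k + c))) (dnat (Suc c))) \<in> H S"
        unfolding H[OF S(1)] using Suc.prems(1) by blast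
      then show ?case using S(2) by auto
    qed
    then show "?R \<subseteq> S" by auto
  qed (rule R)
  \<comment> \<open>Starting at 0 makes the final position equal to the counter, and the converse of
    duplication merges the two copies.\<close>
  have "rep A ?A (?init O ?R O
    {(DPair a (DPair b c), DPair (DPair a b) c) | a b c. a \<in> carrier_of A \<and> b \<in> carrier_of TNat \<and> c \<in> carrier_of TNat}\<inverse>
    O par_rel (Id_on (carrier_of A)) ({(x, DPair x x) | x. x \<in> carrier_of TNat}\<inverse>))"
    by (rule rep_comp rep_converse rep_prod rep_id rep_assoc cl init repR dup_nat[unfolded comp_fun_def])+
  then show ?thesis
    by (rule back_subst[where P = "rep _ _"]) (auto simp: rel_simps carrier_TNat)
qed

text \<open>A definable bijection with the numbers turns search over \<open>TNat\<close> into search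
  over \<open>C\<close>. Its injectivity ensures that a unique solution has a unique index.\<close>

definition enumerable :: "ty \<Rightarrow> bool" where
  "enumerable C \<longleftrightarrow> dup C \<and> (\<exists>e. rep TNat C {(dnat n, e n) | n. True} \<and> bij_betw e UNIV (carrier_of C))"

text \<open>Since at most one \<open>c\<close> solves \<open>P\<close> for a given \<open>x\<close>,
  the least index of a solution is its only index. So the minimality clause of
  \<open>rep_search\<close> disappears and the result no longer depends on the enumeration.\<close>

lemma rep_search_enumerable:
  assumes "decidable (TProd A C) P" "dup A" "enumerable C"
    and unique: "\<And>x c d. x \<in> carrier_of A \<Longrightarrow> c \<in> carrier_of C \<Longrightarrow> d \<in> carrier_of C \<Longrightarrow>
      P (DPair x c) \<Longrightarrow> P (DPair x d) \<Longrightarrow> c = d"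
  shows "rep A (TProd A C) {(x, DPair x c) | x c. x \<in> carrier_of A \<and> c \<in> carrier_of C \<and> P (DPair x c)}"
proof -
  obtain e where e: "rep TNat C {(dnat n, e n) | n. True}" "bij_betw e UNIV (carrier_of C)"
    using assms(3) by (auto simp: enumerable_def)
  have cl: "closed_ty A" using comp_fun_closed[OF assms(2)] by simp
  have inj: "e m = e n \<longleftrightarrow> m = n" for m n
    using e(2) by (auto simp: bij_betw_def dest: injD)
  have car: "carrier_of C = range e" using e(2) by (simp add: bij_betw_def)
  define e' where "e' x = e (THE n. x = dnat n)" for x
  have e': "e' (dnat n) = e n" for n by (simp add: e'_def)
  have "comp_fun TNat C e'"
    by (rule comp_fun_rep[OF back_subst[where P = "rep _ _", OF e(1)] dup_nat]) (auto simp: carrier_TNat e')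
  then have "comp_fun (TProd A TNat) (TProd A C) (\<lambda>p. DPair (dfst p) (e' (dsnd p)))"
    using cl by (intro comp_fun_pair comp_fun_comp[OF comp_fun_snd] comp_fun_fst assms dup_nat) auto
  from rep_search[OF decidable_comp[OF this assms(1)]]
  have "rep A (TProd A TNat) {(x, DPair x (dnat k)) | x k. x \<in> carrier_of A \<and> P (DPair x (e k)) \<and>
    (\<forall>j<k. \<not> P (DPair x (e j)))}"
    by (simp add: e')
  from rep_comp[OF this rep_prod[OF rep_id[OF cl] e(1)]] show ?thesis
  proof (rule back_subst[where P = "rep _ _"])
    have "\<forall>j<k. \<not> P (DPair x (e j))" if "x \<in> carrier_of A" "P (DPair x (e k))" for x k
    proof (intro allI impI notI)
      fix j assume "j < k" "P (DPair x (e j))"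
      then have "e k = e j" by (intro unique[OF that(1) _ _ that(2)]) (simp_all add: car)
      then show False using \<open>j < k\<close> by (simp add: inj)
    qed
    then have eq: "{(x, DPair x (dnat k)) | x k. x \<in> carrier_of A \<and> P (DPair x (e k)) \<and> (\<forall>j<k. \<not> P (DPair x (e j)))} =
      {(x, DPair x (dnat k)) | x k. x \<in> carrier_of A \<and> P (DPair x (e k))}"
      by blast
    show "{(x, DPair x (dnat k)) | x k. x \<in> carrier_of A \<and> P (DPair x (e k)) \<and> (\<forall>j<k. \<not> P (DPair x (e j)))} O
      par_rel (Id_on (carrier_of A)) {(dnat n, e n) | n. True} =
      {(x, DPair x c) | x c. x \<in> carrier_of A \<and> c \<in> carrier_of C \<and> P (DPair x c)}"
      unfolding eq by (auto simp: rel_simps car)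
  qed
qed

text \<open>Definition of a sequence by recursion on the index, from the definable passage from
  \<open>e n\<close> to \<open>e (Suc n)\<close>. That passage sees only the value
  \<open>e n\<close>, hence \<open>e\<close> has to be injective.\<close>

lemma rep_enum:
  assumes J: "rep (TSum TOne A) A (insert (DInl DUnit, e 0) {(DInr (e n), e (Suc n)) | n. True})"
    and e: "range e \<subseteq> carrier_of A" and inj: "inj e"
  shows "rep TNat A {(dnat n, e n) | n. True}"
proof -
  have cl: "closed_ty A" using rep_closed[OF J] by simp
  let ?N = "insert (dnat 0, DInl DUnit) {(dnat (Suc n), DInr (dnat n)) | n. True}"
  have N: "rep TNat (TSum TOne TNat) ?N"
    by (rule rep_clauses[where cs = "[([], VNil, VInl VUnit), ([TNat], VCons VUnit (VVar 0), VInr (VVar 0))]"])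
      (auto simp: clause_simps carrier_TNat)
  let ?J = "insert (DInl DUnit, e 0) {(DInr (e n), e (Suc n)) | n. True}"
  let ?R = "{(dnat n, e n) | n. True}"
  define H where "H r = ?N O sum_rel (Id_on (carrier_of TOne)) r O ?J" for r
  have H: "H r = insert (dnat 0, e 0) {(dnat (Suc n), e (Suc m)) | n m. (dnat n, e m) \<in> r}" for r
    unfolding H_def by (auto simp: rel_simps)
  have R: "?R \<subseteq> hom TNat A" using e by (auto simp: carrier_TNat image_subset_iff)
  show ?thesis
  proof (rule rep_fix[where H = H])
    show "definable (\<Psi>(0 \<mapsto> (TNat, A))) TNat A (\<lambda>\<rho>. H (\<rho> 0))" for \<Psi>
      unfolding H_def
      by (rule rep_definable[OF J] rep_definable[OF N] rep_definable[OF rep_id]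
          definable_fix_var definable_comp definable_sum cl | simp)+
    \<comment> \<open>An element of \<open>H ?R\<close> arises from \<open>(dnat n, e m)\<close> in
      \<open>?R\<close>, which means \<open>e m = e n\<close>; injectivity gives
      \<open>m = n\<close>.\<close>
    show "H ?R \<subseteq> ?R"
      unfolding H using inj by (auto simp flip: dnat_simps dest: injD)
    fix S assume S: "H S \<subseteq> S"
    have "(dnat n, e n) \<in> S" for n
    proof (induction n)
      case 0
      show ?case using S by (auto simp: H)
    next
      case (Suc n)
      then have "(dnat (Suc n), e (Suc n)) \<in> H S" unfolding H by blast
      then show ?case using S by blast
    qed
    then show "?R \<subseteq> S" by auto
  qed (rule R)
qed

lemma enumerable_nat: "enumerable TNat"
proof -
  have "rep TNat TNat {(dnat n, dnat n) | n. True}"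
    by (rule back_subst[where P = "rep _ _", OF rep_id[OF closed_TNat]]) (auto simp: carrier_TNat Id_on_iff)
  moreover have "bij_betw dnat UNIV (carrier_of TNat)"
    by (simp add: bij_betw_def carrier_TNat inj_def)
  ultimately show ?thesis by (auto simp: enumerable_def dup_nat)
qed

text \<open>Cantor's enumeration along the diagonals has a successor that is a rewriting of
  patterns: \<open>(x, y + 1)\<close> moves to \<open>(x + 1, y)\<close> on the same diagonal, and
  the end \<open>(x, 0)\<close> of a diagonal moves to the beginning \<open>(0, x + 1)\<close> of
  the next.\<close>

lemma rep_unpair:
  "rep TNat (TProd TNat TNat) {(dnat n, DPair (dnat (fst (prod_decode n))) (dnat (snd (prod_decode n)))) | n. True}"
proof (rule rep_enum)
  let ?e = "\<lambda>n. DPair (dnat (fst (prod_decode n))) (dnat (snd (prod_decode n)))"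
  let ?N2 = "TProd TNat TNat"
  let ?J = "insert (DInl DUnit, DPair (dnat 0) (dnat 0))
    ({(DInr (DPair (dnat x) (dnat (Suc y))), DPair (dnat (Suc x)) (dnat y)) | x y. True} \<union>
     {(DInr (DPair (dnat x) (dnat 0)), DPair (dnat 0) (dnat (Suc x))) | x. True})"
  have "rep (TSum TOne ?N2) ?N2 ?J"
    by (rule rep_clauses[where cs = "[([], VInl VUnit, VPair VNil VNil),
      ([TNat, TNat], VInr (VPair (VVar 0) (VCons VUnit (VVar 1))), VPair (VCons VUnit (VVar 0)) (VVar 1)),
      ([TNat], VInr (VPair (VVar 0) VNil), VPair VNil (VCons VUnit (VVar 0)))]"])
      (auto simp: clause_simps carrier_TNat)
  moreover have "?J = insert (DInl DUnit, ?e 0) {(DInr (?e n), ?e (Suc n)) | n. True}"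
  proof -
    have s1: "prod_decode (Suc (prod_encode (x, Suc y))) = (Suc x, y)" for x y
    proof -
      have "Suc (prod_encode (x, Suc y)) = prod_encode (Suc x, y)" by (simp add: prod_encode_def)
      then show ?thesis by simp
    qed
    have s2: "prod_decode (Suc (prod_encode (x, 0))) = (0, Suc x)" for x
    proof -
      have "Suc (prod_encode (x, 0)) = prod_encode (0, Suc x)" by (simp add: prod_encode_def)
      then show ?thesis by simp
    qed
    have "prod_decode 0 = (0, 0)"
      using prod_encode_inverse[of "(0, 0)"] by (simp add: prod_encode_def)
    moreover have "{(DInr (?e n), ?e (Suc n)) | n. True} =
      {(DInr (DPair (dnat x) (dnat (Suc y))), DPair (dnat (Suc x)) (dnat y)) | x y. True} \<union>
      {(DInr (DPair (dnat x) (dnat 0)), DPair (dnat 0) (dnat (Suc x))) | x. True}" (is "?L = ?R")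
    proof
      show "?L \<subseteq> ?R"
      proof
        fix p assume "p \<in> ?L"
        then obtain n where p: "p = (DInr (?e n), ?e (Suc n))" by blast
        obtain x y where n: "n = prod_encode (x, y)" by (metis prod_decode_inverse surj_pair)
        show "p \<in> ?R" by (cases y) (auto simp: p n s1 s2)
      qed
      show "?R \<subseteq> ?L"
        by (auto intro: exI[of _ "prod_encode (_, Suc _)"] exI[of _ "prod_encode (_, 0)"] simp: s1 s2)
    qed
    ultimately show ?thesis by simp
  qed
  ultimately show "rep (TSum TOne ?N2) ?N2 (insert (DInl DUnit, ?e 0) {(DInr (?e n), ?e (Suc n)) | n. True})"
    by (simp only:)
  show "range ?e \<subseteq> carrier_of ?N2"
    by (auto simp: carrier_TNat)
  show "inj ?e"
    by (rule injI) (metis dat.inject(3) dnat_inject prod.expand prod_decode_inverse)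
qed

lemma enumerable_prod:
  assumes "enumerable A" "enumerable B"
  shows "enumerable (TProd A B)"
proof -
  obtain e where e: "rep TNat A {(dnat n, e n) | n. True}" "bij_betw e UNIV (carrier_of A)"
    using assms(1) by (auto simp: enumerable_def)
  obtain e' where e': "rep TNat B {(dnat n, e' n) | n. True}" "bij_betw e' UNIV (carrier_of B)"
    using assms(2) by (auto simp: enumerable_def)
  let ?d = "\<lambda>n. DPair (e (fst (prod_decode n))) (e' (snd (prod_decode n)))"
  have "rep TNat (TProd A B) {(dnat n, ?d n) | n. True}"
    by (rule back_subst[where P = "rep _ _", OF rep_comp[OF rep_unpair rep_prod[OF e(1) e'(1)]]])
      (auto simp: rel_simps)
  moreover have "bij_betw ?d UNIV (carrier_of (TProd A B))"
  proof -
    have "inj ?d"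
    proof (rule injI)
      fix m n assume "?d m = ?d n"
      then have "fst (prod_decode m) = fst (prod_decode n)" "snd (prod_decode m) = snd (prod_decode n)"
        using e(2) e'(2) by (simp_all add: bij_betw_def inj_eq)
      then have "prod_decode m = prod_decode n" by (rule prod_eqI)
      then show "m = n" by (metis prod_decode_inverse)
    qed
    moreover have "range ?d = carrier_of (TProd A B)"
    proof -
      have "carrier_of A = range e" "carrier_of B = range e'"
        using e(2) e'(2) by (simp_all add: bij_betw_def)
      moreover have "DPair (e x) (e' y) \<in> range ?d" for x y
        by (rule range_eqI[of _ _ "prod_encode (x, y)"]) simp
      ultimately show ?thesis by auto
    qed
    ultimately show ?thesis by (simp add: bij_betw_def)
  qed
  ultimately show ?thesis using assms by (auto simp: enumerable_def dup_prod)
qed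

text \<open>Search yields \<open>x \<mapsto> (x, y, c)\<close> as well as \<open>y \<mapsto> (x, y, c)\<close>; the first followed by the inverse
  of the second leaves no garbage.\<close>

lemma rep_by_unique_certificate:
  assumes P: "decidable (TProd A (TProd B C)) (\<lambda>p. P (dfst p) (dfst (dsnd p)) (dsnd (dsnd p)))"
    and "enumerable A" "enumerable B" "enumerable C"
    and u1: "\<And>x y c y' c'. P x y c \<Longrightarrow> P x y' c' \<Longrightarrow> y = y' \<and> c = c'"
    and u2: "\<And>x y c x' c'. P x y c \<Longrightarrow> P x' y c' \<Longrightarrow> x = x' \<and> c = c'"
  shows "rep A B {(x, y) | x y. x \<in> carrier_of A \<and> y \<in> carrier_of B \<and> (\<exists>c \<in> carrier_of C. P x y c)}"
proof -
  have dup: "dup A" "dup B" "dup C" using assms by (auto simp: enumerable_def)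
  then have cl: "closed_ty A" "closed_ty B" "closed_ty C" using comp_fun_closed by blast+
  let ?X = "{(DPair a (DPair b c), DPair b (DPair a c)) | a b c. a \<in> carrier_of A \<and> b \<in> carrier_of B \<and> c \<in> carrier_of C}"
  have X: "rep (TProd A (TProd B C)) (TProd B (TProd A C)) ?X"
    by (rule rep_clauses[where cs = "[([A, B, C], VPair (VVar 0) (VPair (VVar 1) (VVar 2)),
        VPair (VVar 1) (VPair (VVar 0) (VVar 2)))]"])
      (use cl in \<open>auto simp: clause_simps\<close>)
  \<comment> \<open>The same test with the roles of \<open>x\<close> and \<open>y\<close> exchanged,
    for the search that starts from \<open>y\<close>.\<close>
  have "comp_fun (TProd B (TProd A C)) (TProd A (TProd B C))
      (\<lambda>p. DPair (dfst (dsnd p)) (DPair (dfst p) (dsnd (dsnd p))))"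
    by (rule comp_fun_rep[OF back_subst[where P = "rep _ _", OF rep_converse[OF X]]])
      (use dup in \<open>auto intro: dup_prod\<close>)
  from decidable_comp[OF this P]
  have P': "decidable (TProd B (TProd A C)) (\<lambda>p. P (dfst (dsnd p)) (dfst p) (dsnd (dsnd p)))"
    by simp
  have S1: "rep A (TProd A (TProd B C)) {(x, DPair x (DPair y c)) | x y c.
      x \<in> carrier_of A \<and> y \<in> carrier_of B \<and> c \<in> carrier_of C \<and> P x y c}"
    by (rule back_subst[where P = "rep _ _", OF rep_search_enumerable[OF P dup(1) enumerable_prod]])
      (use assms(2-4) u1 in auto)
  have S2: "rep B (TProd B (TProd A C)) {(y, DPair y (DPair x c)) | x y c.
      x \<in> carrier_of A \<and> y \<in> carrier_of B \<and> c \<in> carrier_of C \<and> P x y c}"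
    by (rule back_subst[where P = "rep _ _", OF rep_search_enumerable[OF P' dup(2) enumerable_prod]])
      (use assms(2-4) u2 in auto)
  from rep_comp[OF S1 rep_comp[OF X rep_converse[OF S2]]] show ?thesis
    by (rule back_subst[where P = "rep _ _"]) (auto simp: relcomp_unfold, blast)
qed


section \<open>Words\<close>

definition TWord :: "nat \<Rightarrow> ty" where "TWord N = TList (TFin N)"

definition dword :: "nat list \<Rightarrow> dat" where "dword w = dlist (map dfin w)"

lemma dword_simps [simp]: "dword [] = DNil" "dword (x # w) = DCons (dfin x) (dword w)"
  by (simp_all add: dword_def)

lemma dword_inject [simp]: "dword v = dword w \<longleftrightarrow> v = w"
  by (auto simp: dword_def inj_on_def dest: map_injective)

lemma closed_TWord [simp]: "closed_ty (TWord N)"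
  by (simp add: TWord_def)

lemma carrier_TWord: "carrier_of (TWord N) = dword ` {w. set w \<subseteq> {..<N}}"
proof -
  have "lists (dfin ` {..<N}) = map dfin ` {w. set w \<subseteq> {..<N}}"
    by (subst lists_image) (simp only: lists_eq_set)
  then show ?thesis
    by (auto simp: TWord_def carrier_TList carrier_TFin dword_def)
qed

lemma dfin_carrier [simp]: "dfin k \<in> carrier_of (TFin N) \<longleftrightarrow> k < N"
  by (auto simp: carrier_TFin)

lemma dword_carrier [simp]: "dword w \<in> carrier_of (TWord N) \<longleftrightarrow> set w \<subseteq> {..<N}"
  by (auto simp: carrier_TWord)

lemma dup_word: "dup (TWord N)"
  unfolding TWord_def by (intro dup_list dup_fin)

lemma VWord_simps [simp]:
  "val_wt ts VNil (TWord N)"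
  "val_wt ts (VCons v w) (TWord N) \<longleftrightarrow> val_wt ts v (TFin N) \<and> val_wt ts w (TWord N)"
  by (simp_all add: TWord_def)

text \<open>The successor in bijective base \<open>N\<close> numeration, least significant digit first.\<close>

primrec word_succ :: "nat \<Rightarrow> nat list \<Rightarrow> nat list" where
  "word_succ N [] = [0]"
| "word_succ N (x # w) = (if Suc x < N then Suc x # w else 0 # word_succ N w)"

primrec word_value :: "nat \<Rightarrow> nat list \<Rightarrow> nat" where
  "word_value N [] = 0"
| "word_value N (x # w) = Suc x + N * word_value N w"

lemma word_succ_set: "0 < N \<Longrightarrow> set w \<subseteq> {..<N} \<Longrightarrow> set (word_succ N w) \<subseteq> {..<N}"
  by (induction w) auto

lemma word_value_succ: "0 < N \<Longrightarrow> set w \<subseteq> {..<N} \<Longrightarrow> word_value N (word_succ N w) = Suc (word_value N w)"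
  by (induction w) (auto simp: not_less less_Suc_eq_le algebra_simps dest: le_antisym)

text \<open>Digit \<open>x\<close> counts as \<open>Suc x\<close>, so the predecessor of the value
  of \<open>x # w\<close> has residue \<open>x\<close> modulo \<open>N\<close>. This recovers the
  digits, the least significant one first.\<close>

lemma word_value_inject:
  "set v \<subseteq> {..<N} \<Longrightarrow> set w \<subseteq> {..<N} \<Longrightarrow> word_value N v = word_value N w \<Longrightarrow> v = w"
proof (induction v arbitrary: w)
  case Nil
  then show ?case by (cases w) auto
next
  case (Cons x v)
  then obtain y w' where w: "w = y # w'" by (cases w) auto
  have eq: "x + N * word_value N v = y + N * word_value N w'" using Cons.prems by (simp add: w)
  then have "(x + N * word_value N v) mod N = (y + N * word_value N w') mod N" by simp
  then have "x = y" using Cons.prems by (simp add: w)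
  with eq Cons show ?case by (auto simp: w)
qed

text \<open>The successor of a word is never empty and is returned as head and tail. This makes the
  right-hand sides orthogonal: \<open>[0]\<close> arises only from the empty word, whereas a carry
  yields 0 followed by a nonempty word.\<close>

lemma rep_word_succ:
  assumes "0 < N"
  shows "rep (TWord N) (TProd (TFin N) (TWord N))
    {(dword w, DPair (dfin (hd (word_succ N w))) (dword (tl (word_succ N w)))) | w. set w \<subseteq> {..<N}}"
proof -
  let ?W = "TWord N" and ?F = "TFin N"
  let ?P = "TProd ?F ?W"
  \<comment> \<open>The left summand collects the words whose successor is known at once, the right
    one those whose first digit is the largest, \<open>N - 1\<close>, where the carry requires a
    recursive call on the rest.\<close>
  let ?S = "{(DNil, DInl (DPair (dfin 0) DNil))} \<union>
    {(DCons (dfin (N - 1)) (dword w), DInr (dword w)) | w. set w \<subseteq> {..<N}} \<union>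
    {(DCons (dfin x) (dword w), DInl (DPair (dfin (Suc x)) (dword w))) | x w. x < N - 1 \<and> set w \<subseteq> {..<N}}"
  have S: "rep ?W (TSum ?P ?W) ?S"
    by (rule rep_clauses[where cs = "([], VNil, VInl (VPair (vfin 0) VNil)) #
      ([?W], VCons (vfin (N - 1)) (VVar 0), VInr (VVar 0)) #
      map (\<lambda>x. ([?W], VCons (vfin x) (VVar 0), VInl (VPair (vfin (Suc x)) (VVar 0)))) [0..<N - 1]"])
      (use assms in \<open>auto simp: clause_simps carrier_TWord comp_def val_orth_vfin
        simp del: vfin.simps intro!: pairwise_orth_map\<close>)
  let ?J = "{(DInl (DPair (dfin 0) DNil), DPair (dfin 0) DNil)} \<union>
    {(DInr (DPair (dfin x) (dword w)), DPair (dfin 0) (DCons (dfin x) (dword w))) | x w. x < N \<and> set w \<subseteq> {..<N}} \<union>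
    {(DInl (DPair (dfin (Suc x)) (dword w)), DPair (dfin (Suc x)) (dword w)) | x w. x < N - 1 \<and> set w \<subseteq> {..<N}}"
  have J: "rep (TSum ?P ?P) ?P ?J"
    by (rule rep_clauses[where cs = "([], VInl (VPair (vfin 0) VNil), VPair (vfin 0) VNil) #
      ([?F, ?W], VInr (VPair (VVar 0) (VVar 1)), VPair (vfin 0) (VCons (VVar 0) (VVar 1))) #
      map (\<lambda>x. ([?W], VInl (VPair (vfin (Suc x)) (VVar 0)), VPair (vfin (Suc x)) (VVar 0))) [0..<N - 1]"])
      (use assms in \<open>auto simp: clause_simps carrier_TWord carrier_TFin comp_def val_orth_vfin
        simp del: vfin.simps intro!: pairwise_orth_map\<close>)
  define H where "H r = ?S O sum_rel (Id_on (carrier_of ?P)) r O ?J" for r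
  have H: "H r = insert (DNil, DPair (dfin 0) DNil)
    ({(DCons (dfin x) (dword w), DPair (dfin (Suc x)) (dword w)) | x w. x < N - 1 \<and> set w \<subseteq> {..<N}} \<union>
     {(DCons (dfin (N - 1)) (dword w), DPair (dfin 0) (DCons (dfin x) (dword v))) | w x v.
        set w \<subseteq> {..<N} \<and> x < N \<and> set v \<subseteq> {..<N} \<and> (dword w, DPair (dfin x) (dword v)) \<in> r})" for r
    unfolding H_def using assms dword_carrier[of "[]" N] by (auto simp: rel_simps simp del: dfin.simps)
  let ?s = "\<lambda>w. DPair (dfin (hd (word_succ N w))) (dword (tl (word_succ N w)))"
  let ?R = "{(dword w, ?s w) | w. set w \<subseteq> {..<N}}"
  have ne: "word_succ N w \<noteq> []" for w by (cases w) auto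
  have car: "hd (word_succ N w) < N \<and> set (tl (word_succ N w)) \<subseteq> {..<N}" if "set w \<subseteq> {..<N}" for w
    using word_succ_set[OF assms that] ne[of w] by (cases "word_succ N w") auto
  have R: "?R \<subseteq> hom ?W ?P"
    using car by (fastforce simp: carrier_TWord carrier_TFin)
  show ?thesis
  proof (rule rep_fix[where H = H])
    show "definable (\<Psi>(0 \<mapsto> (?W, ?P))) ?W ?P (\<lambda>\<rho>. H (\<rho> 0))" for \<Psi>
      unfolding H_def
      by (rule rep_definable[OF J] rep_definable[OF S] rep_definable[OF rep_id]
          definable_fix_var definable_comp definable_sum | simp)+
    show "H ?R \<subseteq> ?R"
    proof
      fix p assume "p \<in> H ?R"
      then consider "p = (DNil, DPair (dfin 0) DNil)"
        | x w where "p = (DCons (dfin x) (dword w), DPair (dfin (Suc x)) (dword w))" "x < N - 1" "set w \<subseteq> {..<N}"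
        | w where "p = (DCons (dfin (N - 1)) (dword w), DPair (dfin 0) (dword (word_succ N w)))" "set w \<subseteq> {..<N}"
        unfolding H using ne by (auto simp flip: dword_simps)
      then show "p \<in> ?R"
      proof cases
        case 1
        then show ?thesis by (auto intro: exI[of _ "[]"])
      next
        case 2
        then show ?thesis by (auto intro!: exI[of _ "x # w"])
      next
        case 3
        then show ?thesis using assms by (auto intro!: exI[of _ "(N - 1) # w"])
      qed
    qed
    fix S assume S: "H S \<subseteq> S"
    have "(dword w, ?s w) \<in> S" if "set w \<subseteq> {..<N}" for w
      using that
    proof (induction w)
      case Nil
      then show ?case using S by (auto simp: H)
    next
      case (Cons x w)
      show ?case
      proof (cases "Suc x < N")
        case True
        then have "(dword (x # w), ?s (x # w)) \<in> H S" using Cons.prems by (auto simp: H)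
        then show ?thesis using S by blast
      next
        case False
        then have "x = N - 1" using Cons.prems by auto
        moreover have "dword (word_succ N w) = DCons (dfin (hd (word_succ N w))) (dword (tl (word_succ N w)))"
          using ne[of w] by (cases "word_succ N w") auto
        ultimately have "(dword (x # w), ?s (x # w)) \<in> H S"
          using Cons False car[of w] by (auto simp: H)
        then show ?thesis using S by blast
      qed
    qed
    then show "?R \<subseteq> S" by auto
  qed (rule R)
qed

text \<open>The \<open>n\<close>-th iterate of the successor on the empty word has value
  \<open>n\<close>. As words are determined by their values, the iterates meet every word exactly
  once.\<close>

lemma enumerable_word:
  assumes "0 < N"
  shows "enumerable (TWord N)"
proof -
  let ?W = "TWord N" and ?F = "TFin N"
  let ?w = "\<lambda>n. (word_succ N ^^ n) []"
  have set: "set (?w n) \<subseteq> {..<N}" for n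
    by (induction n) (use word_succ_set[OF assms] in auto)
  have val: "word_value N (?w n) = n" for n
    by (induction n) (use word_value_succ[OF assms set] in auto)
  have range: "range ?w = {w. set w \<subseteq> {..<N}}"
  proof (intro equalityI subsetI)
    fix w assume "w \<in> {w. set w \<subseteq> {..<N}}"
    then have "w = ?w (word_value N w)" using set val by (intro word_value_inject) auto
    then show "w \<in> range ?w" by blast
  qed (use set in auto)
  have "inj ?w" by (rule injI) (metis val)
  then have inj: "inj (\<lambda>n. dword (?w n))" by (simp add: inj_def)
  let ?C = "{(DInl DUnit, DNil)} \<union> {(DInr (DPair (dfin x) (dword w)), DCons (dfin x) (dword w)) | x w. x < N \<and> set w \<subseteq> {..<N}}"
  have C: "rep (TSum TOne (TProd ?F ?W)) ?W ?C"
    by (rule rep_clauses[where cs = "[([], VInl VUnit, VNil),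
      ([?F, ?W], VInr (VPair (VVar 0) (VVar 1)), VCons (VVar 0) (VVar 1))]"])
      (auto simp: clause_simps carrier_TWord carrier_TFin)
  have cons: "word_succ N w = hd (word_succ N w) # tl (word_succ N w)" for w by (cases w) auto
  have hdtl: "hd (word_succ N w) < N \<and> set (tl (word_succ N w)) \<subseteq> {..<N}" if "set w \<subseteq> {..<N}" for w
    using word_succ_set[OF assms that] by (subst (asm) cons) auto
  have "rep (TSum TOne ?W) ?W (sum_rel (Id_on (carrier_of TOne))
    {(dword w, DPair (dfin (hd (word_succ N w))) (dword (tl (word_succ N w)))) | w. set w \<subseteq> {..<N}} O ?C)"
    by (rule rep_comp rep_sum rep_id rep_word_succ C assms closed_ty_simps)+
  also have "\<dots> = insert (DInl DUnit, DNil) {(DInr (dword w), dword (word_succ N w)) | w. set w \<subseteq> {..<N}}"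
    using hdtl by (subst cons) (auto simp: rel_simps)
  also have "\<dots> = insert (DInl DUnit, dword (?w 0)) {(DInr (dword (?w n)), dword (?w (Suc n))) | n. True}"
  proof -
    have "{(DInr (dword w), dword (word_succ N w)) | w. w \<in> range ?w} =
      {(DInr (dword (?w n)), dword (?w (Suc n))) | n. True}" by auto
    then show ?thesis by (simp add: range)
  qed
  finally have "rep TNat ?W {(dnat n, dword (?w n)) | n. True}"
    by (rule rep_enum) (use set inj in \<open>auto simp: carrier_TWord\<close>)
  moreover have "bij_betw (\<lambda>n. dword (?w n)) UNIV (carrier_of ?W)"
  proof -
    note inj
    moreover have "range (\<lambda>n. dword (?w n)) = dword ` range ?w" by auto
    ultimately show ?thesis by (simp add: bij_betw_def carrier_TWord range)
  qed
  ultimately show ?thesis by (auto simp: enumerable_def dup_word)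
qed

section \<open>The passage from a value to its word\<close>

lemma iso_typed_weaken: "iso_typed \<Psi> \<omega> T \<Longrightarrow> \<Psi> \<subseteq>\<^sub>m \<Psi>' \<Longrightarrow> iso_typed \<Psi>' \<omega> T"
  and expr_typed_weaken: "expr_typed \<Psi> \<Delta> e A \<Longrightarrow> \<Psi> \<subseteq>\<^sub>m \<Psi>' \<Longrightarrow> expr_typed \<Psi>' \<Delta> e A"
proof (induction arbitrary: \<Psi>' and \<Psi>' rule: iso_typed_expr_typed.inducts)
  case (Clauses A B cs \<Psi>)
  then show ?case by (intro iso_typed_expr_typed.Clauses) fastforce+
next
  case (Fix T \<Psi> \<phi> \<omega>)
  then show ?case by (intro iso_typed_expr_typed.Fix) (auto intro: map_le_upd simp del: fun_upd_apply)
next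
  case (Lam T1 \<Psi> \<phi> \<omega> T2)
  then show ?case by (intro iso_typed_expr_typed.Lam) (auto intro: map_le_upd simp del: fun_upd_apply)
next
  case (IVar \<Psi> \<phi> T)
  then show ?case by (intro iso_typed_expr_typed.IVar) (auto simp: map_le_def dom_def)
next
  case (IApp \<Psi> \<omega>1 T1 T2 \<omega>2)
  then show ?case by (blast intro: iso_typed_expr_typed.IApp)
next
  case (EVal \<Delta> v A \<Psi>)
  then show ?case by (blast intro: iso_typed_expr_typed.EVal)
next
  case (ELet \<Delta>1 p2 A \<Psi> \<omega> B \<Gamma> p1 \<Delta>2 e C)
  then show ?case by (blast intro: iso_typed_expr_typed.ELet)
qed

lemma rep_definable_empty:
  assumes "definable Map.empty A B (\<lambda>_. R)"
  shows "rep A B R"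
proof -
  have "denotes \<Psi> A B (\<lambda>_. R)" if "denotes Map.empty A B (\<lambda>_. R)" for \<Psi> A B R
  proof -
    have "ictx_of Map.empty \<subseteq>\<^sub>m ictx_of \<Psi>" by (simp add: ictx_of_def map_le_def)
    then show ?thesis
      using that iso_typed_weaken unfolding denotes_def env_ok_def by simp blast
  qed
  moreover have "fenv_conv Map.empty = Map.empty" by (auto simp: fenv_conv_def)
  ultimately show ?thesis using assms by (simp add: rep_def definable_def)
qed

text \<open>Monotonicity is inherited from the denotation of isos. It is needed to compare a fixed
  point with its approximations.\<close>

lemma definable_mono:
  assumes "definable \<Psi> A B F" "env_ok \<Psi> \<rho>" "env_ok \<Psi> \<rho>'" "\<And>\<phi>. \<rho> \<phi> \<subseteq> \<rho>' \<phi>"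
  shows "F \<rho> \<subseteq> F \<rho>'"
proof -
  from assms(1) obtain \<omega> where \<omega>: "\<And>\<rho>. env_ok \<Psi> \<rho> \<Longrightarrow> iso_den \<omega> (\<lambda>\<phi>. arc (\<rho> \<phi>)) = arc (F \<rho>)"
    unfolding definable_def denotes_def by blast
  have "iso_den \<omega> (\<lambda>\<phi>. arc (\<rho> \<phi>)) \<subseteq> iso_den \<omega> (\<lambda>\<phi>. arc (\<rho>' \<phi>))"
    by (rule iso_den_mono) (simp add: assms(4))
  then show ?thesis by (simp add: \<omega> assms)
qed

lemma ty_den_subset_carrier:
  assumes "ty_scoped A (length Cs)" "\<forall>C \<in> set Cs. closed_ty C" "\<And>n. n < length Cs \<Longrightarrow> S n \<subseteq> carrier_of (Cs ! n)"
  shows "ty_den A S \<subseteq> carrier_of (psubst A 0 Cs)"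
proof -
  have "ty_den A S = ty_den A (\<lambda>n. if n < length Cs then S n else {})"
    by (rule ty_den_cong[OF assms(1)]) simp
  also have "\<dots> \<subseteq> ty_den A (\<lambda>n. carrier_of (Cs ! n))"
    by (rule ty_den_mono) (simp add: assms(3))
  finally show ?thesis by (simp add: carrier_psubst assms)
qed

text \<open>The letters of Polish notation are 1 to 5; this is the origin of the bound 6 on
  alphabets.\<close>

lemma set_word: "set (word a) \<subseteq> {..<6}"
  by (induction a) auto

text \<open>The tail \<open>l\<close> turns the concatenation of words, which is not a pattern, into an accumulator.\<close>

definition word_rel :: "nat \<Rightarrow> dat set \<Rightarrow> rel" where
  "word_rel N S = {(DPair a (dword l), dword (word a @ l)) | a l. a \<in> S \<and> set l \<subseteq> {..<N}}"

text \<open>Iso variables number the enclosing \<open>\<mu>\<close> from the outside, de Bruijn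
  indices from the inside, whence the reversal. Passing under a further \<open>\<mu>\<close> then
  adds the variable \<open>length Cs\<close> and leaves the others unchanged.\<close>

definition word_env :: "nat \<Rightarrow> ty list \<Rightarrow> fenv" where
  "word_env N Cs = (\<lambda>\<phi>. if \<phi> < length Cs then Some (TProd (Cs ! (length Cs - Suc \<phi>)) (TWord N), TWord N) else None)"

text \<open>\<open>S n\<close> is a subset of the carrier, not the carrier itself, because the
  argument follows the approximations of the least fixed points from below.\<close>

definition word_env_ok :: "nat \<Rightarrow> ty list \<Rightarrow> (nat \<Rightarrow> dat set) \<Rightarrow> (nat \<Rightarrow> rel) \<Rightarrow> bool" where
  "word_env_ok N Cs S \<rho> \<longleftrightarrow>
     (\<forall>n < length Cs. S n \<subseteq> carrier_of (Cs ! n) \<and> \<rho> (length Cs - Suc n) = word_rel N (S n))"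

lemma word_rel_hom: "6 \<le> N \<Longrightarrow> S \<subseteq> carrier_of A \<Longrightarrow> word_rel N S \<subseteq> hom (TProd A (TWord N)) (TWord N)"
  using set_word by (fastforce simp: word_rel_def)

lemma word_env_ok_env_ok:
  assumes "6 \<le> N" "word_env_ok N Cs S \<rho>"
  shows "env_ok (word_env N Cs) \<rho>"
  unfolding env_ok_def
proof (intro allI impI)
  fix \<phi> A B assume *: "word_env N Cs \<phi> = Some (A, B)"
  then have "\<phi> < length Cs" by (simp add: word_env_def split: if_splits)
  then have "S (length Cs - Suc \<phi>) \<subseteq> carrier_of (Cs ! (length Cs - Suc \<phi>))"
    "\<rho> \<phi> = word_rel N (S (length Cs - Suc \<phi>))"
    using assms(2)[unfolded word_env_ok_def, rule_format, of "length Cs - Suc \<phi>"] by auto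
  then show "\<rho> \<phi> \<subseteq> hom A B"
    using * word_rel_hom[OF assms(1)] by (auto simp: word_env_def split: if_splits)
qed

lemma rep_push:
  assumes "k < N"
  shows "rep (TWord N) (TWord N) {(dword l, dword (k # l)) | l. set l \<subseteq> {..<N}}"
  by (rule rep_clauses[where cs = "[([TWord N], VVar 0, VCons (vfin k) (VVar 0))]"])
    (use assms in \<open>auto simp: clause_simps carrier_TWord\<close>)

text \<open>Structural recursion on the open type: a type variable becomes a call of the iso
  variable of its binder, and \<open>\<mu>\<close> becomes a fixed point. \<open>F\<close> precedes
  the quantifiers over \<open>S\<close> and \<open>\<rho>\<close>, because one relation transformer
  has to serve all approximations of the enclosing \<open>\<mu>\<close>-types.\<close>

lemma definable_word_rel:
  assumes N: "6 \<le> N"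
  shows "ty_scoped A (length Cs) \<Longrightarrow> \<forall>C \<in> set Cs. closed_ty C \<Longrightarrow>
    \<exists>F. definable (word_env N Cs) (TProd (psubst A 0 Cs) (TWord N)) (TWord N) F \<and>
      (\<forall>S \<rho>. word_env_ok N Cs S \<rho> \<longrightarrow> F \<rho> = word_rel N (ty_den A S))"
proof (induction A arbitrary: Cs)
  case (TVar n)
  then have n: "n < length Cs" by simp
  show ?case
  proof (intro exI conjI allI impI)
    show "definable (word_env N Cs) (TProd (psubst (TVar n) 0 Cs) (TWord N)) (TWord N) (\<lambda>\<rho>. \<rho> (length Cs - Suc n))"
      by (rule definable_var) (use n TVar in \<open>auto simp: word_env_def\<close>)
  qed (use n in \<open>simp add: word_env_ok_def\<close>)
next
  case TOne
  let ?W = "TWord N"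
  have "rep (TProd TOne ?W) ?W {(DPair DUnit (dword l), dword (1 # l)) | l. set l \<subseteq> {..<N}}"
    by (rule rep_clauses[where cs = "[([?W], VPair VUnit (VVar 0), VCons (vfin 1) (VVar 0))]"])
      (use N in \<open>auto simp: clause_simps carrier_TWord simp del: vfin.simps\<close>)
  then have "definable (word_env N Cs) (TProd (psubst TOne 0 Cs) ?W) ?W (\<lambda>\<rho>. word_rel N (ty_den TOne (\<lambda>_. {})))"
    by (intro rep_definable) (auto simp: word_rel_def elim!: back_subst[where P = "rep _ _"])
  then show ?case by (intro exI) auto
next
  case (TSum A B)
  let ?W = "TWord N" and ?A = "psubst A 0 Cs" and ?B = "psubst B 0 Cs"
  obtain F where F: "definable (word_env N Cs) (TProd ?A ?W) ?W F"
    "\<And>S \<rho>. word_env_ok N Cs S \<rho> \<Longrightarrow> F \<rho> = word_rel N (ty_den A S)"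
    using TSum.IH(1)[of Cs] TSum.prems by auto
  obtain G where G: "definable (word_env N Cs) (TProd ?B ?W) ?W G"
    "\<And>S \<rho>. word_env_ok N Cs S \<rho> \<Longrightarrow> G \<rho> = word_rel N (ty_den B S)"
    using TSum.IH(2)[of Cs] TSum.prems by auto
  have cl: "closed_ty ?A" "closed_ty ?B" using TSum.prems by (simp_all add: closed_psubst)
  let ?D = "{(DPair (DInl a) (dword l), DInl (DPair a (dword l))) | a l. a \<in> carrier_of ?A \<and> set l \<subseteq> {..<N}} \<union>
    {(DPair (DInr b) (dword l), DInr (DPair b (dword l))) | b l. b \<in> carrier_of ?B \<and> set l \<subseteq> {..<N}}"
  have D: "rep (TProd (TSum ?A ?B) ?W) (TSum (TProd ?A ?W) (TProd ?B ?W)) ?D"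
    by (rule rep_clauses[where cs = "[([?A, ?W], VPair (VInl (VVar 0)) (VVar 1), VInl (VPair (VVar 0) (VVar 1))),
      ([?B, ?W], VPair (VInr (VVar 0)) (VVar 1), VInr (VPair (VVar 0) (VVar 1)))]"])
      (use cl in \<open>auto simp: clause_simps carrier_TWord\<close>)
  let ?J = "{(DInl (dword l), dword (2 # l)) | l. set l \<subseteq> {..<N}} \<union> {(DInr (dword l), dword (3 # l)) | l. set l \<subseteq> {..<N}}"
  have J: "rep (TSum ?W ?W) ?W ?J"
    by (rule rep_clauses[where cs = "[([?W], VInl (VVar 0), VCons (vfin 2) (VVar 0)), ([?W], VInr (VVar 0), VCons (vfin 3) (VVar 0))]"])
      (use N in \<open>auto simp: clause_simps carrier_TWord val_orth_vfin\<close>)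
  have "definable (word_env N Cs) (TProd (psubst (TSum A B) 0 Cs) ?W) ?W (\<lambda>\<rho>. ?D O sum_rel (F \<rho>) (G \<rho>) O ?J)"
    unfolding psubst.simps
    by (rule definable_comp rep_definable[OF D] rep_definable[OF J] definable_sum F(1) G(1))+
  moreover have "?D O sum_rel (F \<rho>) (G \<rho>) O ?J = word_rel N (ty_den (TSum A B) S)" if "word_env_ok N Cs S \<rho>" for S \<rho>
  proof -
    have A: "ty_den A S \<subseteq> carrier_of ?A" and B: "ty_den B S \<subseteq> carrier_of ?B"
      by (rule ty_den_subset_carrier; use that TSum.prems in \<open>auto simp: word_env_ok_def\<close>)+
    show ?thesis
      unfolding F(2)[OF that] G(2)[OF that]
      using A B N set_word by (fastforce simp: rel_simps word_rel_def)
  qed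
  ultimately show ?case by blast
next
  case (TProd A B)
  let ?W = "TWord N" and ?A = "psubst A 0 Cs" and ?B = "psubst B 0 Cs"
  obtain F where F: "definable (word_env N Cs) (TProd ?A ?W) ?W F"
    "\<And>S \<rho>. word_env_ok N Cs S \<rho> \<Longrightarrow> F \<rho> = word_rel N (ty_den A S)"
    using TProd.IH(1)[of Cs] TProd.prems by auto
  obtain G where G: "definable (word_env N Cs) (TProd ?B ?W) ?W G"
    "\<And>S \<rho>. word_env_ok N Cs S \<rho> \<Longrightarrow> G \<rho> = word_rel N (ty_den B S)"
    using TProd.IH(2)[of Cs] TProd.prems by auto
  have cl: "closed_ty ?A" "closed_ty ?B" "closed_ty ?W" using TProd.prems by (simp_all add: closed_psubst)
  let ?D = "{(DPair a (DPair b c), DPair (DPair a b) c) | a b c. a \<in> carrier_of ?A \<and> b \<in> carrier_of ?B \<and> c \<in> carrier_of ?W}\<inverse>"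
  let ?J = "{(dword l, dword (4 # l)) | l. set l \<subseteq> {..<N}}"
  have J: "rep ?W ?W ?J" by (rule rep_push) (use N in simp)
  \<comment> \<open>The accumulator grows at its front, so the second component is written before
    the first, and the letter 4 last.\<close>
  have "definable (word_env N Cs) (TProd (psubst (TProd A B) 0 Cs) ?W) ?W
      (\<lambda>\<rho>. ?D O par_rel (Id_on (carrier_of ?A)) (G \<rho>) O F \<rho> O ?J)"
    unfolding psubst.simps
    by (rule F(1) G(1) definable_comp rep_definable[OF rep_converse[OF rep_assoc]] rep_definable[OF J] definable_prod
        rep_definable[OF rep_id] cl)+
  moreover have "?D O par_rel (Id_on (carrier_of ?A)) (G \<rho>) O F \<rho> O ?J = word_rel N (ty_den (TProd A B) S)"
    if "word_env_ok N Cs S \<rho>" for S \<rho>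
  proof -
    have A: "ty_den A S \<subseteq> carrier_of ?A" and B: "ty_den B S \<subseteq> carrier_of ?B"
      by (rule ty_den_subset_carrier; use that TProd.prems in \<open>auto simp: word_env_ok_def\<close>)+
    have set: "set (word a @ l) \<subseteq> {..<N}" if "set l \<subseteq> {..<N}" for a l
      using that N set_word[of a] by auto
    show ?thesis
      unfolding F(2)[OF that] G(2)[OF that]
    proof (intro equalityI subsetI)
      fix p assume "p \<in> word_rel N (ty_den (TProd A B) S)"
      then obtain a b l where *: "p = (DPair (DPair a b) (dword l), dword (4 # word a @ word b @ l))"
        "a \<in> ty_den A S" "b \<in> ty_den B S" "set l \<subseteq> {..<N}"
        by (auto simp: word_rel_def)
      have "(DPair (DPair a b) (dword l), DPair a (DPair b (dword l))) \<in> ?D" using * A B by auto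
      moreover have "(DPair a (DPair b (dword l)), DPair a (dword (word b @ l))) \<in>
          par_rel (Id_on (carrier_of ?A)) (word_rel N (ty_den B S))"
        using * A B by (auto simp: par_rel_def word_rel_def)
      moreover have "(DPair a (dword (word b @ l)), dword (word a @ word b @ l)) \<in> word_rel N (ty_den A S)"
        using * set[of l b] by (auto simp: word_rel_def)
      moreover have "(dword (word a @ word b @ l), dword (4 # word a @ word b @ l)) \<in> ?J"
        using * set[OF set[of l b], of a] by blast
      ultimately show "p \<in> ?D O par_rel (Id_on (carrier_of ?A)) (word_rel N (ty_den B S)) O word_rel N (ty_den A S) O ?J"
        unfolding *(1) by blast
    qed (auto simp: rel_simps word_rel_def)
  qed
  ultimately show ?case by blast
next
  case (TMu A)
  let ?W = "TWord N" and ?T = "psubst (TMu A) 0 Cs"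
  let ?U = "psubst A 0 (?T # Cs)" and ?m = "length Cs"
  have clT: "closed_ty ?T" using TMu.prems by (intro closed_psubst) auto
  then have clU: "closed_ty ?U" using TMu.prems by (intro closed_psubst) auto
  have unfold: "ty_subst (psubst A (Suc 0) Cs) 0 ?T = ?U"
    using TMu.prems by (intro ty_subst_psubst) auto
  have carT: "carrier_of ?T = DFold ` carrier_of ?U"
    using carrier_Mu[of "psubst A (Suc 0) Cs"] clT unfold by simp
  \<comment> \<open>The unfolded type at the head of the list corresponds to the new iso variable
    \<open>?m\<close>, over which the fixed point will be taken.\<close>
  have env: "word_env N (?T # Cs) = (word_env N Cs)(?m \<mapsto> (TProd ?T ?W, ?W))"
    by (auto simp: word_env_def fun_eq_iff nth_Cons' less_Suc_eq)
  obtain F where F: "definable ((word_env N Cs)(?m \<mapsto> (TProd ?T ?W, ?W))) (TProd ?U ?W) ?W F"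
    "\<And>S \<rho>. word_env_ok N (?T # Cs) S \<rho> \<Longrightarrow> F \<rho> = word_rel N (ty_den A S)"
    using TMu.IH[of "?T # Cs"] TMu.prems clT unfolding env
    by (auto simp del: fun_upd_apply)
  let ?D = "{(DPair (DFold a) (dword l), DPair a (dword l)) | a l. a \<in> carrier_of ?U \<and> set l \<subseteq> {..<N}}"
  have D: "rep (TProd ?T ?W) (TProd ?U ?W) ?D"
    by (rule rep_clauses[where cs = "[([?U, ?W], VPair (VFold (VVar 0)) (VVar 1), VPair (VVar 0) (VVar 1))]"])
      (use clT clU unfold in \<open>auto simp: clause_simps carrier_TWord\<close>)
  let ?J = "{(dword l, dword (5 # l)) | l. set l \<subseteq> {..<N}}"
  have J: "rep ?W ?W ?J" by (rule rep_push) (use N in simp)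
  define G where "G \<rho> = ?D O F \<rho> O ?J" for \<rho>
  have G: "definable ((word_env N Cs)(?m \<mapsto> (TProd ?T ?W, ?W))) (TProd ?T ?W) ?W G"
    unfolding G_def by (rule F(1) definable_comp rep_definable[OF D] rep_definable[OF J])+
  let ?F = "\<lambda>\<rho>. rel_fix (TProd ?T ?W) ?W (\<lambda>r. G (\<rho>(?m := r)))"
  have "definable (word_env N Cs) (TProd ?T ?W) ?W ?F"
    by (rule definable_fix[OF G])
  moreover have "?F \<rho> = word_rel N (ty_den (TMu A) S)" if ok: "word_env_ok N Cs S \<rho>" for S \<rho>
  proof (rule rel_fix_eqI)
    let ?\<Theta> = "\<lambda>X. DFold ` ty_den A (case_nat X S)"
    have ok': "word_env_ok N (?T # Cs) (case_nat X S) (\<rho>(?m := word_rel N X))" if "X \<subseteq> carrier_of ?T" for X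
      using ok that by (auto simp: word_env_ok_def nth_Cons split: nat.split)
    have sub: "ty_den A (case_nat X S) \<subseteq> carrier_of ?U" if "X \<subseteq> carrier_of ?T" for X
      by (rule ty_den_subset_carrier)
        (use ok'[OF that] TMu.prems clT in \<open>auto simp: word_env_ok_def simp del: psubst.simps\<close>)
    have set: "set (word a @ l) \<subseteq> {..<N}" if "set l \<subseteq> {..<N}" for a l
      using that N set_word[of a] by auto
    \<comment> \<open>One unfolding of the recursion turns the approximation \<open>X\<close> of the
      \<open>\<mu>\<close>-type into the next one, \<open>?\<Theta> X\<close>.\<close>
    have step: "G (\<rho>(?m := word_rel N X)) = word_rel N (?\<Theta> X)" if X: "X \<subseteq> carrier_of ?T" for X
      unfolding G_def F(2)[OF ok'[OF X]]
    proof (intro equalityI subsetI)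
      fix p assume "p \<in> word_rel N (?\<Theta> X)"
      then obtain a l where *: "p = (DPair (DFold a) (dword l), dword (5 # word a @ l))"
        "a \<in> ty_den A (case_nat X S)" "set l \<subseteq> {..<N}"
        by (auto simp: word_rel_def)
      have "(DPair (DFold a) (dword l), DPair a (dword l)) \<in> ?D" using * sub[OF X] by blast
      moreover have "(DPair a (dword l), dword (word a @ l)) \<in> word_rel N (ty_den A (case_nat X S))"
        using * by (auto simp: word_rel_def)
      moreover have "(dword (word a @ l), dword (5 # word a @ l)) \<in> ?J"
        using * set[of l a] by blast
      ultimately show "p \<in> ?D O word_rel N (ty_den A (case_nat X S)) O ?J"
        unfolding *(1) by blast
    qed (auto simp: rel_simps word_rel_def)
    have mono: "mono ?\<Theta>"
      by (intro monoI image_mono ty_den_mono) (auto split: nat.split)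
    have lfp: "lfp ?\<Theta> \<subseteq> carrier_of ?T"
      by (rule lfp_lowerbound) (use sub[OF order.refl] carT in auto)
    show "word_rel N (ty_den (TMu A) S) \<subseteq> hom (TProd ?T ?W) ?W"
      using word_rel_hom[OF N lfp] by simp
    show "G (\<rho>(?m := word_rel N (ty_den (TMu A) S))) \<subseteq> word_rel N (ty_den (TMu A) S)"
      using step[OF lfp] lfp_unfold[OF mono] by simp
    fix R assume R: "R \<subseteq> hom (TProd ?T ?W) ?W" "G (\<rho>(?m := R)) \<subseteq> R"
    \<comment> \<open>The effect of \<open>G\<close> is known only on relations of the form
      \<open>word_rel N X\<close>, and \<open>R\<close> need not be one. So the bound is carried up
      through the approximations of \<open>lfp ?\<Theta>\<close>, using monotonicity of
      \<open>G\<close> at each stage and unions at limits.\<close>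
    have "lfp ?\<Theta> \<subseteq> carrier_of ?T \<and> word_rel N (lfp ?\<Theta>) \<subseteq> R"
    proof (rule lfp_ordinal_induct[OF mono])
      fix X assume X: "X \<subseteq> carrier_of ?T \<and> word_rel N X \<subseteq> R"
      have "word_rel N (?\<Theta> X) = G (\<rho>(?m := word_rel N X))" using step X by simp
      also have "\<dots> \<subseteq> G (\<rho>(?m := R))"
      proof (rule definable_mono[OF G])
        show "env_ok ((word_env N Cs)(?m \<mapsto> (TProd ?T ?W, ?W))) (\<rho>(?m := word_rel N X))"
          using word_env_ok_env_ok[OF N ok'] X unfolding env by blast
        show "env_ok ((word_env N Cs)(?m \<mapsto> (TProd ?T ?W, ?W))) (\<rho>(?m := R))"
          by (rule env_ok_upd[OF word_env_ok_env_ok[OF N ok] R(1)])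
      qed (use X in simp)
      finally show "?\<Theta> X \<subseteq> carrier_of ?T \<and> word_rel N (?\<Theta> X) \<subseteq> R"
        using R(2) sub X carT by blast
    next
      fix M assume "\<forall>X\<in>M. X \<subseteq> carrier_of ?T \<and> word_rel N X \<subseteq> R"
      then show "\<Union>M \<subseteq> carrier_of ?T \<and> word_rel N (\<Union>M) \<subseteq> R"
        by (fastforce simp: word_rel_def)
    qed
    then show "word_rel N (ty_den (TMu A) S) \<subseteq> R" by simp
  qed
  ultimately show ?case by blast
qed

lemma rep_word:
  assumes "6 \<le> N" "closed_ty A"
  shows "rep A (TWord N) {(a, dword (word a)) | a. a \<in> carrier_of A}"
proof -
  let ?W = "TWord N"
  obtain F where F: "definable (word_env N []) (TProd A ?W) ?W F"
    "\<And>S \<rho>. word_env_ok N [] S \<rho> \<Longrightarrow> F \<rho> = word_rel N (ty_den A S)"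
    using definable_word_rel[OF assms(1), of A "[]"] assms(2) by (auto simp: psubst_closed closed_ty_def)
  have "word_env N [] = Map.empty" by (simp add: word_env_def)
  moreover have "F = (\<lambda>_. word_rel N (carrier_of A))"
    using F(2)[of "\<lambda>_. {}"] by (auto simp: word_env_ok_def carrier_of_def)
  ultimately have W: "rep (TProd A ?W) ?W (word_rel N (carrier_of A))"
    using F(1) by (intro rep_definable_empty) simp
  have "rep A (TProd A ?W) {(a, DPair a (dword [])) | a. a \<in> carrier_of A}"
    by (rule rep_clauses[where cs = "[([A], VVar 0, VPair (VVar 0) VNil)]"])
      (use assms in \<open>auto simp: clause_simps\<close>)
  from rep_comp[OF this W] show ?thesis
    by (rule back_subst[where P = "rep _ _"]) (fastforce simp: word_rel_def relcomp_unfold simp flip: dword_simps(1))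
qed

section \<open>Machines with two stacks\<close>

text \<open>A transition inspects the state and the tops of both stacks, which are popped and replaced
  by words.\<close>

type_synonym machine = "nat \<Rightarrow> nat option \<Rightarrow> nat option \<Rightarrow> nat \<times> nat list \<times> nat list"
type_synonym mconfig = "nat \<times> nat list \<times> nat list"

primrec hd_opt :: "nat list \<Rightarrow> nat option" where
  "hd_opt [] = None"
| "hd_opt (x # l) = Some x"

primrec olist :: "nat option \<Rightarrow> nat list" where
  "olist None = []"
| "olist (Some x) = [x]"

lemma olist_hd_opt [simp]: "olist (hd_opt l) @ tl l = l"
  by (cases l) auto

fun mstep :: "machine \<Rightarrow> mconfig \<Rightarrow> mconfig" where
  "mstep M (q, l, r) = (case M q (hd_opt l) (hd_opt r) of (q', u, v) \<Rightarrow> (q', u @ tl l, v @ tl r))"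

definition machine_ok :: "nat \<Rightarrow> machine \<Rightarrow> bool" where
  "machine_ok N M \<longleftrightarrow> (\<forall>q s t. q < N \<longrightarrow> set (olist s) \<subseteq> {..<N} \<longrightarrow> set (olist t) \<subseteq> {..<N} \<longrightarrow>
     (case M q s t of (q', u, v) \<Rightarrow> q' < N \<and> set u \<subseteq> {..<N} \<and> set v \<subseteq> {..<N}))"

fun config_ok :: "nat \<Rightarrow> mconfig \<Rightarrow> bool" where
  "config_ok N (q, l, r) \<longleftrightarrow> q < N \<and> set l \<subseteq> {..<N} \<and> set r \<subseteq> {..<N}"

lemma set_olist_hd_opt: "set l \<subseteq> {..<N} \<Longrightarrow> set (olist (hd_opt l)) \<subseteq> {..<N} \<and> set (tl l) \<subseteq> {..<N}"
  by (cases l) auto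

lemma config_ok_mstep: "machine_ok N M \<Longrightarrow> config_ok N c \<Longrightarrow> config_ok N (mstep M c)"
proof (cases c)
  fix q l r assume M: "machine_ok N M" and c: "config_ok N c" "c = (q, l, r)"
  obtain q' u v where *: "M q (hd_opt l) (hd_opt r) = (q', u, v)" by (cases "M q (hd_opt l) (hd_opt r)")
  have "q < N" "set (olist (hd_opt l)) \<subseteq> {..<N}" "set (olist (hd_opt r)) \<subseteq> {..<N}"
    "set (tl l) \<subseteq> {..<N}" "set (tl r) \<subseteq> {..<N}"
    using c set_olist_hd_opt by auto
  moreover from this have "q' < N" "set u \<subseteq> {..<N}" "set v \<subseteq> {..<N}"
    using M[unfolded machine_ok_def, rule_format, of q "hd_opt l" "hd_opt r"] by (simp_all add: *)
  ultimately show ?thesis by (simp add: c *)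
qed

fun dconfig :: "mconfig \<Rightarrow> dat" where
  "dconfig (q, l, r) = DPair (dfin q) (DPair (dword l) (dword r))"

definition TConfig :: "nat \<Rightarrow> ty" where
  "TConfig N = TProd (TFin N) (TProd (TWord N) (TWord N))"

lemma dconfig_inject [simp]: "dconfig c = dconfig c' \<longleftrightarrow> c = c'"
  by (cases c; cases c') auto

lemma closed_TConfig [simp]: "closed_ty (TConfig N)"
  by (simp add: TConfig_def)

lemma carrier_TConfig: "carrier_of (TConfig N) = dconfig ` {c. config_ok N c}"
proof (intro equalityI subsetI)
  fix x assume "x \<in> carrier_of (TConfig N)"
  then obtain q l r where "x = dconfig (q, l, r)" "config_ok N (q, l, r)"
    by (auto simp: TConfig_def carrier_TFin carrier_TWord)
  then show "x \<in> dconfig ` {c. config_ok N c}" by blast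
qed (auto simp: TConfig_def)

lemma dup_config: "dup (TConfig N)"
  unfolding TConfig_def by (intro dup_prod dup_fin dup_word)

definition vword :: "nat list \<Rightarrow> val \<Rightarrow> val" where
  "vword u v = foldr (\<lambda>x. VCons (vfin x)) u v"

lemma vword_simps [simp]:
  "vword [] v = v" "vword (x # u) v = VCons (vfin x) (vword u v)"
  by (simp_all add: vword_def)

lemma vword_facts [simp]:
  "val_vars (vword u v) = val_vars v"
  "val_wt ts (vword u v) (TWord N) \<longleftrightarrow> set u \<subseteq> {..<N} \<and> val_wt ts v (TWord N)"
  by (induction u) auto

lemma val_den_vword: "val_den v \<sigma> = dword l \<Longrightarrow> val_den (vword u v) \<sigma> = dword (u @ l)"
  by (induction u) auto

text \<open>An empty stack has no rest to bind, and its pattern is \<open>VNil\<close>, which is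
  orthogonal to every pattern with a top symbol.\<close>

definition tail :: "nat option \<Rightarrow> nat \<Rightarrow> val" where
  "tail s i = (case s of None \<Rightarrow> VNil | Some _ \<Rightarrow> VVar i)"

text \<open>One clause for each state and pair of tops, with a variable for the rest of each
  nonempty stack; \<open>i\<close> is the index of the second rest and is 0 if the first stack is
  empty. The state and the tops reappear on the right-hand side, which makes the right-hand sides
  orthogonal even if the machine merges configurations.\<close>

definition step_clause :: "nat \<Rightarrow> machine \<Rightarrow> nat \<times> nat option \<times> nat option \<Rightarrow> clause" where
  "step_clause N M = (\<lambda>(q, s, t). case M q s t of (q', u, v) \<Rightarrow>
     let i = length (olist s); vs = tail s 0; vt = tail t i in
     (replicate (i + length (olist t)) (TWord N),
      VPair (vfin q) (VPair (vword (olist s) vs) (vword (olist t) vt)),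
      VPair (VPair (vfin q') (VPair (vword u vs) (vword v vt)))
        (VPair (vfin q) (VPair (vword (olist s) VNil) (vword (olist t) VNil)))))"

text \<open>The record of the consumed symbols makes a step injective.\<close>

fun consumed :: "mconfig \<Rightarrow> mconfig" where
  "consumed (q, l, r) = (q, olist (hd_opt l), olist (hd_opt r))"

lemma step_clause_ok:
  assumes "machine_ok N M" "q < N" "set (olist s) \<subseteq> {..<N}" "set (olist t) \<subseteq> {..<N}"
  shows "clause_ok (TConfig N) (TProd (TConfig N) (TConfig N)) (step_clause N M (q, s, t))"
proof -
  obtain q' u v where M: "M q s t = (q', u, v)" by (cases "M q s t")
  then have "q' < N" "set u \<subseteq> {..<N}" "set v \<subseteq> {..<N}"
    using assms(1)[unfolded machine_ok_def, rule_format, of q s t] assms(2-4) by simp_all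
  moreover have "step_clause N M (q, s, t) = (replicate (length (olist s) + length (olist t)) (TWord N),
      VPair (vfin q) (VPair (vword (olist s) (tail s 0)) (vword (olist t) (tail t (length (olist s))))),
      VPair (VPair (vfin q') (VPair (vword u (tail s 0)) (vword v (tail t (length (olist s))))))
        (VPair (vfin q) (VPair (vword (olist s) VNil) (vword (olist t) VNil))))"
    by (simp add: step_clause_def Let_def M)
  ultimately show ?thesis
    using assms(2-4) by (cases s; cases t) (auto simp: clause_ok_def tail_def TConfig_def lessThan_Suc
        simp del: vword_simps)
qed

lemma step_clause_rel:
  assumes "config_ok N (q, olist s, olist t)"
  shows "clause_rel (step_clause N M (q, s, t)) =
    {(dconfig c, DPair (dconfig (mstep M c)) (dconfig (consumed c))) | c. config_ok N c \<and> consumed c = (q, olist s, olist t)}"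
    (is "_ = ?R")
proof -
  obtain q' u v where M: "M q s t = (q', u, v)" by (cases "M q s t")
  let ?i = "length (olist s)"
  let ?n = "?i + length (olist t)"
  \<comment> \<open>\<open>ls\<close> lists the values of the variables; \<open>?T1\<close> and
    \<open>?T2\<close> are the rests of the two stacks, empty where no variable is bound.\<close>
  let ?T1 = "\<lambda>ls. case s of None \<Rightarrow> [] | Some _ \<Rightarrow> ls ! 0"
  let ?T2 = "\<lambda>ls. case t of None \<Rightarrow> [] | Some _ \<Rightarrow> ls ! ?i"
  let ?c = "\<lambda>ls. (q, olist s @ ?T1 ls, olist t @ ?T2 ls)"
  have hd: "hd_opt (olist s @ ?T1 ls) = s" "hd_opt (olist t @ ?T2 ls) = t"
    "tl (olist s @ ?T1 ls) = ?T1 ls" "tl (olist t @ ?T2 ls) = ?T2 ls" for ls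
    by (cases s; cases t; simp)+
  have den: "val_den (vword w (tail s 0)) ((!) (map dword ls)) = dword (w @ ?T1 ls)"
    "val_den (vword w (tail t ?i)) ((!) (map dword ls)) = dword (w @ ?T2 ls)"
    if "length ls = ?n" for w ls
    by (rule val_den_vword; use that in \<open>simp add: tail_def split: option.split\<close>)+
  have den': "val_den (vword w VNil) \<sigma> = dword w" for w \<sigma>
    using val_den_vword[of VNil \<sigma> "[]"] by simp
  \<comment> \<open>The well-typed valuations of the clause are exactly the lists of words over the
    alphabet, of the length given by the number of nonempty stacks.\<close>
  have all: "list_all2 (\<lambda>x T. x \<in> carrier_of T) xs (replicate ?n (TWord N)) \<longleftrightarrow>
      (\<exists>ls. xs = map dword ls \<and> length ls = ?n \<and> (\<forall>l \<in> set ls. set l \<subseteq> {..<N}))" for xs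
  proof
    assume *: "list_all2 (\<lambda>x T. x \<in> carrier_of T) xs (replicate ?n (TWord N))"
    then have "set xs \<subseteq> dword ` {w. set w \<subseteq> {..<N}}"
      by (auto simp: list_all2_conv_all_nth in_set_conv_nth carrier_TWord)
    then have "xs \<in> map dword ` lists {w. set w \<subseteq> {..<N}}"
      unfolding lists_image[symmetric] by (simp add: lists_eq_set)
    then show "\<exists>ls. xs = map dword ls \<and> length ls = ?n \<and> (\<forall>l \<in> set ls. set l \<subseteq> {..<N})"
      using list_all2_lengthD[OF *] by auto
  qed (auto simp: list_all2_conv_all_nth)
  have "clause_rel (step_clause N M (q, s, t)) = {(
      val_den (VPair (vfin q) (VPair (vword (olist s) (tail s 0)) (vword (olist t) (tail t ?i)))) ((!) (map dword ls)),
      val_den (VPair (VPair (vfin q') (VPair (vword u (tail s 0)) (vword v (tail t ?i))))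
        (VPair (vfin q) (VPair (vword (olist s) VNil) (vword (olist t) VNil)))) ((!) (map dword ls))) | ls.
      length ls = ?n \<and> (\<forall>l \<in> set ls. set l \<subseteq> {..<N})}"
    unfolding clause_rel_def step_clause_def Let_def prod.case M all by blast
  also have "\<dots> = {(dconfig (?c ls), DPair (dconfig (q', u @ ?T1 ls, v @ ?T2 ls))
      (dconfig (q, olist s, olist t))) | ls. length ls = ?n \<and> (\<forall>l \<in> set ls. set l \<subseteq> {..<N})}"
    by (intro Collect_cong ex_cong1) (auto simp: den den')
  also have "\<dots> = {(dconfig c, DPair (dconfig (mstep M c)) (dconfig (consumed c))) | c.
      c \<in> ?c ` {ls. length ls = ?n \<and> (\<forall>l \<in> set ls. set l \<subseteq> {..<N})}}"
    by (auto simp: hd M)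
  also have "?c ` {ls. length ls = ?n \<and> (\<forall>l \<in> set ls. set l \<subseteq> {..<N})} =
      {c. config_ok N c \<and> consumed c = (q, olist s, olist t)}"
  proof (intro equalityI subsetI)
    fix c assume "c \<in> ?c ` {ls. length ls = ?n \<and> (\<forall>l \<in> set ls. set l \<subseteq> {..<N})}"
    then obtain ls where c: "c = ?c ls" "length ls = ?n" "\<forall>l \<in> set ls. set l \<subseteq> {..<N}" by blast
    then have "set (?T1 ls) \<subseteq> {..<N}" "set (?T2 ls) \<subseteq> {..<N}"
      by (auto split: option.splits dest: nth_mem)
    then show "c \<in> {c. config_ok N c \<and> consumed c = (q, olist s, olist t)}"
      using assms by (auto simp: c(1) hd)
  next
    fix c assume c: "c \<in> {c. config_ok N c \<and> consumed c = (q, olist s, olist t)}"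
    obtain q'' l r where lr: "c = (q'', l, r)" by (cases c)
    have "olist a = olist b \<longleftrightarrow> a = b" for a b by (cases a; cases b) auto
    then have eq: "q'' = q" "hd_opt l = s" "hd_opt r = t" "set l \<subseteq> {..<N}" "set r \<subseteq> {..<N}"
      using c by (auto simp: lr)
    \<comment> \<open>The matching valuation consists of the tails of those stacks that are not
      empty.\<close>
    let ?ls = "(if s = None then [] else [tl l]) @ (if t = None then [] else [tl r])"
    have "?T1 ?ls = tl l" "?T2 ?ls = tl r" using eq(2,3) by (cases l; cases r; auto)+
    then have "c = ?c ?ls" using eq(2,3) by (simp add: lr eq(1)) (metis olist_hd_opt)
    moreover have "length ?ls = ?n" by (cases s; cases t) auto
    moreover have "\<forall>l \<in> set ?ls. set l \<subseteq> {..<N}" using eq(4,5) set_olist_hd_opt by auto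
    ultimately show "c \<in> ?c ` {ls. length ls = ?n \<and> (\<forall>l \<in> set ls. set l \<subseteq> {..<N})}" by blast
  qed
  finally show ?thesis by simp
qed

lemma orth_vword_olist: "s \<noteq> s' \<Longrightarrow> val_orth (vword (olist s) (tail s i)) (vword (olist s') (tail s' i'))"
  "s \<noteq> s' \<Longrightarrow> val_orth (vword (olist s) VNil) (vword (olist s') VNil)"
  by (cases s; cases s'; auto simp: tail_def val_orth_vfin)+

definition step_keys :: "nat \<Rightarrow> (nat \<times> nat option \<times> nat option) list" where
  "step_keys N = (let os = None # map Some [0..<N] in List.product [0..<N] (List.product os os))"

lemma distinct_step_keys: "distinct (step_keys N)"
proof -
  have "distinct (None # map Some [0..<N])" by (simp add: distinct_map)
  then show ?thesis unfolding step_keys_def Let_def by (intro distinct_product distinct_upt)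
qed

lemma set_step_keys: "(q, s, t) \<in> set (step_keys N) \<longleftrightarrow> config_ok N (q, olist s, olist t)"
proof -
  have *: "s \<in> set (None # map Some [0..<N]) \<longleftrightarrow> set (olist s) \<subseteq> {..<N}" for s
    by (cases s) auto
  show ?thesis unfolding step_keys_def Let_def set_product mem_Times_iff fst_conv snd_conv * by simp
qed

lemma rep_step:
  assumes "machine_ok N M"
  shows "rep (TConfig N) (TProd (TConfig N) (TConfig N))
    {(dconfig c, DPair (dconfig (mstep M c)) (dconfig (consumed c))) | c. config_ok N c}"
proof (rule rep_clauses[where cs = "map (step_clause N M) (step_keys N)"])
  show "clause_ok (TConfig N) (TProd (TConfig N) (TConfig N)) cl" if "cl \<in> set (map (step_clause N M) (step_keys N))" for cl
    using that step_clause_ok[OF assms] by (auto simp: set_step_keys)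
  show "orth_clauses (map (step_clause N M) (step_keys N))"
  proof -
    have "val_orth (fst (snd (step_clause N M k))) (fst (snd (step_clause N M k'))) \<and>
        val_orth (snd (snd (step_clause N M k))) (snd (snd (step_clause N M k')))" if "k \<noteq> k'" for k k'
      using that
      by (cases k; cases k') (auto simp: step_clause_def Let_def val_orth_vfin orth_vword_olist split: prod.splits)
    then show ?thesis
      unfolding orth_clauses_def map_map comp_def
      by (intro conjI pairwise_orth_map distinct_step_keys) auto
  qed
  have "{(dconfig c, DPair (dconfig (mstep M c)) (dconfig (consumed c))) | c. config_ok N c} =
    (\<Union>k \<in> set (step_keys N). clause_rel (step_clause N M k))" (is "?L = ?R")
  proof (intro equalityI subsetI)
    fix p assume "p \<in> ?L"
    then obtain q l r where p: "p = (dconfig (q, l, r), DPair (dconfig (mstep M (q, l, r))) (dconfig (consumed (q, l, r))))"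
      "config_ok N (q, l, r)" by auto
    then have k: "config_ok N (q, olist (hd_opt l), olist (hd_opt r))" using set_olist_hd_opt by simp
    have "p \<in> clause_rel (step_clause N M (q, hd_opt l, hd_opt r))"
      unfolding step_clause_rel[OF k] using p by (intro CollectI exI[of _ "(q, l, r)"]) simp
    then show "p \<in> ?R" using k set_step_keys by blast
  next
    fix p assume "p \<in> ?R"
    then obtain q s t where k: "config_ok N (q, olist s, olist t)" "p \<in> clause_rel (step_clause N M (q, s, t))"
      using set_step_keys by (metis (no_types, lifting) UN_E prod_cases3)
    then show "p \<in> ?L" unfolding step_clause_rel[OF k(1)] by blast
  qed
  then show "{(dconfig c, DPair (dconfig (mstep M c)) (dconfig (consumed c))) | c. config_ok N c} =
    clauses_rel (map (step_clause N M) (step_keys N))"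
    by (simp add: clauses_rel_def)
qed simp_all

lemma mstep_consumed_inject:
  "mstep M c = mstep M c' \<Longrightarrow> consumed c = consumed c' \<Longrightarrow> c = c'"
proof -
  assume *: "mstep M c = mstep M c'" "consumed c = consumed c'"
  obtain q l r where c: "c = (q, l, r)" by (cases c)
  obtain q' l' r' where c': "c' = (q', l', r')" by (cases c')
  have "olist a = olist b \<longleftrightarrow> a = b" for a b by (cases a; cases b) auto
  then have "q = q'" "hd_opt l = hd_opt l'" "hd_opt r = hd_opt r'" using *(2) by (auto simp: c c')
  moreover from this have "tl l = tl l'" "tl r = tl r'" using *(1) by (auto simp: c c' split: prod.splits)
  ultimately show ?thesis unfolding c c' by (metis olist_hd_opt)
qed

definition drun :: "machine \<Rightarrow> dat \<Rightarrow> dat" where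
  "drun M = diterate (\<lambda>x. dconfig (mstep M (inv dconfig x)))"

lemma inv_dconfig [simp]: "inv dconfig (dconfig c) = c"
  by (rule inv_f_f) (simp add: inj_def)

lemma drun: "drun M (DPair (dconfig c) (dnat n)) = dconfig ((mstep M ^^ n) c)"
  unfolding drun_def diterate by (induction n) auto

text \<open>With the number of steps as an argument the run is total, and the consumed symbols
  recorded at each step make it reversible.\<close>

lemma comp_fun_drun:
  assumes "machine_ok N M"
  shows "comp_fun (TProd (TConfig N) TNat) (TConfig N) (drun M)"
  unfolding drun_def
proof (rule comp_fun_iterate[OF _ dup_config])
  let ?F = "\<lambda>x. dconfig (mstep M (inv dconfig x))" and ?g = "\<lambda>x. dconfig (consumed (inv dconfig x))"
  show "rep (TConfig N) (TProd (TConfig N) (TConfig N)) {(x, DPair (?F x) (?g x)) | x. x \<in> carrier_of (TConfig N)}"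
    by (rule back_subst[where P = "rep _ _", OF rep_step[OF assms]], unfold carrier_TConfig)
      (auto simp del: dconfig.simps mstep.simps consumed.simps config_ok.simps split_paired_Ex)
  show "x = y" if xy: "x \<in> carrier_of (TConfig N)" "y \<in> carrier_of (TConfig N)" "?F x = ?F y" "?g x = ?g y" for x y
  proof -
    obtain c d where "x = dconfig c" "y = dconfig d" using xy(1,2) unfolding carrier_TConfig by blast
    then show ?thesis using xy(3,4) mstep_consumed_inject[of M c d] by (simp del: dconfig.simps)
  qed
qed

lemma comp_fun_const:
  assumes "closed_ty A" "closed_ty B" "val_wt [A] v B" "val_vars v = []"
  shows "comp_fun A B (\<lambda>_. val_den v \<sigma>)"
  unfolding comp_fun_def
proof (rule rep_clauses[where cs = "[([A], VVar 0, VPair (VVar 0) v)]"])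
  have "val_den v ((!) [a]) = val_den v \<sigma>" for a by (rule val_den_cong) (simp add: assms)
  then show "{(x, DPair x (val_den v \<sigma>)) | x. x \<in> carrier_of A} = clauses_rel [([A], VVar 0, VPair (VVar 0) v)]"
    by (simp add: clauses_rel_def clause_rel_simps)
qed (use assms in \<open>auto simp: clause_ok_def orth_clauses_def lessThan_Suc\<close>)

lemma comp_fun_dfin: "closed_ty A \<Longrightarrow> k < N \<Longrightarrow> comp_fun A (TFin N) (\<lambda>_. dfin k)"
  using comp_fun_const[of A "TFin N" "vfin k"] by simp

lemma comp_fun_dword: "closed_ty A \<Longrightarrow> set u \<subseteq> {..<N} \<Longrightarrow> comp_fun A (TWord N) (\<lambda>_. dword u)"
  using comp_fun_const[of A "TWord N" "vword u VNil"] val_den_vword[of VNil _ "[]" u] by simp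

lemma decidable_dfin: "decidable (TFin N) (\<lambda>x. x = dfin h)"
  unfolding decidable_def
proof (rule comp_fun_garbage[OF _ dup_bool, where g = "\<lambda>x. x"])
  show "rep (TFin N) (TProd TBool (TFin N)) {(x, DPair (dbool (x = dfin h)) x) | x. x \<in> carrier_of (TFin N)}"
  proof (rule rep_clauses[where cs = "map (\<lambda>k. ([], vfin k, VPair (if k = h then VInl VUnit else VInr VUnit) (vfin k))) [0..<N]"])
    show "orth_clauses (map (\<lambda>k. ([], vfin k, VPair (if k = h then VInl VUnit else VInr VUnit) (vfin k))) [0..<N])"
      unfolding orth_clauses_def map_map comp_def fst_conv snd_conv
      by (intro conjI pairwise_orth_map) (simp_all add: val_orth_vfin)
    have "val_den (if k = h then VInl VUnit else VInr VUnit) \<sigma> = dbool (k = h)" for k \<sigma>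
      by (simp add: dbool_def)
    then show "{(x, DPair (dbool (x = dfin h)) x) | x. x \<in> carrier_of (TFin N)} =
      clauses_rel (map (\<lambda>k. ([], vfin k, VPair (if k = h then VInl VUnit else VInr VUnit) (vfin k))) [0..<N])"
      by (auto simp: clauses_rel_def clause_rel_simps carrier_TFin)
  qed (auto simp: clause_ok_def TBool_def split: if_splits)
qed

lemma comp_fun_run:
  assumes "machine_ok N M" "0 < N" "comp_fun A (TWord N) F" "comp_fun A (TWord N) G" "comp_fun A TNat K"
  shows "comp_fun A (TConfig N) (\<lambda>x. drun M (DPair (DPair (dfin 0) (DPair (F x) (G x))) (K x)))"
proof (rule comp_fun_comp[OF comp_fun_pair[OF _ assms(5)] comp_fun_drun[OF assms(1)]])
  show "comp_fun A (TConfig N) (\<lambda>x. DPair (dfin 0) (DPair (F x) (G x)))"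
    unfolding TConfig_def using comp_fun_closed[OF assms(3)]
    by (intro comp_fun_pair comp_fun_dfin assms) auto
qed

lemma decidable_state:
  assumes "comp_fun A (TConfig N) F"
  shows "decidable A (\<lambda>x. dfst (F x) = dfin h)"
  by (rule decidable_comp[OF comp_fun_comp[OF assms] decidable_dfin[of N]])
    (simp add: TConfig_def comp_fun_fst dup_fin)

section \<open>Acceptance and uniqueness of running times\<close>

definition accepts_in :: "machine \<Rightarrow> nat \<Rightarrow> nat \<Rightarrow> mconfig \<Rightarrow> bool" where
  "accepts_in M h n c \<longleftrightarrow> fst ((mstep M ^^ n) c) = h"

definition accepts :: "machine \<Rightarrow> nat \<Rightarrow> mconfig \<Rightarrow> bool" where
  "accepts M h c \<longleftrightarrow> (\<exists>n. accepts_in M h n c)"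

text \<open>State \<open>h\<close> is left at once for the dead state \<open>Suc h\<close>, hence entered at most once.\<close>

definition transient :: "machine \<Rightarrow> nat \<Rightarrow> bool" where
  "transient M h \<longleftrightarrow> (\<forall>q s t. q = h \<or> q = Suc h \<longrightarrow> M q s t = (Suc h, olist s, olist t))"

lemma fst_mstep_transient: "transient M h \<Longrightarrow> fst c = h \<or> fst c = Suc h \<Longrightarrow> fst (mstep M c) = Suc h"
  by (cases c) (auto simp: transient_def)

lemma transient_dead: "transient M h \<Longrightarrow> fst c = h \<or> fst c = Suc h \<Longrightarrow> fst ((mstep M ^^ Suc n) c) = Suc h"
  by (induction n) (auto simp: fst_mstep_transient)

text \<open>After the first visit to \<open>h\<close> the machine is in the dead state for good.
  This determinacy is what allows running times to serve as certificates.\<close>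

lemma accepts_in_unique:
  assumes "transient M h" "accepts_in M h m c" "accepts_in M h n c"
  shows "m = n"
proof -
  have "\<not> m < n" if "accepts_in M h m c" "accepts_in M h n c" for m n
  proof
    assume "m < n"
    then obtain k where "n = Suc (m + k)" by (auto dest: less_imp_Suc_add)
    then have "n = Suc k + m" by simp
    then have "(mstep M ^^ n) c = (mstep M ^^ Suc k) ((mstep M ^^ m) c)"
      by (simp only: funpow_add comp_apply)
    then have "fst ((mstep M ^^ n) c) = Suc h"
      using transient_dead[OF assms(1), of "(mstep M ^^ m) c" k] that(1)
      by (simp add: accepts_in_def del: funpow.simps)
    then show False using that(2) by (simp add: accepts_in_def)
  qed
  then show ?thesis using assms(2,3) by (meson linorder_neqE_nat)
qed

lemma accepts_simps:
  assumes "transient M h"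
  shows "fst c = h \<Longrightarrow> accepts M h c" "fst c = Suc h \<Longrightarrow> \<not> accepts M h c"
    "fst c \<noteq> h \<Longrightarrow> mstep M c = c' \<Longrightarrow> accepts M h c \<longleftrightarrow> accepts M h c'"
proof -
  show "accepts M h c" if "fst c = h"
    unfolding accepts_def accepts_in_def by (rule exI[of _ 0]) (simp add: that)
  have "fst ((mstep M ^^ n) c) = Suc h" if "fst c = Suc h" for n
    using that transient_dead[OF assms, of c "n - 1"] by (cases n) auto
  then show "\<not> accepts M h c" if "fst c = Suc h"
    using that by (simp add: accepts_def accepts_in_def)
  have "accepts M h c \<longleftrightarrow> accepts M h (mstep M c)" if "fst c \<noteq> h"
  proof
    assume "accepts M h c"
    then obtain n where "fst ((mstep M ^^ n) c) = h" by (auto simp: accepts_def accepts_in_def)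
    then show "accepts M h (mstep M c)"
      using that by (cases n) (auto simp: accepts_def accepts_in_def funpow_swap1)
  next
    assume "accepts M h (mstep M c)"
    then obtain n where "fst ((mstep M ^^ n) (mstep M c)) = h" by (auto simp: accepts_def accepts_in_def)
    then have "fst ((mstep M ^^ Suc n) c) = h" by (simp add: funpow_swap1)
    then show "accepts M h c" unfolding accepts_def accepts_in_def by blast
  qed
  then show "fst c \<noteq> h \<Longrightarrow> mstep M c = c' \<Longrightarrow> accepts M h c \<longleftrightarrow> accepts M h c'" by blast
qed

section \<open>Recognizing the words of a type\<close>

text \<open>Finitely many closed types arise from \<open>A\<close> by taking components and unfolding; \<open>Cs\<close> lists
  the unfolded types that replace the free variables of \<open>A\<close>.\<close>

primrec components :: "ty \<Rightarrow> ty list \<Rightarrow> ty set" where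
  "components (TVar n) Cs = {}"
| "components TOne Cs = {TOne}"
| "components (TSum A B) Cs = insert (psubst (TSum A B) 0 Cs) (components A Cs \<union> components B Cs)"
| "components (TProd A B) Cs = insert (psubst (TProd A B) 0 Cs) (components A Cs \<union> components B Cs)"
| "components (TMu A) Cs = insert (psubst (TMu A) 0 Cs) (components A (psubst (TMu A) 0 Cs # Cs))"

primrec parts :: "ty \<Rightarrow> ty set" where
  "parts (TVar n) = {}"
| "parts TOne = {}"
| "parts (TSum A B) = {A, B}"
| "parts (TProd A B) = {A, B}"
| "parts (TMu A) = {ty_subst A 0 (TMu A)}"

lemma finite_components: "finite (components A Cs)"
  by (induction A arbitrary: Cs) auto

lemma components_self: "ty_scoped A (length Cs) \<Longrightarrow> psubst A 0 Cs \<in> components A Cs \<union> set Cs"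
  by (cases A) auto

text \<open>A \<open>\<mu>\<close>-type that has already been unfolded is found in \<open>Cs\<close>
  and not unfolded anew, which keeps the set finite. For empty \<open>Cs\<close> the components are
  closed under taking parts.\<close>

lemma components_parts:
  "ty_scoped A (length Cs) \<Longrightarrow> \<forall>C \<in> set Cs. closed_ty C \<Longrightarrow> T \<in> components A Cs \<Longrightarrow>
   closed_ty T \<and> parts T \<subseteq> components A Cs \<union> set Cs"
proof (induction A arbitrary: Cs)
  case (TSum A B)
  show ?case
  proof (cases "T = psubst (TSum A B) 0 Cs")
    case True
    then show ?thesis using TSum.prems components_self[of A Cs] components_self[of B Cs] by (auto simp: closed_psubst)
  next
    case False
    then show ?thesis using TSum.IH[of Cs] TSum.prems by auto
  qed
next
  case (TProd A B)
  show ?case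
  proof (cases "T = psubst (TProd A B) 0 Cs")
    case True
    then show ?thesis using TProd.prems components_self[of A Cs] components_self[of B Cs] by (auto simp: closed_psubst)
  next
    case False
    then show ?thesis using TProd.IH[of Cs] TProd.prems by auto
  qed
next
  case (TMu A)
  let ?T = "psubst (TMu A) 0 Cs"
  have cl: "closed_ty ?T" using TMu.prems by (intro closed_psubst) auto
  show ?case
  proof (cases "T = ?T")
    case True
    have "ty_subst (psubst A (Suc 0) Cs) 0 ?T = psubst A 0 (?T # Cs)"
      using TMu.prems by (intro ty_subst_psubst) auto
    then have "parts T = {psubst A 0 (?T # Cs)}" by (simp add: True)
    then show ?thesis using True cl TMu.prems components_self[of A "?T # Cs"] by auto
  next
    case False
    then show ?thesis using TMu.IH[of "?T # Cs"] TMu.prems cl by auto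
  qed
qed auto

lemma finite_component_closure:
  assumes "closed_ty A"
  obtains Ts where "A \<in> set Ts" "\<forall>T \<in> set Ts. closed_ty T \<and> parts T \<subseteq> set Ts"
proof -
  obtain Ts where Ts: "set Ts = components A []" using finite_components finite_list by blast
  show ?thesis
  proof (rule that[of Ts])
    show "A \<in> set Ts" using components_self[of A "[]"] assms by (simp add: Ts psubst_closed closed_ty_def psubst_scoped)
    show "\<forall>T \<in> set Ts. closed_ty T \<and> parts T \<subseteq> set Ts"
      using components_parts[of A "[]"] assms by (auto simp: Ts closed_ty_def)
  qed
qed

definition words_of :: "ty list \<Rightarrow> nat list set" where
  "words_of Ts = {concat (map word ds) | ds. list_all2 (\<lambda>d T. d \<in> carrier_of T) ds Ts}"

lemma words_of_Nil: "words_of [] = {[]}"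
  by (auto simp: words_of_def)

lemma words_of_Cons: "x \<in> words_of (T # Ts) \<longleftrightarrow> (\<exists>a \<in> carrier_of T. \<exists>w \<in> words_of Ts. x = word a @ w)"
proof
  assume "x \<in> words_of (T # Ts)"
  then obtain a ds where "x = word a @ concat (map word ds)" "a \<in> carrier_of T"
    "list_all2 (\<lambda>d T. d \<in> carrier_of T) ds Ts"
    by (auto simp: words_of_def list_all2_Cons2)
  then show "\<exists>a \<in> carrier_of T. \<exists>w \<in> words_of Ts. x = word a @ w" unfolding words_of_def by blast
next
  assume "\<exists>a \<in> carrier_of T. \<exists>w \<in> words_of Ts. x = word a @ w"
  then obtain a ds where "x = concat (map word (a # ds))" "list_all2 (\<lambda>d T. d \<in> carrier_of T) (a # ds) (T # Ts)"
    by (auto simp: words_of_def)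
  then show "x \<in> words_of (T # Ts)" unfolding words_of_def by blast
qed

definition type_index :: "ty list \<Rightarrow> ty \<Rightarrow> nat" where
  "type_index Ts T = (SOME i. i < length Ts \<and> Ts ! i = T)"

lemma type_index: "T \<in> set Ts \<Longrightarrow> type_index Ts T < length Ts \<and> Ts ! type_index Ts T = T"
  unfolding type_index_def by (rule someI_ex) (simp add: in_set_conv_nth)

text \<open>The types form a deterministic grammar for their words: the first letter
  \<open>x\<close> fixes the constructor, and the rest is the concatenation of words of values of
  the listed types.\<close>

definition unfold_types :: "ty \<Rightarrow> nat \<Rightarrow> ty list option" where
  "unfold_types T x = (case T of
     TOne \<Rightarrow> if x = 1 then Some [] else None
   | TSum A B \<Rightarrow> if x = 2 then Some [A] else if x = 3 then Some [B] else None
   | TProd A B \<Rightarrow> if x = 4 then Some [A, B] else None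
   | TMu A \<Rightarrow> if x = 5 then Some [ty_subst A 0 (TMu A)] else None
   | TVar n \<Rightarrow> None)"

lemma words_of_unfold:
  "closed_ty T \<Longrightarrow> x # w \<in> words_of (T # Ts) \<longleftrightarrow> (\<exists>Us. unfold_types T x = Some Us \<and> w \<in> words_of (Us @ Ts))"
  "[] \<notin> words_of (T # Ts)"
proof -
  show "closed_ty T \<Longrightarrow> x # w \<in> words_of (T # Ts) \<longleftrightarrow> (\<exists>Us. unfold_types T x = Some Us \<and> w \<in> words_of (Us @ Ts))"
  proof (cases T)
    case (TSum A B)
    then show ?thesis
      by (cases "x = 2"; cases "x = 3"; simp add: words_of_Cons unfold_types_def bex_Un)
  next
    case (TProd A B)
    have "(\<exists>a \<in> carrier_of (TProd A B). \<exists>v \<in> words_of Ts. x # w = word a @ v) \<longleftrightarrow>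
      x = 4 \<and> (\<exists>a \<in> carrier_of A. \<exists>b \<in> carrier_of B. \<exists>v \<in> words_of Ts. w = word a @ word b @ v)"
      by (auto 4 4)
    moreover have "w \<in> words_of (A # B # Ts) \<longleftrightarrow>
      (\<exists>a \<in> carrier_of A. \<exists>b \<in> carrier_of B. \<exists>v \<in> words_of Ts. w = word a @ word b @ v)"
      unfolding Bex_def words_of_Cons by blast
    ultimately show ?thesis unfolding TProd words_of_Cons[of "x # w"] by (simp add: unfold_types_def)
  next
    case (TMu A)
    assume "closed_ty T"
    then show ?thesis by (auto simp: TMu words_of_Cons unfold_types_def carrier_Mu)
  qed (auto simp: words_of_Cons unfold_types_def closed_ty_def[of "TVar _"])
  have "word a \<noteq> []" for a by (cases a) auto
  then show "[] \<notin> words_of (T # Ts)" by (auto simp: words_of_Cons)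
qed

lemma unfold_types_parts: "unfold_types T x = Some Us \<Longrightarrow> set Us \<subseteq> parts T"
  by (auto simp: unfold_types_def split: ty.splits if_splits)

text \<open>The first stack holds the types of the values that remain to be read from the second.\<close>

definition parser :: "nat \<Rightarrow> ty list \<Rightarrow> machine" where
  "parser h Ts q s t =
     (if q = h \<or> q = Suc h then (Suc h, olist s, olist t)
      else case (s, t) of
        (None, None) \<Rightarrow> (h, [], [])
      | (Some i, Some x) \<Rightarrow>
          (case if i < length Ts then unfold_types (Ts ! i) x else None of
             Some Us \<Rightarrow> (0, map (type_index Ts) Us, [])
           | None \<Rightarrow> (Suc h, [i], [x]))
      | _ \<Rightarrow> (Suc h, olist s, olist t))"

lemma transient_parser: "transient (parser h Ts) h"
  by (simp add: transient_def parser_def)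

lemma machine_ok_parser:
  assumes "\<forall>T \<in> set Ts. closed_ty T \<and> parts T \<subseteq> set Ts" "length Ts \<le> N" "Suc h < N"
  shows "machine_ok N (parser h Ts)"
proof -
  have "set (map (type_index Ts) Us) \<subseteq> {..<N}" if "i < length Ts" "unfold_types (Ts ! i) x = Some Us" for i x Us
  proof -
    have "set Us \<subseteq> set Ts" using unfold_types_parts[OF that(2)] assms(1) that(1) nth_mem by blast
    then show ?thesis using type_index assms(2) by fastforce
  qed
  then show ?thesis
    using assms(3) by (auto simp: machine_ok_def parser_def split: option.splits if_splits)
qed

lemma mstep_parser:
  assumes "0 < h"
  shows "mstep (parser h Ts) (0, [], []) = (h, [], [])"
    "mstep (parser h Ts) (0, i # l, []) = (Suc h, i # l, [])"
    "mstep (parser h Ts) (0, [], x # w) = (Suc h, [], x # w)"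
    "i < length Ts \<Longrightarrow> unfold_types (Ts ! i) x = None \<Longrightarrow>
      mstep (parser h Ts) (0, i # l, x # w) = (Suc h, i # l, x # w)"
    "i < length Ts \<Longrightarrow> unfold_types (Ts ! i) x = Some Us \<Longrightarrow>
      mstep (parser h Ts) (0, i # l, x # w) = (0, map (type_index Ts) Us @ l, w)"
  using assms by (simp_all add: parser_def)

text \<open>Every step that remains in state 0 consumes a letter. Hence the induction is on the
  input word, and unfolding a \<open>\<mu>\<close>-type, which may enlarge the type, does no
  harm.\<close>

lemma accepts_parser:
  assumes Ts: "\<forall>T \<in> set Ts. closed_ty T \<and> parts T \<subseteq> set Ts" and "0 < h"
  shows "set Us \<subseteq> set Ts \<Longrightarrow> accepts (parser h Ts) h (0, map (type_index Ts) Us, w) \<longleftrightarrow> w \<in> words_of Us"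
proof (induction w arbitrary: Us)
  let ?P = "parser h Ts"
  note acc = accepts_simps[OF transient_parser]
  note step = acc(3)[OF _ mstep_parser(1)[OF assms(2)]] acc(3)[OF _ mstep_parser(2)[OF assms(2)]]
    acc(3)[OF _ mstep_parser(3)[OF assms(2)]] acc(3)[OF _ mstep_parser(4)[OF assms(2)]]
    acc(3)[OF _ mstep_parser(5)[OF assms(2)]]
  {
    case Nil
    show ?case
      using assms(2) by (cases Us) (simp_all add: step acc(1,2) words_of_Nil words_of_unfold(2))
  next
    case (Cons x w)
    show ?case
    proof (cases Us)
      case Nil
      then show ?thesis using assms(2) by (simp add: step acc(2) words_of_Nil)
    next
      case (Cons T Vs)
      then have T: "T \<in> set Ts" "closed_ty T" using Cons.prems Ts by auto
      show ?thesis
      proof (cases "unfold_types T x")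
        case None
        then show ?thesis
          using assms(2) T type_index[OF T(1)] by (simp add: Cons step(4) acc(2) words_of_unfold)
      next
        case (Some Ws)
        have "set (Ws @ Vs) \<subseteq> set Ts"
          using unfold_types_parts[OF Some] Ts T Cons.prems Cons by auto
        from Cons.IH[OF this] show ?thesis
          using assms(2) T type_index[OF T(1)] Some by (simp add: Cons step(5) words_of_unfold)
      qed
    qed
  }
qed

section \<open>Turing machines\<close>

definition blank_nth :: "nat list \<Rightarrow> nat \<Rightarrow> nat" where
  "blank_nth l i = (if i < length l then l ! i else 0)"

lemma blank_nth_simps [simp]:
  "blank_nth [] i = 0" "blank_nth (x # l) 0 = x" "blank_nth (x # l) (Suc i) = blank_nth l i"
  by (simp_all add: blank_nth_def)

text \<open>The end of a stack stands for infinitely many blanks.\<close>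

definition osym :: "nat option \<Rightarrow> nat" where
  "osym s = (case s of None \<Rightarrow> 0 | Some x \<Rightarrow> x)"

lemma osym_simps [simp]: "osym None = 0" "osym (Some x) = x"
  by (simp_all add: osym_def)

lemma blank_nth_0: "blank_nth l 0 = osym (hd_opt l)"
  by (cases l) auto

lemma blank_nth_Suc: "blank_nth l (Suc i) = blank_nth (tl l) i"
  by (cases l) auto

text \<open>The first stack is the tape to the left of the head, nearest cell on top; the second is
  the cell under the head followed by the tape to its right. Halting is made visible as one
  additional step into state \<open>h\<close>, which keeps the final tape.\<close>

definition simulator :: "nat \<Rightarrow> tm \<Rightarrow> machine" where
  "simulator h \<delta> q s t =
     (if q = h \<or> q = Suc h then (Suc h, olist s, olist t)
      else case \<delta> (q, osym t) of
        None \<Rightarrow> (h, olist s, olist t)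
      | Some (q', x, MoveR) \<Rightarrow> (q', x # olist s, [])
      | Some (q', x, MoveL) \<Rightarrow> (q', [], [osym s, x]))"

lemma transient_simulator: "transient (simulator h \<delta>) h"
  by (simp add: transient_def simulator_def)

fun represents :: "nat \<Rightarrow> mconfig \<Rightarrow> config \<Rightarrow> bool" where
  "represents h (q, l, r) (q', t, p) \<longleftrightarrow> q = q' \<and> q < h \<and>
     (\<forall>i. t (p + int i) = blank_nth r i) \<and> (\<forall>i. t (p - 1 - int i) = blank_nth l i)"

lemma represents_start: "0 < h \<Longrightarrow> represents h (0, [], w) (tm_start w)"
  by (auto simp: tm_start_def blank_nth_def)

lemma represents_step:
  assumes R: "represents h m c" and bound: "\<forall>(q, x, d) \<in> ran \<delta>. q < h"
  shows "tm_step \<delta> c = Some c' \<Longrightarrow> represents h (mstep (simulator h \<delta>) m) c'"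
    "tm_step \<delta> c = None \<Longrightarrow> mstep (simulator h \<delta>) m = (h, snd m)"
proof -
  obtain q l r where m: "m = (q, l, r)" by (cases m)
  obtain t p where c: "c = (q, t, p)" using R by (cases c) (auto simp: m)
  have q: "q \<noteq> h" "q \<noteq> Suc h" using R by (auto simp: m c)
  have r: "t (p + int i) = blank_nth r i" and l: "t (p - 1 - int i) = blank_nth l i" for i
    using R by (auto simp: m c)
  have head: "t p = osym (hd_opt r)" using r[of 0] by (simp add: blank_nth_0)
  show "mstep (simulator h \<delta>) m = (h, snd m)" if "tm_step \<delta> c = None"
    using that q by (simp add: m c head simulator_def)
  show "represents h (mstep (simulator h \<delta>) m) c'" if "tm_step \<delta> c = Some c'"
  proof -
    from that obtain q' x d where \<delta>: "\<delta> (q, osym (hd_opt r)) = Some (q', x, d)"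
      and c': "c' = (q', t(p := x), move d p)"
      by (auto simp: c head)
    have q': "q' < h" using bound \<delta> by (force intro: ranI)
    show ?thesis
    proof (cases d)
      case MoveR
      have "(t(p := x)) (p + 1 + int i) = blank_nth (tl r) i" for i
        using r[of "Suc i"] by (simp add: blank_nth_Suc algebra_simps)
      moreover have "(t(p := x)) (p + 1 - 1 - int i) = blank_nth (x # l) i" for i
      proof (cases i)
        case (Suc j)
        then show ?thesis using l[of j] by (simp add: algebra_simps)
      qed simp
      ultimately show ?thesis
        using q q' by (simp add: m c' simulator_def \<delta> MoveR)
    next
      case MoveL
      have "(t(p := x)) (p - 1 + int i) = blank_nth (osym (hd_opt l) # x # tl r) i" for i
      proof (cases i)
        case 0
        then show ?thesis using l[of 0] by (simp add: blank_nth_0)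
      next
        case (Suc j)
        then show ?thesis using r[of j] by (cases j) (simp_all add: blank_nth_Suc algebra_simps)
      qed
      moreover have "(t(p := x)) (p - 1 - 1 - int i) = blank_nth (tl l) i" for i
        using l[of "Suc i"] by (simp add: blank_nth_Suc algebra_simps)
      ultimately show ?thesis
        using q q' by (simp add: m c' simulator_def \<delta> MoveL)
    qed
  qed
qed

text \<open>Each transition of the Turing machine is matched by one step, and the final
  configuration by one more step into \<open>h\<close>.\<close>

lemma simulator_complete:
  assumes "(c, c') \<in> {(c, c'). tm_step \<delta> c = Some c'}\<^sup>*" "tm_step \<delta> c' = None" "represents h m c"
    and bound: "\<forall>(q, x, d) \<in> ran \<delta>. q < h"
  shows "\<exists>n q l r. (mstep (simulator h \<delta>) ^^ n) m = (h, l, r) \<and> represents h (q, l, r) c'"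
  using assms(1,3)
proof (induction arbitrary: m rule: converse_rtrancl_induct)
  case base
  obtain q l r where m: "m = (q, l, r)" by (cases m)
  have "(mstep (simulator h \<delta>) ^^ 1) m = (h, l, r)"
    using represents_step(2)[OF base bound assms(2)] by (simp add: m)
  then show ?case using base m by blast
next
  case (step c d)
  then have "represents h (mstep (simulator h \<delta>) m) d"
    using represents_step(1)[OF step.prems bound] by simp
  from step.IH[OF this] obtain n q l r where
    "(mstep (simulator h \<delta>) ^^ n) (mstep (simulator h \<delta>) m) = (h, l, r)" "represents h (q, l, r) c'" by blast
  then have "(mstep (simulator h \<delta>) ^^ Suc n) m = (h, l, r)" by (simp only: funpow_Suc_right comp_apply)
  with \<open>represents h (q, l, r) c'\<close> show ?case by blast
qed

lemma simulator_sound: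
  assumes "(mstep (simulator h \<delta>) ^^ n) m = (h, l, r)" "represents h m c"
    and bound: "\<forall>(q, x, d) \<in> ran \<delta>. q < h"
  shows "\<exists>q c'. (c, c') \<in> {(c, c'). tm_step \<delta> c = Some c'}\<^sup>* \<and> tm_step \<delta> c' = None \<and> represents h (q, l, r) c'"
  using assms(1,2)
proof (induction n arbitrary: m c)
  \<comment> \<open>A represented configuration has a state below \<open>h\<close>, so the accepting
    state cannot be reached in no steps.\<close>
  case 0
  then show ?case by (cases c) auto
next
  case (Suc n)
  have run: "(mstep (simulator h \<delta>) ^^ n) (mstep (simulator h \<delta>) m) = (h, l, r)"
    using Suc.prems(1) by (simp only: funpow_Suc_right comp_apply)
  show ?case
  proof (cases "tm_step \<delta> c")
    case None
    then have m: "mstep (simulator h \<delta>) m = (h, snd m)" using represents_step(2)[OF Suc.prems(2) bound] by blast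
    \<comment> \<open>The step just made enters \<open>h\<close>; any further step would lead into
      the dead state, contrary to being in \<open>h\<close> at the end.\<close>
    have "n = 0"
    proof (rule ccontr)
      assume "n \<noteq> 0"
      then have "fst ((mstep (simulator h \<delta>) ^^ n) (h, snd m)) = Suc h"
        using transient_dead[OF transient_simulator, of "(h, snd m)" h "n - 1" \<delta>] by simp
      then show False using run m by simp
    qed
    then have "snd m = (l, r)" using run m by simp
    then have "represents h (fst m, l, r) c" using Suc.prems(2) by (metis prod.collapse)
    then show ?thesis using None by blast
  next
    case (Some d)
    from Suc.IH[OF run represents_step(1)[OF Suc.prems(2) bound Some]] obtain q c' where
      "(d, c') \<in> {(c, c'). tm_step \<delta> c = Some c'}\<^sup>*" "tm_step \<delta> c' = None" "represents h (q, l, r) c'" by blast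
    then show ?thesis using Some by (blast intro: converse_rtrancl_into_rtrancl)
  qed
qed

lemma machine_ok_simulator:
  assumes "\<forall>(q, x, d) \<in> ran \<delta>. q < h \<and> x < N" "Suc h < N"
  shows "machine_ok N (simulator h \<delta>)"
  unfolding machine_ok_def
proof (intro allI impI)
  fix q s t assume *: "q < N" "set (olist s) \<subseteq> {..<N}" "set (olist t) \<subseteq> {..<N}"
  have "osym s < N" using *(2) assms(2) by (cases s) auto
  moreover have "q' < N \<and> x < N" if "\<delta> (q, osym t) = Some (q', x, d)" for q' x d
    using assms that by (force dest: ranI)
  ultimately show "case simulator h \<delta> q s t of (q', u, v) \<Rightarrow> q' < N \<and> set u \<subseteq> {..<N} \<and> set v \<subseteq> {..<N}"
    using * assms(2) by (auto simp: simulator_def split: option.splits dir.splits)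
qed

text \<open>The first stack holds the tape from the head on, the second the expected output. Equal
  nonblank symbols are removed in pairs. When the expected word is exhausted, \<open>osym t\<close>
  is 0, so the equality of symbols requires a blank on the tape, as the output convention does; a
  blank inside the expected word is rejected.\<close>

definition comparator :: "nat \<Rightarrow> machine" where
  "comparator h q s t =
     (if q \<noteq> h \<and> q \<noteq> Suc h \<and> osym s = osym t
      then if t = None then (h, [], []) else if osym t \<noteq> 0 then (0, [], []) else (Suc h, olist s, olist t)
      else (Suc h, olist s, olist t))"

lemma transient_comparator: "transient (comparator h) h"
  by (simp add: transient_def comparator_def)

lemma machine_ok_comparator: "Suc h < N \<Longrightarrow> machine_ok N (comparator h)"
  by (auto simp: machine_ok_def comparator_def)

definition output_word :: "nat list \<Rightarrow> nat list \<Rightarrow> bool" where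
  "output_word r v \<longleftrightarrow> (\<forall>i < length v. blank_nth r i = v ! i \<and> v ! i \<noteq> 0) \<and> blank_nth r (length v) = 0"

lemma output_word_Nil: "output_word r [] \<longleftrightarrow> osym (hd_opt r) = 0"
  by (simp add: output_word_def blank_nth_0)

lemma output_word_Cons: "output_word r (y # v) \<longleftrightarrow> osym (hd_opt r) = y \<and> y \<noteq> 0 \<and> output_word (tl r) v"
  by (auto simp: output_word_def less_Suc_eq_0_disj blank_nth_0 blank_nth_Suc)

text \<open>The output ends at the first blank and contains none, so its length is determined by the
  tape.\<close>

lemma output_word_unique: "output_word r v \<Longrightarrow> output_word r w \<Longrightarrow> v = w"
proof (induction v arbitrary: r w)
  case Nil
  then show ?case by (cases w) (auto simp: output_word_Nil output_word_Cons)
next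
  case (Cons y v)
  then show ?case by (cases w) (auto simp: output_word_Nil output_word_Cons)
qed

lemma tm_output_represents: "represents h (q, l, r) c \<Longrightarrow> tm_output c v \<longleftrightarrow> output_word r v"
  by (cases c) (auto simp: output_word_def)

lemma mstep_comparator:
  assumes "0 < h"
  shows "mstep (comparator h) (0, r, []) = (if osym (hd_opt r) = 0 then h else Suc h, if osym (hd_opt r) = 0 then tl r else r, [])"
    "mstep (comparator h) (0, r, y # v) =
      (if osym (hd_opt r) = y \<and> y \<noteq> 0 then (0, tl r, v) else (Suc h, r, y # v))"
  using assms by (simp_all add: comparator_def)

lemma accepts_comparator:
  assumes "0 < h"
  shows "accepts (comparator h) h (0, r, v) \<longleftrightarrow> output_word r v"
proof (induction v arbitrary: r)
  case Nil
  show ?case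
    using assms accepts_simps(3)[OF transient_comparator _ mstep_comparator(1)[OF assms]]
    by (simp add: accepts_simps(1,2)[OF transient_comparator] output_word_Nil)
next
  case (Cons y v)
  show ?case
    using assms accepts_simps(3)[OF transient_comparator _ mstep_comparator(2)[OF assms]] Cons
    by (simp add: accepts_simps(2)[OF transient_comparator] output_word_Cons)
qed

text \<open>Polish notation is a prefix code: the first letter fixes the constructor. The arbitrary
  continuations \<open>u\<close> and \<open>v\<close> are what lets the induction pass through
  pairs.\<close>

lemma word_append_inject: "word a @ u = word b @ v \<Longrightarrow> a = b \<and> u = v"
proof (induction a arbitrary: b u v)
  case DUnit
  then show ?case by (cases b) auto
next
  case (DInl a)
  from DInl.prems obtain b' where b: "b = DInl b'" by (cases b) auto
  with DInl.prems have "word a @ u = word b' @ v" by simp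
  from DInl.IH[OF this] show ?case by (simp add: b)
next
  case (DInr a)
  from DInr.prems obtain b' where b: "b = DInr b'" by (cases b) auto
  with DInr.prems have "word a @ u = word b' @ v" by simp
  from DInr.IH[OF this] show ?case by (simp add: b)
next
  case (DFold a)
  from DFold.prems obtain b' where b: "b = DFold b'" by (cases b) auto
  with DFold.prems have "word a @ u = word b' @ v" by simp
  from DFold.IH[OF this] show ?case by (simp add: b)
next
  case (DPair a1 a2)
  from DPair.prems obtain b1 b2 where b: "b = DPair b1 b2" by (cases b) auto
  with DPair.prems have "word a1 @ (word a2 @ u) = word b1 @ (word b2 @ v)" by simp
  from DPair.IH(1)[OF this] have "a1 = b1" "word a2 @ u = word b2 @ v" by simp_all
  with DPair.IH(2)[OF this(2)] show ?case by (simp add: b)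
qed

lemma word_inject: "word a = word b \<longleftrightarrow> a = b"
  using word_append_inject[of a "[]" b "[]"] by auto

text \<open>The running times of the three machines serve as a certificate because they are unique.\<close>

definition certified :: "nat \<Rightarrow> tm \<Rightarrow> ty list \<Rightarrow> nat \<Rightarrow> nat list \<Rightarrow> nat list \<Rightarrow> nat \<Rightarrow> nat \<Rightarrow> nat \<Rightarrow> bool" where
  "certified h \<delta> Ts i w v l m n \<longleftrightarrow> accepts_in (parser h Ts) h l (0, [i], w) \<and>
     accepts_in (simulator h \<delta>) h m (0, [], w) \<and>
     accepts_in (comparator h) h n (0, snd (snd ((mstep (simulator h \<delta>) ^^ m) (0, [], w))), v)"

lemma certified_unique:
  "certified h \<delta> Ts i w v l m n \<Longrightarrow> certified h \<delta> Ts i w v l' m' n' \<Longrightarrow> l = l' \<and> m = m' \<and> n = n'"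
  unfolding certified_def
  using accepts_in_unique transient_parser transient_simulator transient_comparator by metis

text \<open>The machine is known to compute \<open>f\<close> only on words of values of
  \<open>A\<close>, and the parser confines \<open>w\<close> to these. On them, halting excludes
  that \<open>f\<close> is undefined, and determinism identifies the output.\<close>

lemma certified_iff:
  assumes \<delta>: "\<forall>a \<in> carrier_of A. case f a of
        None \<Rightarrow> \<not> (\<exists>c. tm_final \<delta> (word a) c)
      | Some b \<Rightarrow> \<exists>c. tm_final \<delta> (word a) c \<and> tm_output c (word b)"
    and Ts: "A \<in> set Ts" "\<forall>T \<in> set Ts. closed_ty T \<and> parts T \<subseteq> set Ts"
    and h: "0 < h" "\<forall>(q, x, d) \<in> ran \<delta>. q < h"
  shows "(\<exists>l m n. certified h \<delta> Ts (type_index Ts A) w v l m n) \<longleftrightarrow>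
    (\<exists>a b. a \<in> carrier_of A \<and> f a = Some b \<and> w = word a \<and> v = word b)"
proof -
  let ?S = "simulator h \<delta>"
  have final: "(\<exists>c. tm_final \<delta> w c \<and> tm_output c v) \<longleftrightarrow>
    (\<exists>m l r. (mstep ?S ^^ m) (0, [], w) = (h, l, r) \<and> output_word r v)" for w v
  proof
    assume "\<exists>c. tm_final \<delta> w c \<and> tm_output c v"
    then obtain c where "tm_final \<delta> w c" "tm_output c v" by blast
    moreover then obtain m q l r where "(mstep ?S ^^ m) (0, [], w) = (h, l, r)" "represents h (q, l, r) c"
      unfolding tm_final_def using simulator_complete[OF _ _ represents_start[OF h(1)] h(2)] by blast
    ultimately show "\<exists>m l r. (mstep ?S ^^ m) (0, [], w) = (h, l, r) \<and> output_word r v"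
      using tm_output_represents by blast
  next
    assume "\<exists>m l r. (mstep ?S ^^ m) (0, [], w) = (h, l, r) \<and> output_word r v"
    then obtain m l r where "(mstep ?S ^^ m) (0, [], w) = (h, l, r)" "output_word r v" by blast
    then show "\<exists>c. tm_final \<delta> w c \<and> tm_output c v"
      using simulator_sound[OF _ represents_start[OF h(1)] h(2)] tm_output_represents
      unfolding tm_final_def by blast
  qed
  have unique: "v = v'" if fin: "tm_final \<delta> w c" "tm_output c v" "tm_final \<delta> w c'" "tm_output c' v'" for w c v c' v'
  proof -
    obtain m l r where m: "(mstep ?S ^^ m) (0, [], w) = (h, l, r)" "output_word r v"
      using final fin(1,2) by blast
    obtain m' l' r' where m': "(mstep ?S ^^ m') (0, [], w) = (h, l', r')" "output_word r' v'"
      using final fin(3,4) by blast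
    \<comment> \<open>Both runs are simulated from the same configuration and the accepting state is
      entered only once, so they stop at the same time with the same tape.\<close>
    have "m = m'"
      using m m' by (intro accepts_in_unique[OF transient_simulator, of h \<delta> _ "(0, [], w)"]) (auto simp: accepts_in_def)
    then show ?thesis using m m' output_word_unique by simp
  qed
  have parse: "(\<exists>l. accepts_in (parser h Ts) h l (0, [type_index Ts A], w)) \<longleftrightarrow> w \<in> word ` carrier_of A"
    using accepts_parser[OF Ts(2) h(1), of "[A]" w] Ts(1)
    by (auto simp: accepts_def words_of_Cons words_of_Nil)
  have compare: "(\<exists>n. accepts_in (comparator h) h n (0, r, v)) \<longleftrightarrow> output_word r v" for r
    using accepts_comparator[OF h(1)] by (simp add: accepts_def)
  have "(\<exists>l m n. certified h \<delta> Ts (type_index Ts A) w v l m n) \<longleftrightarrow>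
    w \<in> word ` carrier_of A \<and> (\<exists>m. fst ((mstep ?S ^^ m) (0, [], w)) = h \<and>
      output_word (snd (snd ((mstep ?S ^^ m) (0, [], w)))) v)"
    unfolding certified_def accepts_in_def[of ?S] using parse compare by blast
  also have "\<dots> \<longleftrightarrow> w \<in> word ` carrier_of A \<and> (\<exists>c. tm_final \<delta> w c \<and> tm_output c v)"
    unfolding final by (metis prod.collapse fst_conv snd_conv)
  also have "\<dots> \<longleftrightarrow> (\<exists>a b. a \<in> carrier_of A \<and> f a = Some b \<and> w = word a \<and> v = word b)"
  proof
    assume "w \<in> word ` carrier_of A \<and> (\<exists>c. tm_final \<delta> w c \<and> tm_output c v)"
    then obtain a c where a: "a \<in> carrier_of A" "w = word a" and c: "tm_final \<delta> w c" "tm_output c v" by blast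
    \<comment> \<open>The final configuration \<open>c\<close> rules out the case that
      \<open>f a\<close> is undefined.\<close>
    from bspec[OF \<delta> a(1)] obtain b c' where b: "f a = Some b" "tm_final \<delta> (word a) c'" "tm_output c' (word b)"
      using c a by (cases "f a") (auto simp del: split_paired_All split_paired_Ex tm_output.simps)
    have "v = word b" using unique[OF c] b(2,3) a(2) by blast
    with a b show "\<exists>a b. a \<in> carrier_of A \<and> f a = Some b \<and> w = word a \<and> v = word b" by blast
  next
    assume "\<exists>a b. a \<in> carrier_of A \<and> f a = Some b \<and> w = word a \<and> v = word b"
    then show "w \<in> word ` carrier_of A \<and> (\<exists>c. tm_final \<delta> w c \<and> tm_output c v)"
      using \<delta> by fastforce
  qed
  finally show ?thesis .
qed

lemma rep_words:
  assumes f: "partial_injection (carrier_of A) Y f" "computable_on (carrier_of A) f" and A: "closed_ty A"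
  obtains N where "6 \<le> N" "rep (TWord N) (TWord N) {(dword w, dword v) | w v. set w \<subseteq> {..<N} \<and> set v \<subseteq> {..<N} \<and>
    (\<exists>a b. a \<in> carrier_of A \<and> f a = Some b \<and> w = word a \<and> v = word b)}"
proof -
  obtain \<delta> where \<delta>: "finite (dom \<delta>)" "\<forall>a \<in> carrier_of A. case f a of
        None \<Rightarrow> \<not> (\<exists>c. tm_final \<delta> (word a) c)
      | Some b \<Rightarrow> \<exists>c. tm_final \<delta> (word a) c \<and> tm_output c (word b)"
    using f(2) unfolding computable_on_def by blast
  obtain Ts where Ts: "A \<in> set Ts" "\<forall>T \<in> set Ts. closed_ty T \<and> parts T \<subseteq> set Ts"
    using finite_component_closure[OF A] .
  have "finite ((\<lambda>(q, x, d). q) ` ran \<delta>)" "finite ((\<lambda>(q, x, d). x) ` ran \<delta>)"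
    using \<delta>(1) by (simp_all add: finite_ran)
  then obtain q0 x0 where q0: "\<forall>q \<in> (\<lambda>(q, x, d). q) ` ran \<delta>. q < q0" and x0: "\<forall>x \<in> (\<lambda>(q, x, d). x) ` ran \<delta>. x < x0"
    by (meson finite_nat_set_iff_bounded)
  \<comment> \<open>The successor makes \<open>h\<close> positive, hence different from the start
    state 0, even if the transition table is empty.\<close>
  define h where "h = Suc q0"
  \<comment> \<open>One bound for everything that occurs in configurations: states up to the dead
    state \<open>Suc h\<close>, written tape symbols, indices of types in \<open>Ts\<close>, and the
    letters of words, which are below 6.\<close>
  define N where "N = h + x0 + length Ts + 6"
  have h: "0 < h" "\<forall>(q, x, d) \<in> ran \<delta>. q < h" using q0 by (fastforce simp: h_def)+
  have N: "6 \<le> N" "0 < N" "Suc h < N" "length Ts \<le> N" by (simp_all add: N_def)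
  have bound: "\<forall>(q, x, d) \<in> ran \<delta>. q < h \<and> x < N" using h(2) x0 by (fastforce simp: N_def)
  let ?W = "TWord N" and ?N3 = "TProd TNat (TProd TNat TNat)"
  let ?i = "type_index Ts A"
  have i: "?i < N" using type_index[OF Ts(1)] N(4) by simp
  let ?X = "TProd ?W (TProd ?W ?N3)"
  note ok = machine_ok_parser[OF Ts(2) N(4,3)] machine_ok_simulator[OF bound N(3)] machine_ok_comparator[OF N(3)]
  have d3: "dup TNat" "dup (TProd TNat TNat)" "dup ?N3" "dup (TProd ?W ?N3)" "dup ?W"
    by (intro dup_prod dup_nat dup_word)+
  have w: "comp_fun ?X ?W dfst" by (intro comp_fun_fst d3) simp
  have s: "comp_fun ?X (TProd ?W ?N3) dsnd" by (intro comp_fun_snd d3) simp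
  have v: "comp_fun ?X ?W (\<lambda>p. dfst (dsnd p))" by (rule comp_fun_comp[OF s comp_fun_fst]) (simp_all add: d3)
  have s2: "comp_fun ?X ?N3 (\<lambda>p. dsnd (dsnd p))" by (rule comp_fun_comp[OF s comp_fun_snd]) (simp_all add: d3)
  have l: "comp_fun ?X TNat (\<lambda>p. dfst (dsnd (dsnd p)))" by (rule comp_fun_comp[OF s2 comp_fun_fst]) (simp_all add: d3)
  have s3: "comp_fun ?X (TProd TNat TNat) (\<lambda>p. dsnd (dsnd (dsnd p)))" by (rule comp_fun_comp[OF s2 comp_fun_snd]) (simp_all add: d3)
  have m: "comp_fun ?X TNat (\<lambda>p. dfst (dsnd (dsnd (dsnd p))))" by (rule comp_fun_comp[OF s3 comp_fun_fst]) (simp_all add: d3)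
  have n: "comp_fun ?X TNat (\<lambda>p. dsnd (dsnd (dsnd (dsnd p))))" by (rule comp_fun_comp[OF s3 comp_fun_snd]) (simp_all add: d3)
  let ?sim = "\<lambda>p. drun (simulator h \<delta>) (DPair (DPair (dfin 0) (DPair (dword []) (dfst p))) (dfst (dsnd (dsnd (dsnd p)))))"
  have sim: "comp_fun ?X (TConfig N) ?sim"
    by (rule comp_fun_run[OF ok(2) N(2) comp_fun_dword w m]) simp_all
  have right: "comp_fun (TConfig N) ?W (\<lambda>c. dsnd (dsnd c))"
    unfolding TConfig_def by (rule comp_fun_comp[OF comp_fun_snd comp_fun_snd]) (auto intro: dup_prod dup_word)
  \<comment> \<open>The three running times are components of \<open>p\<close>, so each run is a
    total function of \<open>p\<close>. The comparator is started on the right stack that the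
    simulation has reached.\<close>
  have dec: "decidable ?X (\<lambda>p.
      dfst (drun (parser h Ts) (DPair (DPair (dfin 0) (DPair (dword [?i]) (dfst p))) (dfst (dsnd (dsnd p))))) = dfin h \<and>
      dfst (?sim p) = dfin h \<and>
      dfst (drun (comparator h) (DPair (DPair (dfin 0) (DPair (dsnd (dsnd (?sim p))) (dfst (dsnd p))))
        (dsnd (dsnd (dsnd (dsnd p)))))) = dfin h)"
    by (rule decidable_conj[OF decidable_state[OF comp_fun_run[OF ok(1) N(2) comp_fun_dword w l]]
          decidable_conj[OF decidable_state[OF sim]
            decidable_state[OF comp_fun_run[OF ok(3) N(2) comp_fun_comp[OF sim right] v n]]]])
      (use i in simp_all)
  define P where "P x y c \<longleftrightarrow> (\<exists>w v l m n. x = dword w \<and> y = dword v \<and> c = DPair (dnat l) (DPair (dnat m) (dnat n)) \<and>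
    certified h \<delta> Ts ?i w v l m n)" for x y c
  have drun': "drun M (DPair (DPair (dfin q) (DPair (dword l) (dword r))) (dnat n)) = dconfig ((mstep M ^^ n) (q, l, r))"
    for M q l r n using drun[of M "(q, l, r)" n] by simp
  have dfst_dconfig: "dfst (dconfig c) = dfin (fst c)" and dsnd_dconfig: "dsnd (dsnd (dconfig c)) = dword (snd (snd c))" for c
    by (cases c; simp)+
  have decP: "decidable ?X (\<lambda>p. P (dfst p) (dfst (dsnd p)) (dsnd (dsnd p)))"
  proof (rule decidable_cong[OF dec])
    fix p assume "p \<in> carrier_of ?X"
    then obtain w v l m n where p: "p = DPair (dword w) (DPair (dword v) (DPair (dnat l) (DPair (dnat m) (dnat n))))"
      by (auto simp: carrier_TWord carrier_TNat)
    have P: "P (dword w) (dword v) (DPair (dnat l) (DPair (dnat m) (dnat n))) \<longleftrightarrow> certified h \<delta> Ts ?i w v l m n"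
      by (simp add: P_def)
    show "(dfst (drun (parser h Ts) (DPair (DPair (dfin 0) (DPair (dword [?i]) (dfst p))) (dfst (dsnd (dsnd p))))) = dfin h \<and>
      dfst (?sim p) = dfin h \<and>
      dfst (drun (comparator h) (DPair (DPair (dfin 0) (DPair (dsnd (dsnd (?sim p))) (dfst (dsnd p))))
        (dsnd (dsnd (dsnd (dsnd p)))))) = dfin h) \<longleftrightarrow> P (dfst p) (dfst (dsnd p)) (dsnd (dsnd p))"
      unfolding p dfst.simps dsnd.simps P drun' dfst_dconfig dsnd_dconfig dfin_inject certified_def accepts_in_def
      by (rule refl)
  qed
  have cert: "(\<exists>l m n. certified h \<delta> Ts ?i w v l m n) \<longleftrightarrow>
    (\<exists>a b. a \<in> carrier_of A \<and> f a = Some b \<and> w = word a \<and> v = word b)" for w v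
    by (rule certified_iff[OF \<delta>(2) Ts h])
  have u1: "y = y' \<and> c = c'" if "P x y c" "P x y' c'" for x y c y' c'
  proof -
    obtain w v l m n where 1: "x = dword w" "y = dword v" "c = DPair (dnat l) (DPair (dnat m) (dnat n))"
      "certified h \<delta> Ts ?i w v l m n" using \<open>P x y c\<close> by (auto simp: P_def)
    obtain w' v' l' m' n' where 2: "x = dword w'" "y' = dword v'" "c' = DPair (dnat l') (DPair (dnat m') (dnat n'))"
      "certified h \<delta> Ts ?i w' v' l' m' n'" using \<open>P x y' c'\<close> by (auto simp: P_def)
    have "w = w'" using 1(1) 2(1) by simp
    \<comment> \<open>\<open>word_inject\<close> recovers the value from \<open>w\<close>, and
      \<open>f\<close> is single-valued.\<close>
    moreover have "v = v'" using cert[of w v] cert[of w' v'] 1(4) 2(4) \<open>w = w'\<close> by (auto simp: word_inject)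
    ultimately show ?thesis using certified_unique 1 2 by blast
  qed
  have u2: "x = x' \<and> c = c'" if "P x y c" "P x' y c'" for x y c x' c'
  proof -
    obtain w v l m n where 1: "x = dword w" "y = dword v" "c = DPair (dnat l) (DPair (dnat m) (dnat n))"
      "certified h \<delta> Ts ?i w v l m n" using \<open>P x y c\<close> by (auto simp: P_def)
    obtain w' v' l' m' n' where 2: "x' = dword w'" "y = dword v'" "c' = DPair (dnat l') (DPair (dnat m') (dnat n'))"
      "certified h \<delta> Ts ?i w' v' l' m' n'" using \<open>P x' y c'\<close> by (auto simp: P_def)
    obtain a b where a: "f a = Some b" "w = word a" "v = word b" using cert[of w v] 1(4) by blast
    obtain a' b' where a': "f a' = Some b'" "w' = word a'" "v' = word b'" using cert[of w' v'] 2(4) by blast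
    have "v = v'" using 1(2) 2(2) by simp
    then have "f a = f a'" using a a' by (simp add: word_inject)
    \<comment> \<open>Injectivity of \<open>f\<close> enters here: it is what makes the certificate
      unique when the search starts from the output.\<close>
    then have "a = a'" using f(1) a(1) a'(1) by (auto simp: partial_injection_def inj_on_def dom_def)
    then have "w = w'" using a a' by simp
    then show ?thesis using certified_unique 1 2 \<open>v = v'\<close> by blast
  qed
  have "rep ?W ?W {(x, y) | x y. x \<in> carrier_of ?W \<and> y \<in> carrier_of ?W \<and> (\<exists>c \<in> carrier_of ?N3. P x y c)}"
    by (rule rep_by_unique_certificate[OF decP enumerable_word enumerable_word _ u1 u2])
      (auto intro: enumerable_prod enumerable_nat N(2))
  moreover have "(\<exists>c \<in> carrier_of ?N3. P (dword w) (dword v) c) \<longleftrightarrow> (\<exists>l m n. certified h \<delta> Ts ?i w v l m n)" for w v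
  proof
    assume "\<exists>l m n. certified h \<delta> Ts ?i w v l m n"
    then obtain l m n where "certified h \<delta> Ts ?i w v l m n" by blast
    then have "P (dword w) (dword v) (DPair (dnat l) (DPair (dnat m) (dnat n)))" by (auto simp: P_def)
    then show "\<exists>c \<in> carrier_of ?N3. P (dword w) (dword v) c" by (rule bexI) (simp add: carrier_TNat)
  qed (unfold P_def dword_inject, blast)
  then have "{(x, y) | x y. x \<in> carrier_of ?W \<and> y \<in> carrier_of ?W \<and> (\<exists>c \<in> carrier_of ?N3. P x y c)} =
    {(dword w, dword v) | w v. set w \<subseteq> {..<N} \<and> set v \<subseteq> {..<N} \<and> (\<exists>l m n. certified h \<delta> Ts ?i w v l m n)}"
    unfolding carrier_TWord by blast
  ultimately show ?thesis
    using that[OF N(1)] by (simp only: cert)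
qed

theorem mainTheorem3:
  fixes A B :: ty and f :: "dat \<rightharpoonup> dat"
  assumes "closed_ty A" and "closed_ty B"
    and "partial_injection (carrier_of A) (carrier_of B) f"
    and "computable_on (carrier_of A) f"
  shows "\<exists>\<omega>. iso_typed Map.empty \<omega> (TIso A B) \<and> closed_iso_den \<omega> = arcs f"
proof -
  obtain N where N: "6 \<le> N" "rep (TWord N) (TWord N) {(dword w, dword v) | w v. set w \<subseteq> {..<N} \<and> set v \<subseteq> {..<N} \<and>
    (\<exists>a b. a \<in> carrier_of A \<and> f a = Some b \<and> w = word a \<and> v = word b)}" (is "rep _ _ ?R")
    using rep_words[OF assms(3,4,1)] .
  have set: "set (word a) \<subseteq> {..<N}" for a using set_word[of a] N(1) by auto
  have f: "a \<in> carrier_of A \<and> b \<in> carrier_of B" if "f a = Some b" for a b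
    using assms(3) that by (auto simp: partial_injection_def dom_def ran_def)
  \<comment> \<open>The bound on letters and the typing of \<open>a\<close> are automatic, so
    \<open>?R\<close> is exactly the image of the graph of \<open>f\<close> under passage to
    words.\<close>
  have R: "?R = {(dword (word a), dword (word b)) | a b. f a = Some b}"
    using set f by blast
  \<comment> \<open>Encode the argument as a word, apply the relation on words, and decode by the
    inverse of the encoding for \<open>B\<close>.\<close>
  have "rep A B ({(a, dword (word a)) | a. a \<in> carrier_of A} O ?R O {(b, dword (word b)) | b. b \<in> carrier_of B}\<inverse>)"
    by (intro rep_comp[OF rep_word rep_comp[OF N(2) rep_converse[OF rep_word]]] N(1) assms)
  also have "\<dots> = {(a, b) | a b. f a = Some b}"
    unfolding R using f by (auto simp: word_inject relcomp_unfold)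
  finally have "\<exists>\<omega>. iso_typed Map.empty \<omega> (TIso A B) \<and> closed_iso_den \<omega> = arc {(a, b) | a b. f a = Some b}"
    by (rule rep_iso)
  moreover have "arc {(a, b) | a b. f a = Some b} = arcs f"
    by (simp add: arc_def arcs_def)
  ultimately show ?thesis by (simp only:)
qed

end
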